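(* For every integer $m\ge2$, every irreducible reversible Markov kernel $P$ on $m$ states, and every $n\ge1$, $$\operatorname{Gap}(\widetilde P_n)\ge\frac{1}{1080\,m}\,\frac{\operatorname{Gap}(P)}{n}.$$ For the optimal quantities $c_m^\star$ and $C_m^{\mathrm{opt}}$ this implies $$c_m^\star\ge\frac1{1080\,m},\qquad C_m^{\mathrm{opt}}\le1080\,m.$$
   Context: Let $\Omega$ be a finite set with $|\Omega|=m$, and let $P$ be an irreducible Markov kernel (stochastic matrix) on $\Omega$ that is reversible with respect to its stationary law $\pi$, i.e. $\pi_xP(x,y)=\pi_yP(y,x)$. Let $1=\lambda_1>\lambda_2\ge\cdots\ge\lambda_m\ge-1$ be the eigenvalues of $P$ in $L^2(\pi)$. "Gap" always means the right spectral gap: $\operatorname{Gap}(P)=1-\lambda_2$ (one minus the second largest eigenvalue, counted with multiplicity). Let $(X_t)_{t\in\mathbb Z}$ be a stationary two-sided Markov chain with kernel $P$ and marginal law $\pi$. For a window length $n\ge1$ put $K_t=\sum_{j=0}^{n-1}e_{X_{t+j}}\in\mathbb Z_+^\Omega$, where $e_x$ is the coordinate vector indexed by $x$. Let $\mu_n$ be the law of $K_0$ and $\mathsf S_n=\operatorname{supp}(\mu_n)$. The projected count kernel $\widetilde P_n$ is the Markov kernel on $\mathsf S_n$ defined by $\mu_n(k)\widetilde P_n(k,\ell)=\mathbb P(K_0=k,K_1=\ell)$; it is reversible with respect to $\mu_n$ and irreducible on $\mathsf S_n$. $\operatorname{Gap}(\widetilde P_n)$ is its right spectral gap on $\mathsf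 S_n$; if $\mathsf S_n$ is a singleton, $\operatorname{Gap}(\widetilde P_n)=1$ by convention. Define $$c_m^\star=\inf\frac{n\operatorname{Gap}(\widetilde P_n)}{\operatorname{Gap}(P)},\qquad C_m^{\mathrm{opt}}=(c_m^\star)^{-1},$$ where the infimum is over all irreducible reversible Markov kernels $P$ on a set $\Omega$ with $|\Omega|=m$ and all integers $n\ge2$. *)

theory Defs
  imports "HOL-Probability.Probability" "Jordan_Normal_Form.Char_Poly"
begin

section \<open>Finite Markov kernels and the right spectral gap\<close>

text \<open>A kernel on a finite set S is a function of two arguments; only its values on S are used.\<close>

definition stochastic_on :: "'a set \<Rightarrow> ('a \<Rightarrow> 'a \<Rightarrow> real) \<Rightarrow> bool" where
  "stochastic_on S P \<longleftrightarrow>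
     (\<forall>x\<in>S. \<forall>y\<in>S. 0 \<le> P x y) \<and> (\<forall>x\<in>S. (\<Sum>y\<in>S. P x y) = 1)"

definition irreducible_on :: "'a set \<Rightarrow> ('a \<Rightarrow> 'a \<Rightarrow> real) \<Rightarrow> bool" where
  "irreducible_on S P \<longleftrightarrow>
     (\<forall>x\<in>S. \<forall>y\<in>S. (x, y) \<in> {(u, v). u \<in> S \<and> v \<in> S \<and> P u v > 0}\<^sup>*)"

definition stationary_law :: "'a set \<Rightarrow> ('a \<Rightarrow> 'a \<Rightarrow> real) \<Rightarrow> ('a \<Rightarrow> real) \<Rightarrow> bool" where
  "stationary_law S P \<pi> \<longleftrightarrow>
     (\<forall>x\<in>S. 0 \<le> \<pi> x) \<and> (\<Sum>x\<in>S. \<pi> x) = 1 \<and> (\<forall>y\<in>S. (\<Sum>x\<in>S. \<pi> x * P x y) = \<pi> y)"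

definition reversible_on :: "'a set \<Rightarrow> ('a \<Rightarrow> 'a \<Rightarrow> real) \<Rightarrow> ('a \<Rightarrow> real) \<Rightarrow> bool" where
  "reversible_on S P \<pi> \<longleftrightarrow> (\<forall>x\<in>S. \<forall>y\<in>S. \<pi> x * P x y = \<pi> y * P y x)"

definition irreducible_reversible_kernel ::
    "'a set \<Rightarrow> ('a \<Rightarrow> 'a \<Rightarrow> real) \<Rightarrow> ('a \<Rightarrow> real) \<Rightarrow> bool" where
  "irreducible_reversible_kernel S P \<pi> \<longleftrightarrow>
     finite S \<and> stochastic_on S P \<and> irreducible_on S P \<and>
     stationary_law S P \<pi> \<and> reversible_on S P \<pi>"

text \<open>
  The eigenvalues with multiplicity are the roots of the characteristic polynomial, which does not
  depend on the enumeration of S. For an irreducible reversible kernel, the matrix is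
  diagonalizable with real spectrum (the law is positive on S and P is self-adjoint in the
  weighted L2 space), so these are card S real numbers, and algebraic and geometric
  multiplicities agree.
\<close>

definition kernel_matrix :: "'a set \<Rightarrow> ('a \<Rightarrow> 'a \<Rightarrow> real) \<Rightarrow> real mat" where
  "kernel_matrix S P =
     mat (card S) (card S) (\<lambda>(i, j). P (from_nat_into S i) (from_nat_into S j))"

definition eigenvalues_desc :: "'a set \<Rightarrow> ('a \<Rightarrow> 'a \<Rightarrow> real) \<Rightarrow> real list" where
  "eigenvalues_desc S P =
     rev (sorted_list_of_multiset (proots (char_poly (kernel_matrix S P))))"

text \<open>List positions start at 0, so position 1 holds the second largest eigenvalue.\<close>

definition gap :: "'a set \<Rightarrow> ('a \<Rightarrow> 'a \<Rightarrow> real) \<Rightarrow> real" where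
  "gap S P = (if card S = 1 then 1 else 1 - eigenvalues_desc S P ! 1)"

section \<open>Stationary chains and the projected count kernel\<close>

text \<open>
  The last condition is the Markov property with transition kernel P, multiplied out so that it
  also covers histories of probability 0; h j is the state at time t - j.
\<close>

definition stationary_markov_chain ::
    "'a set \<Rightarrow> ('a \<Rightarrow> 'a \<Rightarrow> real) \<Rightarrow> ('a \<Rightarrow> real) \<Rightarrow> 'w measure \<Rightarrow> (int \<Rightarrow> 'w \<Rightarrow> 'a) \<Rightarrow> bool" where
  "stationary_markov_chain S P \<pi> M X \<longleftrightarrow>
     prob_space M \<and>
     (\<forall>t. X t \<in> measurable M (count_space S)) \<and>
     (\<forall>t. \<forall>x\<in>S. measure M {\<omega> \<in> space M. X t \<omega> = x} = \<pi> x) \<and>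
     (\<forall>t. \<forall>r::nat. \<forall>h. (\<forall>j\<le>r. h j \<in> S) \<longrightarrow> (\<forall>y\<in>S.
        measure M {\<omega> \<in> space M. (\<forall>j\<le>r. X (t - int j) \<omega> = h j) \<and> X (t + 1) \<omega> = y}
        = measure M {\<omega> \<in> space M. \<forall>j\<le>r. X (t - int j) \<omega> = h j} * P (h 0) y))"

text \<open>Coordinates outside the state set are 0, since the chain never leaves it.\<close>

definition window_count :: "(int \<Rightarrow> 'w \<Rightarrow> 'a) \<Rightarrow> nat \<Rightarrow> int \<Rightarrow> 'w \<Rightarrow> ('a \<Rightarrow> nat)" where
  "window_count X n t \<omega> = (\<lambda>x. \<Sum>j<n. if X (t + int j) \<omega> = x then 1 else 0)"

definition count_law :: "'w measure \<Rightarrow> (int \<Rightarrow> 'w \<Rightarrow> 'a) \<Rightarrow> nat \<Rightarrow> ('a \<Rightarrow> nat) \<Rightarrow> real" where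
  "count_law M X n k = measure M {\<omega> \<in> space M. window_count X n 0 \<omega> = k}"

definition count_support :: "'w measure \<Rightarrow> (int \<Rightarrow> 'w \<Rightarrow> 'a) \<Rightarrow> nat \<Rightarrow> ('a \<Rightarrow> nat) set" where
  "count_support M X n = {k. count_law M X n k > 0}"

definition projected_kernel ::
    "'w measure \<Rightarrow> (int \<Rightarrow> 'w \<Rightarrow> 'a) \<Rightarrow> nat \<Rightarrow> ('a \<Rightarrow> nat) \<Rightarrow> ('a \<Rightarrow> nat) \<Rightarrow> real" where
  "projected_kernel M X n k l =
     measure M {\<omega> \<in> space M. window_count X n 0 \<omega> = k \<and> window_count X n 1 \<omega> = l}
     / count_law M X n k"

definition projected_gap :: "'w measure \<Rightarrow> (int \<Rightarrow> 'w \<Rightarrow> 'a) \<Rightarrow> nat \<Rightarrow> real" where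
  "projected_gap M X n = gap (count_support M X n) (projected_kernel M X n)"

section \<open>Optimal constants\<close>

text \<open>
  The state set ranges over the m-element sets of natural numbers, which loses nothing up to
  relabelling. The ratio depends on the chain only through its finite-dimensional laws, hence only
  on P and n. The path space type suffices as sample space: by Kolmogorov extension every
  irreducible reversible kernel has a stationary two-sided chain realized there.
\<close>

definition c_star :: "nat \<Rightarrow> real" where
  "c_star m = Inf {real n * projected_gap M X n / gap S P | S P \<pi> M X n.
     card S = m \<and> irreducible_reversible_kernel S P \<pi> \<and>
     stationary_markov_chain S P \<pi> (M :: (int \<Rightarrow> nat) measure) (X :: int \<Rightarrow> (int \<Rightarrow> nat) \<Rightarrow> nat) \<and>
     n \<ge> 2}"

definition C_opt :: "nat \<Rightarrow> real" where
  "C_opt m = inverse (c_star m)"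

end

theory Submission
  imports Defs "Jordan_Normal_Form.Schur_Decomposition"
begin

text \<open>
  Write m for the number of states, gamma for the gap of P, K_t for the counts of the window that
  starts at time t, and D for the mean square of f(K_1) - f(K_0), where f is a function of
  the counts. Since D is twice the Dirichlet form of
  the count kernel, the claim is the Poincare inequality
  Var f(K_0) \<le> 540 (m n / gamma) D. It is proved for finite sums over paths of the
  stationary chain.

  Moving a window by T steps changes f by at most T times the square root of D in mean square.
  For windows with n at most of order m / gamma this is enough: two windows at an odd distance of
  about n have small covariance because of the gap, so the variance is controlled by a
  shift of length at most 2 n (lemma \<open>poincare_short_window\<close>).

  For longer windows the factor n has to be linear rather than quadratic. Some state x has
  weight at least 1/m, and by an argument with level sets the mean hitting time of x is at most
  2 m / gamma from every starting state (lemmas \<open>drift_sup_bound\<close>, \<open>avoid_bound\<close>). Let G be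
  of the order m / gamma, so that x is hit within G steps with probability at least 3/4, whatever
  the start. Cut the path at the first visit to x and then into independent blocks, loops at x
  that are closed at the first visit to x not earlier than 4 G steps after their start. As in
  the Efron-Stein inequality, the variance of f is at most the sum over the blocks of the mean
  square change of f when one block is deleted and the window is filled up at its end. The counts
  do not depend on the order of the blocks; hence every block may be assumed to be the first
  one (lemmas \<open>block_cost_average\<close>, \<open>cvar_bound\<close>), and there are at most n / (4 G) of
  them. Deleting the first block amounts to moving the window over a random initial piece of the
  path whose length has exponential tails on the scale G. The increments of f met on the way
  depend on the future only, and the hitting bound is uniform in the state, so by
  reversibility the length and the increments can be separated, and the cost is a constant times
  the square of G times D (lemmas \<open>random_shift\<close>, \<open>total_block_cost\<close>). Altogether the
  variance is at most of order (n / G) times the square of G times D, that is, n G D. The incomplete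
  block at the end of the window contributes a predictor error and a small multiple of the
  variance, which is absorbed (lemma \<open>poincare_long_window\<close>).

  The Poincare inequalities and the gap, defined by the characteristic polynomial, are linked by
  diagonalizing a real symmetric matrix (lemmas \<open>ip_funpow_le_gap_power\<close>, \<open>gap_geI\<close>).
\<close>

section \<open>Diagonalization of real symmetric matrices\<close>

unbundle no vec_syntax and no inner_syntax

lemma real_symmetric_eigenvalue_exists:
  fixes A :: "real mat"
  assumes A: "A \<in> carrier_mat n n" and sym: "transpose_mat A = A" and n: "n > 0"
  shows "\<exists>e. eigenvalue A e"
proof -
  let ?C = "map_mat complex_of_real A"
  have C: "?C \<in> carrier_mat n n" using A by auto
  have sym': "A $$ (i,j) = A $$ (j,i)" if "i < n" "j < n" for i j
    using arg_cong[OF sym, of "\<lambda>M. M $$ (i,j)"] that A by auto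
  have "degree (char_poly ?C) = n" using degree_monic_char_poly[OF C] by auto
  hence "\<not> constant (poly (char_poly ?C))" using n by (simp add: constant_degree)
  then obtain z where z: "poly (char_poly ?C) z = 0"
    using fundamental_theorem_of_algebra by blast
  hence "eigenvalue ?C z" using eigenvalue_root_char_poly[OF C] by simp
  then obtain v where ev: "eigenvector ?C v z" unfolding eigenvalue_def by auto
  hence v: "v \<in> carrier_vec n" "v \<noteq> 0\<^sub>v n" "?C *\<^sub>v v = z \<cdot>\<^sub>v v"
    using C unfolding eigenvector_def by auto
  have row: "(\<Sum>j<n. complex_of_real (A $$ (i,j)) * v $ j) = z * v $ i" if "i < n" for i
    using arg_cong[OF v(3), of "\<lambda>w. w $ i"] that A v(1)
    by (auto simp: scalar_prod_def lessThan_atLeast0)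
  \<comment> \<open>The quadratic form of A at the complex eigenvector v is real, because A is real and symmetric.\<close>
  define q where "q = (\<Sum>i<n. \<Sum>j<n. cnj (v $ i) * (complex_of_real (A $$ (i,j)) * v $ j))"
  define N where "N = (\<Sum>i<n. (cmod (v $ i))\<^sup>2)"
  have q1: "q = z * complex_of_real N"
  proof -
    have "q = (\<Sum>i<n. cnj (v $ i) * (z * v $ i))"
      unfolding q_def by (intro sum.cong refl) (simp add: row flip: sum_distrib_left)
    also have "\<dots> = z * (\<Sum>i<n. cnj (v $ i) * v $ i)"
      by (simp add: sum_distrib_left mult_ac)
    also have "(\<Sum>i<n. cnj (v $ i) * v $ i) = complex_of_real N"
      unfolding N_def by (simp add: complex_norm_square mult.commute del: of_real_power)
    finally show ?thesis .
  qed
  have q2: "cnj q = q"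
  proof -
    have "cnj q = (\<Sum>i<n. \<Sum>j<n. cnj (v $ j) * (complex_of_real (A $$ (j,i)) * v $ i))"
      unfolding q_def by (auto intro!: sum.cong simp: sym' mult_ac)
    also have "\<dots> = q" unfolding q_def by (rule sum.swap)
    finally show ?thesis .
  qed
  obtain i where i: "i < n" "v $ i \<noteq> 0"
    using v(1,2) by (metis carrier_vecD eq_vecI index_zero_vec(1) index_zero_vec(2))
  have "N > 0" unfolding N_def
    by (rule sum_pos2[of _ i]) (use i in auto)
  have "Im q = 0" using q2 by (metis add.inverse_neutral cnj.simps(2) equation_minus_iff neg_equal_zero)
  hence "Im z = 0" using q1 \<open>N > 0\<close> by simp
  hence "z = complex_of_real (Re z)" by (simp add: complex_eq_iff)
  hence "poly (map_poly complex_of_real (char_poly A)) (complex_of_real (Re z)) = 0"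
    using z by (simp add: of_real_hom.char_poly_hom[OF A])
  hence "complex_of_real (poly (char_poly A) (Re z)) = 0"
    by (metis of_real_hom.poly_map_poly)
  hence "poly (char_poly A) (Re z) = 0" by simp
  thus ?thesis using eigenvalue_root_char_poly[OF A] by auto
qed

lemma conjugate_real_vec: "conjugate (v :: real vec) = v"
  by (rule eq_vecI) auto

text \<open>Induction on the size: an orthonormal basis starting with an eigenvector turns the matrix into a
  block matrix with the eigenvalue in the first corner, and symmetry makes the off-diagonal
  blocks vanish.\<close>

theorem real_symmetric_diagonalization:
  fixes A :: "real mat"
  assumes "A \<in> carrier_mat n n" "transpose_mat A = A"
  shows "\<exists>Q\<in>carrier_mat n n. transpose_mat Q * Q = 1\<^sub>m n \<and> diagonal_mat (transpose_mat Q * A * Q)"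
  using assms
proof (induction n arbitrary: A)
  case 0
  then show ?case by (intro bexI[of _ "1\<^sub>m 0"]) (auto simp: diagonal_mat_def)
next
  case (Suc k)
  let ?n = "Suc k"
  note A = Suc.prems(1)
  obtain e where "eigenvalue A e"
    using real_symmetric_eigenvalue_exists[OF Suc.prems] by auto
  then obtain v where v: "v \<in> carrier_vec ?n" "v \<noteq> 0\<^sub>v ?n" "A *\<^sub>v v = e \<cdot>\<^sub>v v"
    using A unfolding eigenvalue_def eigenvector_def by auto
  define ws where "ws = gram_schmidt ?n (basis_completion v)"
  note bc = vec_space.basis_completion[OF v(1,2)]
  have ws: "set ws \<subseteq> carrier_vec ?n" "corthogonal ws" "length ws = ?n"
    using cof_vec_space.gram_schmidt_result[OF bc(2,4,5) refl, folded ws_def] bc(6) by auto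
  obtain bs where bs: "basis_completion v = v # bs"
    using bc(6,7) by (cases "basis_completion v") auto
  have ws0: "ws ! 0 = v"
    using cof_vec_space.gram_schmidt_hd[OF v(1), of bs] ws(3) 
    unfolding ws_def bs by (cases "gram_schmidt ?n (v # bs)") auto
  have wsc: "ws ! i \<in> carrier_vec ?n" if "i < ?n" for i
    using ws that by (metis nth_mem subsetD)
  have orth: "(ws ! i \<bullet> ws ! j = 0) = (i \<noteq> j)" if "i < ?n" "j < ?n" for i j
    using corthogonalD[OF ws(2)] ws(3) that by (simp add: conjugate_real_vec)
  define c where "c i = 1 / sqrt (ws ! i \<bullet> ws ! i)" for i
  have pos: "ws ! i \<bullet> ws ! i > 0" if "i < ?n" for i
  proof -
    have "ws ! i \<bullet> ws ! i \<ge> 0" unfolding scalar_prod_def by (intro sum_nonneg) auto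
    thus ?thesis using orth[OF that that] by simp
  qed
  define W where "W = mat_of_cols ?n (map (\<lambda>i. c i \<cdot>\<^sub>v (ws ! i)) [0..<?n])"
  have W: "W \<in> carrier_mat ?n ?n" unfolding W_def
    using mat_of_cols_carrier(1)[of ?n "map (\<lambda>i. c i \<cdot>\<^sub>v (ws ! i)) [0..<?n]"] by simp
  have colW: "col W i = c i \<cdot>\<^sub>v (ws ! i)" if "i < ?n" for i
    unfolding W_def using that wsc[OF that] by (subst col_mat_of_cols) (auto simp del: upt_Suc)
  have cc: "c i * (c i * (ws ! i \<bullet> ws ! i)) = 1" if "i < ?n" for i
    using pos[OF that] unfolding c_def by (simp add: field_simps)
  have WW: "transpose_mat W * W = 1\<^sub>m ?n"
  proof (rule eq_matI)
    fix i j assume "i < dim_row (1\<^sub>m ?n :: real mat)" "j < dim_col (1\<^sub>m ?n :: real mat)"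
    hence ij: "i < ?n" "j < ?n" by auto
    have "(transpose_mat W * W) $$ (i,j) = (c i \<cdot>\<^sub>v (ws ! i)) \<bullet> (c j \<cdot>\<^sub>v (ws ! j))"
      using ij W by (simp add: colW)
    also have "\<dots> = c i * (c j * (ws ! i \<bullet> ws ! j))"
      using wsc ij by (simp add: smult_scalar_prod_distrib[of _ ?n] scalar_prod_smult_distrib[of _ ?n])
    also have "\<dots> = 1\<^sub>m ?n $$ (i,j)"
      using orth[OF ij] cc[OF ij(1)] ij by (cases "i = j") auto
    finally show "(transpose_mat W * W) $$ (i,j) = 1\<^sub>m ?n $$ (i,j)" .
  qed (use W in auto)
  define A' where "A' = transpose_mat W * A * W"
  have A': "A' \<in> carrier_mat ?n ?n" unfolding A'_def using W A by auto
  have A'_sym: "transpose_mat A' = A'"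
    unfolding A'_def using W A Suc.prems(2)
    by (simp add: transpose_mult[of _ ?n ?n _ ?n] assoc_mult_mat[of _ ?n ?n _ ?n _ ?n])
  have A'0: "A' $$ (i,0) = (if i = 0 then e else 0)" if i: "i < ?n" for i
  proof -
    have AW: "A *\<^sub>v col W 0 = e \<cdot>\<^sub>v col W 0"
      unfolding colW[OF zero_less_Suc] ws0 using v A
      by (simp add: mult_mat_vec[of _ ?n ?n] smult_smult_assoc mult.commute)
    have "A' $$ (i,0) = (transpose_mat W * (A * W)) $$ (i,0)"
      unfolding A'_def using W A by (simp add: assoc_mult_mat[of _ ?n ?n _ ?n _ ?n])
    also have "\<dots> = col W i \<bullet> col (A * W) 0" using i W A by simp
    also have "col (A * W) 0 = A *\<^sub>v col W 0" using W by (simp add: col_mult2[OF A W])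
    also have "col W i \<bullet> (A *\<^sub>v col W 0) = e * (col W i \<bullet> col W 0)"
      unfolding AW using W i by (simp add: scalar_prod_smult_distrib[of _ ?n])
    also have "col W i \<bullet> col W 0 = (transpose_mat W * W) $$ (i,0)" using W i by simp
    also have "\<dots> = (if i = 0 then 1 else 0)" unfolding WW using i by simp
    finally show ?thesis by simp
  qed
  have A'0': "A' $$ (0,i) = (if i = 0 then e else 0)" if i: "i < ?n" for i
    using A'0[OF i] arg_cong[OF A'_sym, of "\<lambda>M. M $$ (0,i)"] i A' by auto
  define B where "B = mat k k (\<lambda>(i,j). A' $$ (Suc i, Suc j))"
  have B: "B \<in> carrier_mat k k" unfolding B_def by auto
  have "transpose_mat B = B"
  proof (rule eq_matI)
    fix i j assume ij: "i < dim_row B" "j < dim_col B"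
    thus "transpose_mat B $$ (i,j) = B $$ (i,j)"
      using arg_cong[OF A'_sym, of "\<lambda>M. M $$ (Suc i, Suc j)"] A' B by (auto simp: B_def)
  qed (use B in auto)
  from Suc.IH[OF B this] obtain R where R: "R \<in> carrier_mat k k" "transpose_mat R * R = 1\<^sub>m k"
    "diagonal_mat (transpose_mat R * B * R)" by auto
  let ?e = "mat 1 1 (\<lambda>_. e)"
  let ?F = "\<lambda>M N. four_block_mat M (0\<^sub>m 1 k) (0\<^sub>m k 1) N"
  have blk: "A' = ?F ?e B"
    by (rule eq_matI) (use A' A'0 A'0' B in \<open>auto simp: B_def less_Suc_eq_0_disj\<close>)
  define T where "T = ?F (1\<^sub>m 1) R"
  have T: "T \<in> carrier_mat ?n ?n" unfolding T_def using R four_block_carrier_mat[of "1\<^sub>m 1" 1 1 R k k] by auto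
  have TT: "transpose_mat T = ?F (1\<^sub>m 1) (transpose_mat R)"
    unfolding T_def using R(1) by (subst transpose_four_block_mat[of _ 1 1 _ k _ k]) auto
  have F_mult: "?F M N * ?F M' N' = ?F (M * M') (N * N')"
    if "M \<in> carrier_mat 1 1" "M' \<in> carrier_mat 1 1" "N \<in> carrier_mat k k" "N' \<in> carrier_mat k k"
    for M M' N N' :: "real mat"
    using that by (subst mult_four_block_mat[of _ 1 1 _ k _ k _ _ 1 _ k]) auto
  have TtT: "transpose_mat T * T = 1\<^sub>m ?n"
    unfolding TT unfolding T_def using R by (subst F_mult) (auto intro!: eq_matI simp: less_Suc_eq_0_disj)
  have TAT: "transpose_mat T * A' * T = ?F ?e (transpose_mat R * B * R)"
  proof -
    have 1: "?F (1\<^sub>m 1) (transpose_mat R) * ?F ?e B = ?F (1\<^sub>m 1 * ?e) (transpose_mat R * B)"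
      by (rule F_mult) (use R B in auto)
    have 2: "?F (1\<^sub>m 1 * ?e) (transpose_mat R * B) * ?F (1\<^sub>m 1) R
        = ?F (1\<^sub>m 1 * ?e * 1\<^sub>m 1) (transpose_mat R * B * R)"
      by (rule F_mult) (use R B in auto)
    have 3: "1\<^sub>m 1 * ?e * 1\<^sub>m 1 = ?e" by (rule eq_matI) auto
    show ?thesis unfolding TT blk unfolding T_def 1 2 3 ..
  qed
  show ?case
  proof (intro bexI[of _ "W * T"] conjI)
    show "W * T \<in> carrier_mat ?n ?n" using W T by auto
    have "transpose_mat (W * T) * (W * T) = transpose_mat T * (transpose_mat W * W) * T"
      using W T by (simp add: transpose_mult[of _ ?n ?n _ ?n] assoc_mult_mat[of _ ?n ?n _ ?n _ ?n])
    also have "\<dots> = 1\<^sub>m ?n" unfolding WW using T TtT by simp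
    finally show "transpose_mat (W * T) * (W * T) = 1\<^sub>m ?n" .
    have "transpose_mat (W * T) * A * (W * T) = transpose_mat T * A' * T"
      unfolding A'_def using W T A
      by (simp add: transpose_mult[of _ ?n ?n _ ?n] assoc_mult_mat[of _ ?n ?n _ ?n _ ?n])
    also have "diagonal_mat \<dots>"
    proof -
      have "diagonal_mat (?F ?e C)" if "diagonal_mat C" "C \<in> carrier_mat k k" for C
        using that unfolding diagonal_mat_def by (auto simp: less_Suc_eq_0_disj) metis
      thus ?thesis unfolding TAT using R B by auto
    qed
    finally show "diagonal_mat (transpose_mat (W * T) * A * (W * T))" .
  qed
qed

text \<open>In the weighted inner product, a kernel that is reversible with respect to a positive weight
  has an orthonormal basis of eigenfunctions, listed by decreasing eigenvalue.\<close>

lemma reversible_kernel_eigenbasis: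
  fixes P :: "'a \<Rightarrow> 'a \<Rightarrow> real"
  assumes fin: "finite S" and pos: "\<And>x. x \<in> S \<Longrightarrow> \<pi> x > 0" and rev: "reversible_on S P \<pi>"
  obtains u :: "nat \<Rightarrow> 'a \<Rightarrow> real" where
    "length (eigenvalues_desc S P) = card S"
    "sorted_wrt (\<ge>) (eigenvalues_desc S P)"
    "\<And>k x. k < card S \<Longrightarrow> x \<in> S \<Longrightarrow> (\<Sum>y\<in>S. P x y * u k y) = eigenvalues_desc S P ! k * u k x"
    "\<And>k l. k < card S \<Longrightarrow> l < card S \<Longrightarrow> (\<Sum>x\<in>S. \<pi> x * u k x * u l x) = (if k = l then 1 else 0)"
    "\<And>g x. x \<in> S \<Longrightarrow> g x = (\<Sum>k<card S. (\<Sum>y\<in>S. \<pi> y * u k y * g y) * u k x)"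
proof -
  define n where "n = card S"
  define s where "s = from_nat_into S"
  have bij: "bij_betw s {..<n} S"
    unfolding s_def n_def using bij_betw_from_nat_into_finite[OF fin] .
  have sS: "s i \<in> S" if "i < n" for i using bij that by (auto simp: bij_betw_def)
  have reidx: "(\<Sum>x\<in>S. F x) = (\<Sum>i<n. F (s i))" for F :: "'a \<Rightarrow> real"
    using sum.reindex_bij_betw[OF bij, of F] by simp
  have sp: "sqrt (\<pi> (s i)) > 0" if "i < n" for i using pos[OF sS[OF that]] by simp
  have sp2: "sqrt (\<pi> (s i)) * sqrt (\<pi> (s i)) = \<pi> (s i)" if "i < n" for i
    using pos[OF sS[OF that]] by simp
  \<comment> \<open>Conjugation by the square roots of the weights makes the kernel matrix symmetric.\<close>
  define A where "A = mat n n (\<lambda>(i,j). sqrt (\<pi> (s i)) * P (s i) (s j) / sqrt (\<pi> (s j)))"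
  have A: "A \<in> carrier_mat n n" unfolding A_def by auto
  have "transpose_mat A = A"
  proof (rule eq_matI)
    fix i j assume "i < dim_row A" "j < dim_col A"
    hence ij: "i < n" "j < n" using A by auto
    have "\<pi> (s i) * P (s i) (s j) = \<pi> (s j) * P (s j) (s i)"
      using rev sS[OF ij(1)] sS[OF ij(2)] unfolding reversible_on_def by auto
    hence "sqrt (\<pi> (s i)) * sqrt (\<pi> (s i)) * P (s i) (s j) = sqrt (\<pi> (s j)) * sqrt (\<pi> (s j)) * P (s j) (s i)"
      using sp2 ij by metis
    hence "sqrt (\<pi> (s j)) * P (s j) (s i) / sqrt (\<pi> (s i)) = sqrt (\<pi> (s i)) * P (s i) (s j) / sqrt (\<pi> (s j))"
      using sp[OF ij(1)] sp[OF ij(2)] by (subst frac_eq_eq) (auto simp only: mult_ac)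
    thus "transpose_mat A $$ (i,j) = A $$ (i,j)"
      using ij unfolding A_def by simp
  qed (use A in auto)
  from real_symmetric_diagonalization[OF A this] obtain Q where Q: "Q \<in> carrier_mat n n"
    "transpose_mat Q * Q = 1\<^sub>m n" "diagonal_mat (transpose_mat Q * A * Q)" by auto
  have Q': "Q * transpose_mat Q = 1\<^sub>m n"
    using mat_mult_left_right_inverse[OF _ Q(1) Q(2)] Q(1) by auto
  define D where "D = transpose_mat Q * A * Q"
  have D: "D \<in> carrier_mat n n" unfolding D_def using Q A by auto
  define d where "d k = D $$ (k,k)" for k
  have AQ: "A * Q = Q * D"
  proof -
    have "Q * D = (Q * transpose_mat Q) * (A * Q)"
      unfolding D_def using Q(1) A by (simp add: assoc_mult_mat[of _ n n _ n _ n])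
    thus ?thesis unfolding Q' using A Q by simp
  qed
  define q where "q i k = Q $$ (i,k)" for i k
  have q_orth: "(\<Sum>i<n. q i k * q i l) = (if k = l then 1 else 0)" if "k < n" "l < n" for k l
    using arg_cong[OF Q(2), of "\<lambda>M. M $$ (k,l)"] that Q(1)
    by (simp add: scalar_prod_def q_def lessThan_atLeast0)
  have q_compl: "(\<Sum>k<n. q i k * q j k) = (if i = j then 1 else 0)" if "i < n" "j < n" for i j
    using arg_cong[OF Q', of "\<lambda>M. M $$ (i,j)"] that Q(1)
    by (simp add: scalar_prod_def q_def lessThan_atLeast0)
  have q_eig: "(\<Sum>j<n. A $$ (i,j) * q j k) = d k * q i k" if "i < n" "k < n" for i k
  proof -
    have "(\<Sum>j<n. A $$ (i,j) * q j k) = (A * Q) $$ (i,k)"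
      using that Q(1) A by (simp add: scalar_prod_def q_def lessThan_atLeast0)
    also have "\<dots> = (\<Sum>j<n. q i j * D $$ (j,k))"
      unfolding AQ using that Q(1) D by (simp add: scalar_prod_def q_def lessThan_atLeast0)
    also have "\<dots> = (\<Sum>j<n. if j = k then q i k * d k else 0)"
      using Q(3) that D unfolding D_def[symmetric] diagonal_mat_def d_def
      by (intro sum.cong) auto
    also have "\<dots> = d k * q i k" using that by simp
    finally show ?thesis .
  qed
  define t where "t = the_inv_into {..<n} s"
  have ts: "t (s i) = i" if "i < n" for i
    unfolding t_def using bij that by (auto simp: bij_betw_def intro: the_inv_into_f_f)
  define u where "u k x = q (t x) k / sqrt (\<pi> x)" for k x
  have us: "u k (s i) = q i k / sqrt (\<pi> (s i))" if "i < n" for i k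
    unfolding u_def using ts that by simp
  have u_orth: "(\<Sum>x\<in>S. \<pi> x * u k x * u l x) = (if k = l then 1 else 0)" if "k < n" "l < n" for k l
  proof -
    have "(\<Sum>x\<in>S. \<pi> x * u k x * u l x) = (\<Sum>i<n. q i k * q i l)"
      unfolding reidx
    proof (intro sum.cong refl)
      fix i assume "i \<in> {..<n}" hence i: "i < n" by auto
      show "\<pi> (s i) * u k (s i) * u l (s i) = q i k * q i l"
        using sp[OF i] sp2[OF i] by (simp add: us i field_simps)
    qed
    thus ?thesis using q_orth that by simp
  qed
  have u_eig: "(\<Sum>y\<in>S. P x y * u k y) = d k * u k x" if kx: "k < n" "x \<in> S" for k x
  proof -
    obtain i where i: "i < n" "x = s i" using kx(2) bij by (auto simp: bij_betw_def)
    have "sqrt (\<pi> (s i)) * (\<Sum>y\<in>S. P x y * u k y) = (\<Sum>j<n. A $$ (i,j) * q j k)"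
      unfolding reidx sum_distrib_left i(2) using i(1) by (intro sum.cong refl) (simp add: us A_def)
    also have "\<dots> = d k * q i k" using q_eig i kx by simp
    also have "\<dots> = sqrt (\<pi> (s i)) * (d k * u k (s i))" using sp[OF i(1)] by (simp add: us[OF i(1)])
    finally show ?thesis using sp[OF i(1)] unfolding i(2) by (simp only: mult_cancel_left) auto
  qed
  have u_delta: "(\<Sum>k<n. \<pi> y * u k y * u k x) = (if x = y then 1 else 0)" if xy: "x \<in> S" "y \<in> S" for x y
  proof -
    obtain i j where i: "i < n" "x = s i" and j: "j < n" "y = s j"
      using xy bij by (auto simp: bij_betw_def)
    have eq: "(s i = s j) = (i = j)" using ts i(1) j(1) by metis
    have "(\<Sum>k<n. \<pi> y * u k y * u k x) = sqrt (\<pi> (s j)) / sqrt (\<pi> (s i)) * (\<Sum>k<n. q i k * q j k)"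
      unfolding sum_distrib_left
    proof (intro sum.cong refl)
      fix k
      show "\<pi> y * u k y * u k x = sqrt (\<pi> (s j)) / sqrt (\<pi> (s i)) * (q i k * q j k)"
        unfolding i(2) j(2) us[OF i(1)] us[OF j(1)] using sp[OF j(1)] sp[OF i(1)] sp2[OF j(1)]
        by (simp add: field_simps)
    qed
    also have "\<dots> = (if x = y then 1 else 0)"
      unfolding q_compl[OF i(1) j(1)] i(2) j(2) eq using sp[OF i(1)] by auto
    finally show ?thesis .
  qed
  have u_compl: "g x = (\<Sum>k<n. (\<Sum>y\<in>S. \<pi> y * u k y * g y) * u k x)" if x: "x \<in> S" for g :: "'a \<Rightarrow> real" and x
  proof -
    have "(\<Sum>k<n. (\<Sum>y\<in>S. \<pi> y * u k y * g y) * u k x) = (\<Sum>k<n. \<Sum>y\<in>S. \<pi> y * u k y * u k x * g y)"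
      by (simp add: sum_distrib_left sum_distrib_right mult_ac)
    also have "\<dots> = (\<Sum>y\<in>S. (\<Sum>k<n. \<pi> y * u k y * u k x) * g y)"
      by (subst sum.swap) (simp add: sum_distrib_right)
    also have "\<dots> = (\<Sum>y\<in>S. if x = y then g y else 0)"
      using x by (intro sum.cong refl) (simp add: u_delta)
    also have "\<dots> = g x" using x fin by simp
    finally show ?thesis by simp
  qed
  \<comment> \<open>The kernel matrix is similar to the diagonal matrix E, which identifies the roots of its
    characteristic polynomial.\<close>
  let ?K = "kernel_matrix S P"
  have K: "?K \<in> carrier_mat n n" unfolding kernel_matrix_def n_def by auto
  define U where "U = mat n n (\<lambda>(i,k). u k (s i))"
  define V where "V = mat n n (\<lambda>(k,i). \<pi> (s i) * u k (s i))"
  define E where "E = mat n n (\<lambda>(i,k). if i = k then d k else 0)"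
  have UVE: "U \<in> carrier_mat n n" "V \<in> carrier_mat n n" "E \<in> carrier_mat n n"
    unfolding U_def V_def E_def by auto
  have UV: "U * V = 1\<^sub>m n"
  proof (rule eq_matI)
    fix i j assume "i < dim_row (1\<^sub>m n :: real mat)" "j < dim_col (1\<^sub>m n :: real mat)"
    hence ij: "i < n" "j < n" by auto
    have eq: "(s i = s j) = (i = j)" using ts ij by metis
    have "(U * V) $$ (i,j) = (\<Sum>k<n. \<pi> (s j) * u k (s j) * u k (s i))"
      using ij UVE by (simp add: scalar_prod_def U_def V_def lessThan_atLeast0 mult_ac)
    also have "\<dots> = (if s i = s j then 1 else 0)" using u_delta sS ij by auto
    finally show "(U * V) $$ (i,j) = 1\<^sub>m n $$ (i,j)" using ij eq by simp
  qed (use UVE in auto)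
  have VU: "V * U = 1\<^sub>m n" using mat_mult_left_right_inverse[OF _ _ UV] UVE by auto
  have KU: "?K * U = U * E"
  proof (rule eq_matI)
    fix i k assume "i < dim_row (U * E)" "k < dim_col (U * E)"
    hence ik: "i < n" "k < n" using UVE by auto
    have "(?K * U) $$ (i,k) = (\<Sum>j<n. P (s i) (s j) * u k (s j))"
      using ik UVE K by (simp add: scalar_prod_def U_def lessThan_atLeast0 kernel_matrix_def s_def n_def)
    also have "\<dots> = d k * u k (s i)" using u_eig[OF ik(2) sS[OF ik(1)]] unfolding reidx .
    also have "\<dots> = (\<Sum>j<n. u j (s i) * (if j = k then d k else 0))"
      using ik by (simp add: if_distrib[of "\<lambda>z. _ * z"] cong: if_cong)
    also have "\<dots> = (U * E) $$ (i,k)"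
      using ik UVE by (simp add: scalar_prod_def U_def E_def lessThan_atLeast0)
    finally show "(?K * U) $$ (i,k) = (U * E) $$ (i,k)" .
  qed (use UVE K in auto)
  have "?K = ?K * (U * V)" unfolding UV using K by simp
  also have "\<dots> = U * E * V" using K UVE KU by (metis assoc_mult_mat)
  finally have "similar_mat ?K E"
    unfolding similar_mat_def using similar_mat_witI[OF UV VU _ K UVE(3,1,2)] by blast
  hence "char_poly ?K = char_poly E" by (rule char_poly_similar)
  also have "\<dots> = (\<Prod>a\<leftarrow>diag_mat E. [:- a, 1:])"
    by (rule char_poly_upper_triangular[OF UVE(3)]) (auto simp: E_def upper_triangular_def)
  finally have cp: "char_poly ?K = (\<Prod>a\<leftarrow>diag_mat E. [:- a, 1:])" .
  have dE: "diag_mat E = map d [0..<n]"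
    unfolding diag_mat_def E_def by (auto intro!: map_cong)
  have "proots (\<Prod>a\<leftarrow>xs. [:- a, 1:]) = mset xs" for xs :: "real list"
  proof (induction xs)
    case (Cons a xs)
    have "(\<Prod>a\<leftarrow>xs. [:- a, 1:]) \<noteq> 0" by (auto simp: prod_list_zero_iff)
    then show ?case using Cons by (simp add: proots_mult del: mult_pCons_left)
  qed simp
  hence pr: "proots (char_poly ?K) = mset (map d [0..<n])" unfolding cp dE by blast
  let ?ev = "eigenvalues_desc S P"
  have ms: "mset ?ev = mset (map d [0..<n])" unfolding eigenvalues_desc_def pr by simp
  have srt: "sorted_wrt (\<ge>) ?ev"
    unfolding eigenvalues_desc_def sorted_wrt_rev by simp
  have len: "length ?ev = n" using arg_cong[OF ms, of size] by simp
  from mset_eq_permutation[OF ms] obtain p where p: "p permutes {..<n}" "permute_list p (map d [0..<n]) = ?ev"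
    by auto
  have pn: "p k < n" if "k < n" for k using p(1) that by (meson lessThan_iff permutes_in_image)
  have evp: "?ev ! k = d (p k)" if "k < n" for k
    using permute_list_nth[of p "map d [0..<n]" k] pn[OF that] that p by simp
  show thesis
  proof (rule that[of "\<lambda>k. u (p k)"], fold n_def)
    fix k x assume "k < n" "x \<in> S"
    thus "(\<Sum>y\<in>S. P x y * u (p k) y) = ?ev ! k * u (p k) x"
      using u_eig pn evp by simp
  next
    fix k l assume kl: "k < n" "l < n"
    have "(p k = p l) = (k = l)" using permutes_inj[OF p(1)] by (auto dest: injD)
    thus "(\<Sum>x\<in>S. \<pi> x * u (p k) x * u (p l) x) = (if k = l then 1 else 0)"
      using u_orth pn kl by simp
  next
    fix g :: "'a \<Rightarrow> real" and x assume x: "x \<in> S"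
    show "g x = (\<Sum>k<n. (\<Sum>y\<in>S. \<pi> y * u (p k) y * g y) * u (p k) x)"
      using u_compl[OF x, of g] sum.permute[OF p(1), of "\<lambda>k. (\<Sum>y\<in>S. \<pi> y * u k y * g y) * u k x"]
      by (simp add: o_def)
  qed (use len srt in auto)
qed

section \<open>Reversible kernels and their spectral gap\<close>

text \<open>A stochastic kernel on a finite set with a positive reversible law. Irreducibility is not part
  of it, so that the count kernel is an instance too.\<close>

locale reversible_chain =
  fixes S :: "'a set" and P :: "'a \<Rightarrow> 'a \<Rightarrow> real" and \<pi> :: "'a \<Rightarrow> real"
  assumes finite_S: "finite S"
    and P_nonneg: "x \<in> S \<Longrightarrow> y \<in> S \<Longrightarrow> 0 \<le> P x y"
    and P_sum: "x \<in> S \<Longrightarrow> (\<Sum>y\<in>S. P x y) = 1"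
    and pi_pos: "x \<in> S \<Longrightarrow> 0 < \<pi> x"
    and pi_sum: "(\<Sum>x\<in>S. \<pi> x) = 1"
    and balance: "x \<in> S \<Longrightarrow> y \<in> S \<Longrightarrow> \<pi> x * P x y = \<pi> y * P y x"
begin

text \<open>The inner product of the weighted L2 space.\<close>

definition ip :: "('a \<Rightarrow> real) \<Rightarrow> ('a \<Rightarrow> real) \<Rightarrow> real" where
  "ip f g = (\<Sum>x\<in>S. \<pi> x * f x * g x)"

text \<open>The kernel as an operator on functions: the conditional expectation one step ahead.\<close>

definition step :: "('a \<Rightarrow> real) \<Rightarrow> 'a \<Rightarrow> real" where
  "step g x = (\<Sum>y\<in>S. P x y * g y)"

lemma ip_commute: "ip f g = ip g f"
  unfolding ip_def by (simp add: mult_ac)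

lemma ip_add_left: "ip (\<lambda>x. f x + h x) g = ip f g + ip h g"
  unfolding ip_def by (simp add: algebra_simps sum.distrib)

lemma ip_scale_left: "ip (\<lambda>x. c * f x) g = c * ip f g"
  unfolding ip_def by (simp add: sum_distrib_left mult_ac)

lemma ip_add_right: "ip g (\<lambda>x. f x + h x) = ip g f + ip g h"
  unfolding ip_def by (simp add: algebra_simps sum.distrib)

lemma ip_scale_right: "ip g (\<lambda>x. c * f x) = c * ip g f"
  unfolding ip_def by (simp add: sum_distrib_left mult_ac)

lemma ip_self_nonneg: "0 \<le> ip f f"
  unfolding ip_def by (intro sum_nonneg) (simp add: mult.assoc pi_pos less_imp_le)

lemma ip_cong: "(\<And>x. x \<in> S \<Longrightarrow> f x = f' x) \<Longrightarrow> (\<And>x. x \<in> S \<Longrightarrow> g x = g' x) \<Longrightarrow> ip f g = ip f' g'"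
  unfolding ip_def by (intro sum.cong) auto

lemma step_cong: "(\<And>y. y \<in> S \<Longrightarrow> f y = g y) \<Longrightarrow> step f x = step g x"
  unfolding step_def by (intro sum.cong) auto

lemma step_linear: "step (\<lambda>x. a * f x + b * g x) = (\<lambda>x. a * step f x + b * step g x)"
  unfolding step_def by (simp add: algebra_simps sum.distrib sum_distrib_left)

lemma step_const: "x \<in> S \<Longrightarrow> step (\<lambda>_. c) x = c"
  unfolding step_def by (simp add: P_sum flip: sum_distrib_right)

lemma ip_step: "ip f (step g) = (\<Sum>x\<in>S. \<Sum>y\<in>S. \<pi> x * P x y * f x * g y)"
  unfolding ip_def step_def by (simp add: sum_distrib_left mult_ac)

lemma step_selfadjoint: "ip f (step g) = ip (step f) g"
proof -
  have "ip f (step g) = (\<Sum>x\<in>S. \<Sum>y\<in>S. \<pi> y * P y x * g y * f x)"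
    unfolding ip_step by (intro sum.cong refl) (simp add: balance mult_ac)
  also have "\<dots> = ip g (step f)" unfolding ip_step by (rule sum.swap)
  finally show ?thesis by (simp add: ip_commute)
qed

lemma stationary: "y \<in> S \<Longrightarrow> (\<Sum>x\<in>S. \<pi> x * P x y) = \<pi> y"
proof -
  assume y: "y \<in> S"
  have "(\<Sum>x\<in>S. \<pi> x * P x y) = (\<Sum>x\<in>S. \<pi> y * P y x)" using y by (intro sum.cong) (auto simp: balance)
  thus ?thesis using P_sum[OF y] by (simp flip: sum_distrib_left)
qed

lemma sum_pi_P_left: "(\<Sum>x\<in>S. \<Sum>y\<in>S. \<pi> x * P x y * h x) = (\<Sum>x\<in>S. \<pi> x * h x)"
proof (intro sum.cong refl)
  fix x assume x: "x \<in> S"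
  have "(\<Sum>y\<in>S. \<pi> x * P x y * h x) = \<pi> x * h x * (\<Sum>y\<in>S. P x y)"
    unfolding sum_distrib_left by (simp add: mult_ac)
  thus "(\<Sum>y\<in>S. \<pi> x * P x y * h x) = \<pi> x * h x" using P_sum[OF x] by simp
qed

lemma sum_pi_P_right: "(\<Sum>x\<in>S. \<Sum>y\<in>S. \<pi> x * P x y * h y) = (\<Sum>x\<in>S. \<pi> x * h x)"
  by (subst sum.swap) (simp add: stationary flip: sum_distrib_right)

lemma sum_square_edge:
  "(\<Sum>x\<in>S. \<Sum>y\<in>S. \<pi> x * P x y * (a * g x + b * g y)\<^sup>2) = (a\<^sup>2 + b\<^sup>2) * ip g g + 2 * a * b * ip g (step g)"
proof -
  have "(\<Sum>x\<in>S. \<Sum>y\<in>S. \<pi> x * P x y * (a * g x + b * g y)\<^sup>2)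
     = a\<^sup>2 * (\<Sum>x\<in>S. \<Sum>y\<in>S. \<pi> x * P x y * (g x * g x)) + b\<^sup>2 * (\<Sum>x\<in>S. \<Sum>y\<in>S. \<pi> x * P x y * (g y * g y))
     + 2 * a * b * ip g (step g)"
    unfolding ip_step sum_distrib_left sum.distrib[symmetric]
    by (intro sum.cong refl) (simp add: power2_eq_square algebra_simps)
  also have "\<dots> = (a\<^sup>2 + b\<^sup>2) * ip g g + 2 * a * b * ip g (step g)"
    unfolding sum_pi_P_left sum_pi_P_right[of "\<lambda>y. g y * g y"] ip_def by (simp add: algebra_simps)
  finally show ?thesis .
qed

lemma dirichlet_form_eq:
  "(\<Sum>x\<in>S. \<Sum>y\<in>S. \<pi> x * P x y * (g x - g y)\<^sup>2) = 2 * (ip g g - ip g (step g))"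
  using sum_square_edge[of 1 g "-1"] by simp

lemma edge_sum_nonneg: "0 \<le> (\<Sum>x\<in>S. \<Sum>y\<in>S. \<pi> x * P x y * (h x y)\<^sup>2)"
  by (intro sum_nonneg mult_nonneg_nonneg) (auto simp: pi_pos P_nonneg less_imp_le)

lemma ip_step_le: "ip g (step g) \<le> ip g g"
  using dirichlet_form_eq[of g] edge_sum_nonneg[of "\<lambda>x y. g x - g y"] by simp

lemma ip_step_ge: "- ip g g \<le> ip g (step g)"
  using sum_square_edge[of 1 g 1] edge_sum_nonneg[of "\<lambda>x y. 1 * g x + 1 * g y"] by simp

lemma reversible: "reversible_on S P \<pi>"
  unfolding reversible_on_def using balance by auto

lemma step_iterate_linear: "(step ^^ s) (\<lambda>x. a * f x + b * g x) = (\<lambda>x. a * (step ^^ s) f x + b * (step ^^ s) g x)"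
  by (induction s) (auto simp: step_linear)

lemma step_iterate_const: "x \<in> S \<Longrightarrow> (step ^^ s) (\<lambda>_. c) x = c"
proof (induction s arbitrary: x)
  case (Suc s)
  then have "step ((step ^^ s) (\<lambda>_. c)) x = step (\<lambda>_. c) x" by (intro step_cong) auto
  then show ?case using Suc step_const by simp
qed auto

lemma step_iterate_selfadjoint: "ip f ((step ^^ s) g) = ip ((step ^^ s) f) g"
proof (induction s arbitrary: f)
  case (Suc s)
  have "ip f ((step ^^ Suc s) g) = ip (step f) ((step ^^ s) g)" by (simp add: step_selfadjoint)
  also have "\<dots> = ip ((step ^^ s) (step f)) g" by (rule Suc)
  finally show ?case by (simp add: funpow_swap1)
qed auto

lemma eigenbasis_quadratic:
  assumes orth: "\<And>k l. k < card S \<Longrightarrow> l < card S \<Longrightarrow> ip (u k) (u l) = (if k = l then 1 else 0)"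
    and eig: "\<And>k x. k < card S \<Longrightarrow> x \<in> S \<Longrightarrow> step (u k) x = e k * u k x"
    and compl: "\<And>g x. x \<in> S \<Longrightarrow> g x = (\<Sum>k<card S. ip (u k) g * u k x)"
  shows "ip h ((step ^^ s) h) = (\<Sum>k<card S. e k ^ s * (ip (u k) h)\<^sup>2)"
proof -
  have su: "ip (u k) ((step ^^ s) h) = e k ^ s * ip (u k) h" if k: "k < card S" for k
  proof (induction s)
    case (Suc s)
    have "ip (u k) ((step ^^ Suc s) h) = ip (step (u k)) ((step ^^ s) h)" by (simp add: step_selfadjoint)
    also have "\<dots> = ip (\<lambda>x. e k * u k x) ((step ^^ s) h)" by (rule ip_cong) (auto simp: eig k)
    finally show ?case using Suc by (simp add: ip_scale_left)
  qed auto
  have "ip h ((step ^^ s) h) = ip (\<lambda>x. \<Sum>k<card S. ip (u k) h * u k x) ((step ^^ s) h)"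
    by (rule ip_cong[OF compl refl])
  also have "\<dots> = (\<Sum>k<card S. ip (u k) h * ip (u k) ((step ^^ s) h))"
    unfolding ip_def[of _ "(step ^^ s) h"]
    by (simp add: sum_distrib_left sum_distrib_right mult_ac) (subst sum.swap, simp add: mult_ac)
  also have "\<dots> = (\<Sum>k<card S. e k ^ s * (ip (u k) h)\<^sup>2)"
    by (intro sum.cong refl) (simp add: su power2_eq_square)
  finally show ?thesis .
qed

lemma eigenbasis:
  obtains u where
    "\<And>k l. k < card S \<Longrightarrow> l < card S \<Longrightarrow> ip (u k) (u l) = (if k = l then 1 else 0)"
    "\<And>k x. k < card S \<Longrightarrow> x \<in> S \<Longrightarrow> step (u k) x = eigenvalues_desc S P ! k * u k x"
    "\<And>h s. ip h ((step ^^ s) h) = (\<Sum>k<card S. (eigenvalues_desc S P ! k) ^ s * (ip (u k) h)\<^sup>2)"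
    "\<And>k l. k \<le> l \<Longrightarrow> l < card S \<Longrightarrow> eigenvalues_desc S P ! l \<le> eigenvalues_desc S P ! k"
    "\<And>k. k < card S \<Longrightarrow> eigenvalues_desc S P ! k \<le> 1"
proof -
  let ?ev = "\<lambda>k. eigenvalues_desc S P ! k"
  obtain u where u: "length (eigenvalues_desc S P) = card S"
    "sorted_wrt (\<ge>) (eigenvalues_desc S P)"
    "\<And>k x. k < card S \<Longrightarrow> x \<in> S \<Longrightarrow> (\<Sum>y\<in>S. P x y * u k y) = ?ev k * u k x"
    "\<And>k l. k < card S \<Longrightarrow> l < card S \<Longrightarrow> (\<Sum>x\<in>S. \<pi> x * u k x * u l x) = (if k = l then 1 else 0)"
    "\<And>g x. x \<in> S \<Longrightarrow> g x = (\<Sum>k<card S. (\<Sum>y\<in>S. \<pi> y * u k y * g y) * u k x)"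
    by (rule reversible_kernel_eigenbasis[OF finite_S _ reversible], erule pi_pos, rule that)
  have le1: "?ev k \<le> 1" if k: "k < card S" for k
  proof -
    have "ip (u k) (step (u k)) = ip (u k) (\<lambda>x. ?ev k * u k x)"
      by (rule ip_cong) (auto simp: step_def u(3) k)
    also have "\<dots> = ?ev k" using u(4)[OF k k] by (simp add: ip_scale_right) (simp add: ip_def)
    finally show ?thesis using ip_step_le[of "u k"] u(4)[OF k k] by (simp add: ip_def)
  qed
  have mono: "?ev l \<le> ?ev k" if "k \<le> l" "l < card S" for k l
    using that u(1,2) by (cases "k = l") (auto simp: sorted_wrt_iff_nth_less)
  have orth: "ip (u k) (u l) = (if k = l then 1 else 0)" if "k < card S" "l < card S" for k l
    using u(4)[OF that] by (simp add: ip_def)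
  have eig: "step (u k) x = ?ev k * u k x" if "k < card S" "x \<in> S" for k x
    using u(3)[OF that] by (simp add: step_def)
  have "g x = (\<Sum>k<card S. ip (u k) g * u k x)" if "x \<in> S" for g x
    using u(5)[OF that, of g] unfolding ip_def .
  note quad = eigenbasis_quadratic[OF orth eig this]
  show thesis by (rule that[of u, OF orth eig quad mono le1])
qed

text \<open>For odd exponents the power function is monotone on all reals, so negative eigenvalues do no
  harm. The eigenfunction with number 0 need not be constant when the eigenvalue 1 is multiple;
  therefore the bound is first shown on its orthogonal complement and then transferred
  to the complement of the constants by a combination of g and the constant 1.\<close>

lemma ip_funpow_le_gap_power:
  assumes two: "card S \<ge> 2" and odd: "odd s" and mean: "ip (\<lambda>_. 1) g = 0"
  shows "ip g ((step ^^ s) g) \<le> (1 - gap S P) ^ s * ip g g"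
proof -
  obtain u where
    orth: "\<And>k l. k < card S \<Longrightarrow> l < card S \<Longrightarrow> ip (u k) (u l) = (if k = l then 1 else 0)" and
    "\<And>k x. k < card S \<Longrightarrow> x \<in> S \<Longrightarrow> step (u k) x = eigenvalues_desc S P ! k * u k x" and
    quad: "\<And>h s. ip h ((step ^^ s) h) = (\<Sum>k<card S. (eigenvalues_desc S P ! k) ^ s * (ip (u k) h)\<^sup>2)" and
    mono: "\<And>k l. k \<le> l \<Longrightarrow> l < card S \<Longrightarrow> eigenvalues_desc S P ! l \<le> eigenvalues_desc S P ! k" and
    le1: "\<And>k. k < card S \<Longrightarrow> eigenvalues_desc S P ! k \<le> 1"
    by (rule eigenbasis) blast
  let ?ev = "\<lambda>k. eigenvalues_desc S P ! k"
  define lam where "lam = ?ev 1 ^ s"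
  have lam_gap: "lam = (1 - gap S P) ^ s" unfolding lam_def gap_def using two by simp
  have lam1: "lam \<le> 1" unfolding lam_def using power_mono_odd[OF odd le1[of 1]] two by simp
  have norm: "ip h h = (\<Sum>k<card S. (ip (u k) h)\<^sup>2)" for h using quad[of h 0] by simp
  have orth_bound: "ip h ((step ^^ s) h) \<le> lam * ip h h" if h: "ip (u 0) h = 0" for h
  proof -
    have "?ev k ^ s * (ip (u k) h)\<^sup>2 \<le> lam * (ip (u k) h)\<^sup>2" if k: "k < card S" for k
    proof (cases "k = 0")
      case False
      hence "?ev k ^ s \<le> lam" unfolding lam_def using k by (intro power_mono_odd[OF odd] mono) auto
      thus ?thesis by (rule mult_right_mono) simp
    qed (simp add: h)
    thus ?thesis unfolding quad norm sum_distrib_left by (intro sum_mono) auto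
  qed
  have gen: "ip g ((step ^^ s) g) \<le> ip g g"
  proof -
    have "?ev k ^ s * (ip (u k) g)\<^sup>2 \<le> (ip (u k) g)\<^sup>2" if k: "k < card S" for k
      using mult_right_mono[OF power_mono_odd[OF odd le1[OF k]], of "(ip (u k) g)\<^sup>2"] by simp
    thus ?thesis unfolding quad norm by (intro sum_mono) auto
  qed
  define a where "a = ip (u 0) (\<lambda>_. 1)"
  define b where "b = ip (u 0) g"
  define h where "h = (\<lambda>x. b * 1 + (- a) * g x)"
  have one: "ip (\<lambda>_. 1) (\<lambda>_. 1) = 1" unfolding ip_def using pi_sum by simp
  have h0: "ip (u 0) h = 0"
    unfolding h_def ip_add_right ip_scale_right a_def b_def by simp
  have hh: "ip h h = b\<^sup>2 + a\<^sup>2 * ip g g"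
    unfolding h_def ip_add_right ip_scale_right ip_add_left ip_scale_left one mean ip_commute[of g "\<lambda>_. 1"]
    by (simp add: power2_eq_square)
  have s1: "ip (\<lambda>_. 1) ((step ^^ s) g) = 0"
  proof -
    have "ip (\<lambda>_. 1) ((step ^^ s) g) = ip ((step ^^ s) (\<lambda>_. 1)) g" by (rule step_iterate_selfadjoint)
    also have "\<dots> = ip (\<lambda>_. 1) g" by (rule ip_cong) (auto simp: step_iterate_const)
    finally show ?thesis using mean by simp
  qed
  have "ip h ((step ^^ s) h) = ip h (\<lambda>x. b * (step ^^ s) (\<lambda>_. 1) x + (- a) * (step ^^ s) g x)"
    unfolding h_def step_iterate_linear ..
  also have "\<dots> = ip h (\<lambda>x. b * 1 + (- a) * (step ^^ s) g x)"
    by (rule ip_cong) (auto simp: step_iterate_const)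
  also have "\<dots> = b\<^sup>2 + a\<^sup>2 * ip g ((step ^^ s) g)"
    unfolding h_def ip_add_right ip_scale_right ip_add_left ip_scale_left one mean s1 ip_commute[of g "\<lambda>_. 1"]
    by (simp add: power2_eq_square)
  finally have key: "b\<^sup>2 + a\<^sup>2 * ip g ((step ^^ s) g) \<le> lam * (b\<^sup>2 + a\<^sup>2 * ip g g)"
    using orth_bound[OF h0] hh by simp
  have "ip g ((step ^^ s) g) \<le> lam * ip g g"
  proof (cases "a = 0")
    case False
    have "lam * b\<^sup>2 \<le> b\<^sup>2" using mult_right_mono[OF lam1, of "b\<^sup>2"] by simp
    hence "a\<^sup>2 * ip g ((step ^^ s) g) \<le> a\<^sup>2 * (lam * ip g g)" using key by (simp add: algebra_simps)
    thus ?thesis using False by (simp add: mult_le_cancel_left)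
  next
    case True
    show ?thesis
    proof (cases "b = 0")
      case True
      thus ?thesis using orth_bound[of g] unfolding b_def by simp
    next
      case False
      hence "lam \<ge> 1" using key \<open>a = 0\<close> by (simp add: mult_le_cancel_right1)
      hence "lam = 1" using lam1 by simp
      thus ?thesis using gen by simp
    qed
  qed
  thus ?thesis unfolding lam_gap .
qed

lemma poincare:
  assumes two: "card S \<ge> 2"
  shows "gap S P * (ip g g - (ip (\<lambda>_. 1) g)\<^sup>2) \<le> ip g g - ip g (step g)"
proof -
  define c where "c = ip (\<lambda>_. 1) g"
  define h where "h = (\<lambda>x. 1 * g x + (- c) * 1)"
  have one: "ip (\<lambda>_. 1) (\<lambda>_. 1) = 1" unfolding ip_def using pi_sum by simp
  have h0: "ip (\<lambda>_. 1) h = 0"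
    unfolding h_def ip_add_right ip_scale_right one c_def by simp
  have hh: "ip h h = ip g g - c\<^sup>2"
    unfolding h_def ip_add_right ip_scale_right ip_add_left ip_scale_left one ip_commute[of g "\<lambda>_. 1"] c_def
    by (simp add: power2_eq_square)
  have s1: "ip (\<lambda>_. 1) (step g) = c"
  proof -
    have "ip (\<lambda>_. 1) (step g) = ip (step (\<lambda>_. 1)) g" by (rule step_selfadjoint)
    also have "\<dots> = ip (\<lambda>_. 1) g" by (rule ip_cong) (auto simp: step_const)
    finally show ?thesis using c_def by simp
  qed
  have "ip h (step h) = ip h (\<lambda>x. 1 * step g x + (- c) * step (\<lambda>_. 1) x)"
    unfolding h_def step_linear ..
  also have "\<dots> = ip h (\<lambda>x. 1 * step g x + (- c) * 1)"
    by (rule ip_cong) (auto simp: step_const)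
  also have "\<dots> = ip g (step g) - c\<^sup>2"
    unfolding h_def ip_add_right ip_scale_right ip_add_left ip_scale_left one s1 ip_commute[of g "\<lambda>_. 1"]
    by (simp add: power2_eq_square flip: c_def)
  finally have "ip g (step g) - c\<^sup>2 \<le> (1 - gap S P) * (ip g g - c\<^sup>2)"
    using ip_funpow_le_gap_power[OF two _ h0, of 1] hh by simp
  thus ?thesis unfolding c_def by (simp add: algebra_simps)
qed

lemma mean_zero_combination:
  obtains a b :: real where "a * ip (\<lambda>_. 1) f + b * ip (\<lambda>_. 1) g = 0" "(a, b) \<noteq> (0, 0)"
proof (cases "ip (\<lambda>_. 1) g = 0")
  case True thus ?thesis by (intro that[of 0 1]) auto
next
  case False thus ?thesis by (intro that[of "ip (\<lambda>_. 1) g" "- ip (\<lambda>_. 1) f"]) auto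
qed

text \<open>Converse of the Poincare inequality: the span of the two leading eigenfunctions contains a
  nonzero function of mean zero.\<close>

lemma gap_geI:
  assumes two: "card S \<ge> 2"
    and bound: "\<And>g. ip (\<lambda>_. 1) g = 0 \<Longrightarrow> c * ip g g \<le> ip g g - ip g (step g)"
  shows "c \<le> gap S P"
proof -
  obtain u where
    orth: "\<And>k l. k < card S \<Longrightarrow> l < card S \<Longrightarrow> ip (u k) (u l) = (if k = l then 1 else 0)" and
    eig: "\<And>k x. k < card S \<Longrightarrow> x \<in> S \<Longrightarrow> step (u k) x = eigenvalues_desc S P ! k * u k x" and
    quad: "\<And>h s. ip h ((step ^^ s) h) = (\<Sum>k<card S. (eigenvalues_desc S P ! k) ^ s * (ip (u k) h)\<^sup>2)" and
    mono: "\<And>k l. k \<le> l \<Longrightarrow> l < card S \<Longrightarrow> eigenvalues_desc S P ! l \<le> eigenvalues_desc S P ! k"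
    by (rule eigenbasis) blast
  let ?ev = "\<lambda>k. eigenvalues_desc S P ! k"
  obtain a b :: real where ab: "a * ip (\<lambda>_. 1) (u 0) + b * ip (\<lambda>_. 1) (u 1) = 0" "(a, b) \<noteq> (0, 0)"
    by (rule mean_zero_combination)
  define h where "h = (\<lambda>x. a * u 0 x + b * u 1 x)"
  have "ip (\<lambda>_. 1) h = 0" unfolding h_def ip_add_right ip_scale_right using ab by simp
  from bound[OF this] have b1: "c * ip h h \<le> ip h h - ip h (step h)" .
  have hk: "ip (u k) h = (if k = 0 then a else if k = 1 then b else 0)" if "k < card S" for k
    unfolding h_def ip_add_right ip_scale_right using orth that two by auto
  have norm: "ip h h = (\<Sum>k<card S. (ip (u k) h)\<^sup>2)" using quad[of h 0] by simp
  have "?ev 1 * (ip (u k) h)\<^sup>2 \<le> ?ev k * (ip (u k) h)\<^sup>2" if k: "k < card S" for k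
    using mono[of 0 1] two unfolding hk[OF k] by (auto intro: mult_right_mono)
  hence "?ev 1 * ip h h \<le> ip h ((step ^^ 1) h)"
    unfolding quad norm sum_distrib_left by (intro sum_mono) auto
  moreover have "ip h h > 0"
  proof -
    have "ip h h \<ge> (\<Sum>k\<in>{0,1}. (ip (u k) h)\<^sup>2)"
      unfolding norm by (rule sum_mono2) (use two in auto)
    moreover have "(\<Sum>k\<in>{0,1::nat}. (ip (u k) h)\<^sup>2) = a\<^sup>2 + b\<^sup>2" using hk two by simp
    moreover have "a\<^sup>2 + b\<^sup>2 > 0" using ab(2) by (auto simp: sum_power2_gt_zero_iff)
    ultimately show ?thesis by simp
  qed
  ultimately have "(c + ?ev 1) * ip h h \<le> 1 * ip h h" using b1 by (simp add: algebra_simps)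
  hence "c + ?ev 1 \<le> 1" using \<open>ip h h > 0\<close> by (simp only: mult_le_cancel_right_pos)
  thus ?thesis unfolding gap_def using two by simp
qed

lemma nonconstant_exists:
  assumes "card S \<ge> 2"
  obtains g where "ip (\<lambda>_. 1) g = 0" "ip g g > 0"
proof -
  obtain u where
    orth: "\<And>k l. k < card S \<Longrightarrow> l < card S \<Longrightarrow> ip (u k) (u l) = (if k = l then 1 else 0)"
    by (rule eigenbasis) blast
  obtain a b :: real where ab: "a * ip (\<lambda>_. 1) (u 0) + b * ip (\<lambda>_. 1) (u 1) = 0" "(a, b) \<noteq> (0, 0)"
    by (rule mean_zero_combination)
  define h where "h = (\<lambda>x. a * u 0 x + b * u 1 x)"
  have "ip (\<lambda>_. 1) h = 0" unfolding h_def ip_add_right ip_scale_right using ab by simp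
  moreover have "ip h h = a\<^sup>2 + b\<^sup>2"
    unfolding h_def ip_add_right ip_scale_right ip_add_left ip_scale_left
    using orth assms by (simp add: power2_eq_square)
  moreover have "a\<^sup>2 + b\<^sup>2 > 0" using ab(2) by (auto simp: sum_power2_gt_zero_iff)
  ultimately show thesis using that by simp
qed

lemma gap_le_2:
  assumes "card S \<ge> 2" shows "gap S P \<le> 2"
proof -
  obtain g where g: "ip (\<lambda>_. 1) g = 0" "ip g g > 0" using nonconstant_exists[OF assms] .
  have "gap S P * ip g g \<le> ip g g - ip g (step g)" using poincare[OF assms, of g] g(1) by simp
  hence "gap S P * ip g g \<le> 2 * ip g g" using ip_step_ge[of g] by linarith
  thus ?thesis using g(2) by (simp only: mult_le_cancel_right_pos)
qed

lemma gap_pos: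
  assumes two: "card S \<ge> 2" and irr: "irreducible_on S P"
  shows "gap S P > 0"
proof (rule ccontr)
  assume "\<not> gap S P > 0"
  hence ev1: "eigenvalues_desc S P ! 1 \<ge> 1" unfolding gap_def using two by auto
  obtain u where
    orth: "\<And>k l. k < card S \<Longrightarrow> l < card S \<Longrightarrow> ip (u k) (u l) = (if k = l then 1 else 0)" and
    eig: "\<And>k x. k < card S \<Longrightarrow> x \<in> S \<Longrightarrow> step (u k) x = eigenvalues_desc S P ! k * u k x" and
    "\<And>h s. ip h ((step ^^ s) h) = (\<Sum>k<card S. (eigenvalues_desc S P ! k) ^ s * (ip (u k) h)\<^sup>2)" and
    mono: "\<And>k l. k \<le> l \<Longrightarrow> l < card S \<Longrightarrow> eigenvalues_desc S P ! l \<le> eigenvalues_desc S P ! k"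
    by (rule eigenbasis) blast
  have const: "u k x = u k y" if k: "k < 2" and xy: "x \<in> S" "y \<in> S" for k x y
  proof -
    have kc: "k < card S" using k two by simp
    have ev: "eigenvalues_desc S P ! k \<ge> 1" using mono[of k 1] ev1 k two by auto
    have "ip (u k) (step (u k)) = ip (u k) (\<lambda>x. eigenvalues_desc S P ! k * u k x)"
      by (rule ip_cong) (auto simp: eig kc)
    hence "ip (u k) (step (u k)) \<ge> ip (u k) (u k)" using orth[OF kc kc] ev by (simp add: ip_scale_right)
    hence "(\<Sum>x\<in>S. \<Sum>y\<in>S. \<pi> x * P x y * (u k x - u k y)\<^sup>2) \<le> 0"
      unfolding dirichlet_form_eq by simp
    moreover have nn: "0 \<le> \<pi> x * P x y * (u k x - u k y)\<^sup>2" if "x \<in> S" "y \<in> S" for x y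
      using that by (simp add: pi_pos P_nonneg less_imp_le)
    ultimately have "(\<Sum>x\<in>S. \<Sum>y\<in>S. \<pi> x * P x y * (u k x - u k y)\<^sup>2) = 0"
      by (intro antisym sum_nonneg) auto
    hence "\<forall>x\<in>S. \<forall>y\<in>S. \<pi> x * P x y * (u k x - u k y)\<^sup>2 = 0"
      using nn finite_S by (simp add: sum_nonneg_eq_0_iff sum_nonneg)
    hence edge: "u k x = u k y" if "x \<in> S" "y \<in> S" "P x y > 0" for x y
      using that pi_pos[of x] by fastforce
    have "(x, y) \<in> {(u, v). u \<in> S \<and> v \<in> S \<and> P u v > 0}\<^sup>*"
      using irr xy unfolding irreducible_on_def by blast
    thus ?thesis by (induction rule: rtrancl_induct) (use edge in auto)
  qed
  obtain x where x: "x \<in> S" using two by (metis card.empty ex_in_conv not_numeral_le_zero)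
  have ips: "ip (u k) (u l) = u k x * u l x" if "k < 2" "l < 2" for k l
  proof -
    have "ip (u k) (u l) = ip (\<lambda>_. u k x) (\<lambda>_. u l x)" by (rule ip_cong) (auto intro: const[OF that(1) _ x] const[OF that(2) _ x])
    also have "\<dots> = u k x * u l x * (\<Sum>x\<in>S. \<pi> x)" unfolding ip_def sum_distrib_left by (simp add: mult_ac)
    finally show ?thesis using pi_sum by simp
  qed
  have "u 0 x * u 0 x = 1" "u 1 x * u 1 x = 1" "u 0 x * u 1 x = 0"
    using ips[of 0 0] ips[of 1 1] ips[of 0 1] orth[of 0 0] orth[of 1 1] orth[of 0 1] two by auto
  thus False by auto
qed

end

context reversible_chain
begin

lemma dirichlet_bilinear:
  "(\<Sum>x\<in>S. \<Sum>y\<in>S. \<pi> x * P x y * ((f x - f y) * (h x - h y))) = 2 * (ip f h - ip f (step h))"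
proof -
  have "(\<Sum>x\<in>S. \<Sum>y\<in>S. \<pi> x * P x y * ((f x - f y) * (h x - h y)))
     = (\<Sum>x\<in>S. \<Sum>y\<in>S. \<pi> x * P x y * (f x * h x)) + (\<Sum>x\<in>S. \<Sum>y\<in>S. \<pi> x * P x y * (f y * h y))
     - ip f (step h) - ip h (step f)"
    unfolding ip_step sum.distrib[symmetric] sum_subtractf[symmetric]
    by (intro sum.cong refl) (simp add: algebra_simps)
  also have "ip h (step f) = ip f (step h)" by (metis step_selfadjoint ip_commute)
  finally show ?thesis
    unfolding sum_pi_P_left sum_pi_P_right[of "\<lambda>y. f y * h y"] ip_def by (simp add: algebra_simps)
qed

end

section \<open>Path weights\<close>

context reversible_chain
begin

text \<open>Paths are lists of states. All expectations over the chain on a time interval of length r are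
  written as finite sums over the paths of length r.\<close>

definition paths :: "nat \<Rightarrow> 'a list set" where
  "paths r = {w. set w \<subseteq> S \<and> length w = r}"

text \<open>The probability of continuing from z along a given path; z itself is not an entry of the path.\<close>

primrec wt :: "'a \<Rightarrow> 'a list \<Rightarrow> real" where
  "wt z [] = 1"
| "wt z (y # w) = P z y * wt y w"

text \<open>The probability of a path under the stationary chain.\<close>

primrec pw :: "'a list \<Rightarrow> real" where
  "pw [] = 1"
| "pw (y # w) = \<pi> y * wt y w"

lemma finite_paths [simp]: "finite (paths r)"
  unfolding paths_def using finite_lists_length_eq[OF finite_S] .

lemma paths_0 [simp]: "paths 0 = {[]}"
  unfolding paths_def by auto

lemma paths_length: "w \<in> paths r \<Longrightarrow> length w = r" unfolding paths_def by auto

lemma paths_set: "w \<in> paths r \<Longrightarrow> set w \<subseteq> S" unfolding paths_def by auto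

lemma append_in_paths: "u \<in> paths r \<Longrightarrow> v \<in> paths s \<Longrightarrow> u @ v \<in> paths (r + s)"
  unfolding paths_def by auto

lemma take_in_paths: "w \<in> paths r \<Longrightarrow> i \<le> r \<Longrightarrow> take i w \<in> paths i"
  unfolding paths_def by (auto dest: in_set_takeD)

lemma drop_in_paths: "w \<in> paths r \<Longrightarrow> drop i w \<in> paths (r - i)"
  unfolding paths_def by (auto dest: in_set_dropD)

lemma rev_in_paths: "w \<in> paths r \<Longrightarrow> rev w \<in> paths r"
  unfolding paths_def by auto

lemma last_in_S: "z \<in> S \<Longrightarrow> u \<in> paths r \<Longrightarrow> last (z # u) \<in> S"
  unfolding paths_def by (cases u rule: rev_cases) auto

lemma sum_paths_add: "(\<Sum>w\<in>paths (r + s). H w) = (\<Sum>u\<in>paths r. \<Sum>v\<in>paths s. H (u @ v))"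
proof -
  have "(\<Sum>u\<in>paths r. \<Sum>v\<in>paths s. H (u @ v)) = (\<Sum>(u, v)\<in>paths r \<times> paths s. H (u @ v))"
    by (simp add: sum.cartesian_product)
  also have "\<dots> = (\<Sum>w\<in>paths (r + s). H w)"
    by (rule sum.reindex_bij_witness[of _ "\<lambda>w. (take r w, drop r w)" "\<lambda>(u, v). u @ v"])
      (auto simp: paths_def dest: in_set_takeD in_set_dropD)
  finally show ?thesis by simp
qed

lemma sum_paths_1: "(\<Sum>w\<in>paths (Suc 0). H w) = (\<Sum>y\<in>S. H [y])"
  by (rule sum.reindex_bij_witness[of _ "\<lambda>y. [y]" hd]) (auto simp: paths_def length_Suc_conv)

lemma sum_paths_Suc: "(\<Sum>w\<in>paths (Suc r). H w) = (\<Sum>y\<in>S. \<Sum>w\<in>paths r. H (y # w))"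
  using sum_paths_add[of H "Suc 0" r] by (simp add: sum_paths_1[of "\<lambda>u. \<Sum>v\<in>paths r. H (u @ v)"])

lemma sum_paths_rev: "(\<Sum>w\<in>paths r. H (rev w)) = (\<Sum>w\<in>paths r. H w)"
  by (rule sum.reindex_bij_witness[of _ rev rev]) (auto simp: rev_in_paths)

lemma wt_nonneg: "z \<in> S \<Longrightarrow> set w \<subseteq> S \<Longrightarrow> 0 \<le> wt z w"
  by (induction w arbitrary: z) (auto simp: P_nonneg)

lemma wt_nonneg': "z \<in> S \<Longrightarrow> w \<in> paths r \<Longrightarrow> 0 \<le> wt z w"
  by (auto intro: wt_nonneg dest: paths_set)

lemma pw_nonneg: "w \<in> paths r \<Longrightarrow> 0 \<le> pw w"
  by (cases w) (auto simp: paths_def pi_pos wt_nonneg less_imp_le)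

lemma wt_append: "wt z (u @ v) = wt z u * wt (last (z # u)) v"
  by (induction u arbitrary: z) (auto simp: mult_ac)

lemma pw_append: "u \<noteq> [] \<Longrightarrow> pw (u @ v) = pw u * wt (last u) v"
  by (cases u) (auto simp: wt_append mult_ac)

lemma sum_wt: "z \<in> S \<Longrightarrow> (\<Sum>w\<in>paths r. wt z w) = 1"
proof (induction r arbitrary: z)
  case (Suc r)
  have "(\<Sum>w\<in>paths (Suc r). wt z w) = (\<Sum>y\<in>S. P z y * (\<Sum>w\<in>paths r. wt y w))"
    by (simp add: sum_paths_Suc sum_distrib_left)
  also have "\<dots> = (\<Sum>y\<in>S. P z y)" using Suc.IH by simp
  finally show ?case using P_sum[OF Suc.prems] by simp
qed simp

lemma pw_rev: "set w \<subseteq> S \<Longrightarrow> pw (rev w) = pw w"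
proof (induction w rule: induct_list012)
  case (3 y z v)
  have "pw (rev (y # z # v)) = pw (rev (z # v)) * P z y"
    using pw_append[of "rev (z # v)" "[y]"] by simp
  also have "pw (rev (z # v)) = \<pi> z * wt z v" using 3 by simp
  also have "\<pi> z * wt z v * P z y = \<pi> y * P y z * wt z v" using 3 balance[of z y] by simp
  finally show ?case by simp
qed auto

lemma pw_rev_append:
  assumes "w \<noteq> []" "set w \<subseteq> S" "set v \<subseteq> S"
  shows "pw (rev v @ w) = pw w * wt (hd w) v"
proof -
  have "pw (rev v @ w) = pw (rev w @ v)" using pw_rev[of "rev w @ v"] assms by simp
  also have "\<dots> = pw (rev w) * wt (last (rev w)) v" using assms by (intro pw_append) auto
  finally show ?thesis using assms by (simp add: pw_rev last_rev)
qed

lemma sum_pw_append: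
  assumes "u \<in> paths r"
  shows "(\<Sum>v\<in>paths s. pw (u @ v)) = pw u"
proof (cases "u = []")
  case True
  show ?thesis
  proof (cases s)
    case (Suc s')
    have "(\<Sum>v\<in>paths s. pw v) = (\<Sum>y\<in>S. \<pi> y * (\<Sum>w\<in>paths s'. wt y w))"
      unfolding Suc sum_paths_Suc by (simp add: sum_distrib_left)
    also have "\<dots> = 1" using pi_sum by (simp add: sum_wt)
    finally show ?thesis using True by simp
  qed (use True in simp)
next
  case False
  have "last u \<in> S" using False assms by (auto simp: paths_def)
  thus ?thesis using False by (simp add: pw_append sum_wt flip: sum_distrib_left)
qed

lemma sum_pw: "(\<Sum>v\<in>paths s. pw v) = 1"
  using sum_pw_append[of "[]" 0 s] by simp

lemma sum_pw_append_left:
  assumes "u \<in> paths r"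
  shows "(\<Sum>v\<in>paths s. pw (v @ u)) = pw u"
proof -
  have "(\<Sum>v\<in>paths s. pw (v @ u)) = (\<Sum>v\<in>paths s. pw (rev u @ rev v))"
    using assms by (intro sum.cong refl) (subst pw_rev[symmetric], auto simp: paths_def)
  also have "\<dots> = (\<Sum>v\<in>paths s. pw (rev u @ v))" by (rule sum_paths_rev)
  also have "\<dots> = pw (rev u)" by (rule sum_pw_append[OF rev_in_paths[OF assms]])
  finally show ?thesis using assms by (simp add: pw_rev paths_def)
qed

lemma sum_pw_take: "(\<Sum>w\<in>paths (r + s). pw w * H (take r w)) = (\<Sum>u\<in>paths r. pw u * H u)"
  unfolding sum_paths_add
  by (intro sum.cong refl) (simp add: paths_length sum_pw_append flip: sum_distrib_right cong: sum.cong)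

lemma sum_pw_drop: "(\<Sum>w\<in>paths (s + r). pw w * H (drop s w)) = (\<Sum>u\<in>paths r. pw u * H u)"
  unfolding sum_paths_add
  by (subst sum.swap, intro sum.cong refl)
    (simp add: paths_length sum_pw_append_left flip: sum_distrib_right cong: sum.cong)

lemma sum_wt_take:
  assumes z: "z \<in> S"
  shows "(\<Sum>w\<in>paths (r + s). wt z w * H (take r w)) = (\<Sum>u\<in>paths r. wt z u * H u)"
  unfolding sum_paths_add
proof (intro sum.cong refl)
  fix u assume u: "u \<in> paths r"
  have "(\<Sum>v\<in>paths s. wt z (u @ v) * H (take r (u @ v))) = (\<Sum>v\<in>paths s. wt z u * H u * wt (last (z # u)) v)"
    using u by (intro sum.cong refl) (simp only: wt_append, simp add: paths_length)
  also have "\<dots> = wt z u * H u"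
    using sum_wt[OF last_in_S[OF z u], of s] by (simp only: sum_distrib_left[symmetric])
  finally show "(\<Sum>v\<in>paths s. wt z (u @ v) * H (take r (u @ v))) = wt z u * H u" .
qed

text \<open>Events that depend on the path after (or before) a given piece of it are controlled by
  their worst-case probability, uniformly in the starting state.\<close>

lemma sum_pw_suffix_event:
  assumes r: "r \<ge> 1" and G: "\<And>v. v \<in> paths r \<Longrightarrow> 0 \<le> G v"
    and B: "\<And>z. z \<in> S \<Longrightarrow> (\<Sum>u\<in>paths s. wt z u * B u) \<le> \<delta>"
  shows "(\<Sum>w\<in>paths (r + s). pw w * (G (take r w) * B (drop r w))) \<le> \<delta> * (\<Sum>v\<in>paths r. pw v * G v)"
  unfolding sum_paths_add sum_distrib_left
proof (rule sum_mono)
  fix v assume v: "v \<in> paths r"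
  have ne: "v \<noteq> []" using v r by (auto simp: paths_def)
  have l: "last v \<in> S" using v ne by (auto simp: paths_def)
  have "(\<Sum>u\<in>paths s. pw (v @ u) * (G (take r (v @ u)) * B (drop r (v @ u))))
     = pw v * G v * (\<Sum>u\<in>paths s. wt (last v) u * B u)"
    unfolding sum_distrib_left using v ne by (intro sum.cong refl) (simp add: paths_length pw_append mult_ac)
  also have "\<dots> \<le> pw v * G v * \<delta>"
    using B[OF l] G[OF v] pw_nonneg[OF v] by (intro mult_left_mono) auto
  finally show "(\<Sum>u\<in>paths s. pw (v @ u) * (G (take r (v @ u)) * B (drop r (v @ u)))) \<le> \<delta> * (pw v * G v)"
    by (simp add: mult_ac)
qed

lemma sum_pw_prefix_event:
  assumes r: "r \<ge> 1" and G: "\<And>v. v \<in> paths r \<Longrightarrow> 0 \<le> G v"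
    and B: "\<And>z. z \<in> S \<Longrightarrow> (\<Sum>u\<in>paths s. wt z u * B (rev u)) \<le> \<delta>"
  shows "(\<Sum>w\<in>paths (s + r). pw w * (B (take s w) * G (drop s w))) \<le> \<delta> * (\<Sum>v\<in>paths r. pw v * G v)"
proof -
  have "(\<Sum>w\<in>paths (s + r). pw w * (B (take s w) * G (drop s w)))
     = (\<Sum>w\<in>paths (r + s). pw (rev w) * (B (take s (rev w)) * G (drop s (rev w))))"
    by (subst sum_paths_rev[symmetric]) (simp add: add.commute)
  also have "\<dots> = (\<Sum>w\<in>paths (r + s). pw w * (G (rev (take r w)) * B (rev (drop r w))))"
    by (intro sum.cong refl) (auto simp: paths_def pw_rev take_rev drop_rev mult_ac)
  also have "\<dots> \<le> \<delta> * (\<Sum>v\<in>paths r. pw v * G (rev v))"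
    by (rule sum_pw_suffix_event[OF r]) (use G B rev_in_paths in auto)
  also have "(\<Sum>v\<in>paths r. pw v * G (rev v)) = (\<Sum>v\<in>paths r. pw (rev v) * G (rev v))"
    by (intro sum.cong refl) (auto simp: pw_rev paths_def)
  also have "\<dots> = (\<Sum>v\<in>paths r. pw v * G v)" by (rule sum_paths_rev)
  finally show ?thesis .
qed

text \<open>By reversibility the past of a path is a continuation, read backwards, from its first state.\<close>

lemma sum_pw_past:
  assumes n: "n \<ge> 1"
  shows "(\<Sum>w\<in>paths n. pw w * (\<Sum>v\<in>paths s. wt (hd w) v * G v w))
       = (\<Sum>w\<in>paths (s + n). pw w * G (rev (take s w)) (drop s w))"
proof -
  have "(\<Sum>w\<in>paths (s + n). pw w * G (rev (take s w)) (drop s w))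
     = (\<Sum>v\<in>paths s. \<Sum>w\<in>paths n. pw (v @ w) * G (rev v) w)"
    unfolding sum_paths_add by (intro sum.cong refl) (simp add: paths_length)
  also have "\<dots> = (\<Sum>v\<in>paths s. \<Sum>w\<in>paths n. pw (rev v @ w) * G v w)"
    by (subst sum_paths_rev[symmetric]) simp
  also have "\<dots> = (\<Sum>v\<in>paths s. \<Sum>w\<in>paths n. pw w * (wt (hd w) v * G v w))"
  proof (intro sum.cong refl)
    fix v w assume "v \<in> paths s" "w \<in> paths n"
    thus "pw (rev v @ w) * G v w = pw w * (wt (hd w) v * G v w)"
      using n by (subst pw_rev_append) (auto simp: paths_def)
  qed
  also have "\<dots> = (\<Sum>w\<in>paths n. pw w * (\<Sum>v\<in>paths s. wt (hd w) v * G v w))"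
    by (subst sum.swap) (simp add: sum_distrib_left)
  finally show ?thesis by simp
qed

end

section \<open>Uniform hitting of a heavy state\<close>

context reversible_chain
begin

text \<open>The level sets of h are cut one value at a time. Across the cut below the value c the flow of
  h is at most the mass above the cut, while the Poincare inequality for the
  indicator bounds the flow from below; so raising the level from one value to the next
  adds at most one inverse gap to the sum. For the maximal value c the sum bounds the
  difference of the maximum of h and its mean.\<close>

lemma drift_level_bound:
  assumes two: "card S \<ge> 2" and gp: "gap S P > 0"
    and x: "x \<in> S" "h x = 0" and h: "\<And>z. z \<in> S \<Longrightarrow> 0 \<le> h z"
    and drift: "\<And>z. z \<in> S \<Longrightarrow> z \<noteq> x \<Longrightarrow> h z - step h z \<le> 1"
    and c: "c \<in> h ` S"
  shows "(\<Sum>z\<in>S. \<pi> z * max 0 (c - h z)) \<le> real (card {v\<in>h ` S. v < c}) / gap S P"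
  using c
proof (induction "card {v\<in>h ` S. v < c}" arbitrary: c rule: less_induct)
  case less
  let ?L = "{v\<in>h ` S. v < c}"
  have finL: "finite ?L" using finite_S by auto
  show ?case
  proof (cases "?L = {}")
    case True
    hence "max 0 (c - h z) = 0" if "z \<in> S" for z using that by force
    thus ?thesis by (simp add: less_imp_le[OF gp])
  next
    case False
    define c' where "c' = Max ?L"
    have c': "c' \<in> h ` S" "c' < c" using Max_in[OF finL False] unfolding c'_def by auto
    have top: "h z \<le> c'" if "z \<in> S" "h z < c" for z
      unfolding c'_def using that finL by (intro Max_ge) auto
    have "{v\<in>h ` S. v < c'} = ?L - {c'}" using c' top by force
    hence card: "card ?L = Suc (card {v\<in>h ` S. v < c'})"
      using c' finL by (metis (no_types, lifting) card.remove mem_Collect_eq)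
    have IH: "(\<Sum>z\<in>S. \<pi> z * max 0 (c' - h z)) \<le> real (card {v\<in>h ` S. v < c'}) / gap S P"
      using less.hyps[OF _ c'(1)] card by simp
    define g where "g z = (if c \<le> h z then 1 else 0 :: real)" for z
    define p where "p = (\<Sum>z\<in>S. \<pi> z * g z)"
    have c0: "c > 0" using c' h by force
    have decomp: "(\<Sum>z\<in>S. \<pi> z * max 0 (c - h z)) = (\<Sum>z\<in>S. \<pi> z * max 0 (c' - h z)) + (c - c') * (1 - p)"
    proof -
      have "\<pi> z * max 0 (c - h z) = \<pi> z * max 0 (c' - h z) + (c - c') * (\<pi> z - \<pi> z * g z)" if "z \<in> S" for z
        using top[OF that] c'(2) unfolding g_def by (cases "c \<le> h z") (auto simp: max_def algebra_simps)
      hence "(\<Sum>z\<in>S. \<pi> z * max 0 (c - h z)) = (\<Sum>z\<in>S. \<pi> z * max 0 (c' - h z)) + (c - c') * (\<Sum>z\<in>S. \<pi> z - \<pi> z * g z)"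
        by (simp add: sum.distrib sum_distrib_left)
      thus ?thesis unfolding sum_subtractf pi_sum p_def .
    qed
    have gg: "ip g g = p" "ip (\<lambda>_. 1) g = p"
      unfolding ip_def p_def g_def by (auto intro!: sum.cong)
    have "(c - c') * (\<Sum>x\<in>S. \<Sum>y\<in>S. \<pi> x * P x y * (g x - g y)\<^sup>2)
       \<le> (\<Sum>x\<in>S. \<Sum>y\<in>S. \<pi> x * P x y * ((g x - g y) * (h x - h y)))"
      unfolding sum_distrib_left
    proof (intro sum_mono)
      fix y z assume yz: "y \<in> S" "z \<in> S"
      have "(c - c') * (g y - g z)\<^sup>2 \<le> (g y - g z) * (h y - h z)"
        unfolding g_def using top[OF yz(1)] top[OF yz(2)] by (auto simp: power2_eq_square)
      hence "\<pi> y * P y z * ((c - c') * (g y - g z)\<^sup>2) \<le> \<pi> y * P y z * ((g y - g z) * (h y - h z))"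
        using yz by (intro mult_left_mono) (auto simp: P_nonneg pi_pos less_imp_le)
      thus "(c - c') * (\<pi> y * P y z * (g y - g z)\<^sup>2) \<le> \<pi> y * P y z * ((g y - g z) * (h y - h z))"
        by (simp add: mult_ac)
    qed
    hence "(c - c') * (ip g g - ip g (step g)) \<le> ip g h - ip g (step h)"
      unfolding dirichlet_form_eq dirichlet_bilinear
      by (simp only: mult.left_commute[of "c - c'" 2] mult_le_cancel_left_pos zero_less_numeral)
    also have "\<dots> = (\<Sum>z\<in>S. \<pi> z * g z * (h z - step h z))"
      unfolding ip_def by (simp add: algebra_simps sum_subtractf)
    also have "\<dots> \<le> p" unfolding p_def
    proof (rule sum_mono)
      fix z assume z: "z \<in> S"
      show "\<pi> z * g z * (h z - step h z) \<le> \<pi> z * g z"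
      proof (cases "c \<le> h z")
        case True
        hence "z \<noteq> x" using x c0 by auto
        from drift[OF z this] show ?thesis using True pi_pos[OF z] unfolding g_def by simp
      qed (simp add: g_def)
    qed
    finally have "(c - c') * (ip g g - ip g (step g)) \<le> p" .
    moreover have "gap S P * (p - p\<^sup>2) \<le> ip g g - ip g (step g)"
      using poincare[OF two, of g] unfolding gg .
    ultimately have "(c - c') * (gap S P * (p - p\<^sup>2)) \<le> p"
      using mult_left_mono[of "gap S P * (p - p\<^sup>2)" "ip g g - ip g (step g)" "c - c'"] c' by linarith
    hence "((c - c') * (1 - p) * gap S P) * p \<le> 1 * p" by (simp add: algebra_simps power2_eq_square)
    moreover have "p > 0"
    proof -
      obtain z where "z \<in> S" "h z = c" using less.prems by auto
      thus ?thesis unfolding p_def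
        by (intro sum_pos2[of _ z]) (auto simp: g_def finite_S pi_pos less_imp_le)
    qed
    ultimately have "(c - c') * (1 - p) * gap S P \<le> 1" by (simp only: mult_le_cancel_right_pos)
    hence "(c - c') * (1 - p) \<le> 1 / gap S P" using gp by (simp add: field_simps)
    thus ?thesis using IH unfolding decomp card by (simp add: add_divide_distrib)
  qed
qed

lemma drift_mean_bound:
  assumes two: "card S \<ge> 2" and gp: "gap S P > 0"
    and x: "x \<in> S" "h x = 0" and h: "\<And>z. z \<in> S \<Longrightarrow> 0 \<le> h z"
    and drift: "\<And>z. z \<in> S \<Longrightarrow> z \<noteq> x \<Longrightarrow> h z - step h z \<le> 1"
  shows "ip (\<lambda>_. 1) h \<le> 1 / (gap S P * \<pi> x)"
proof -
  define e where "e = ip (\<lambda>_. 1) h"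
  have e0: "e \<ge> 0" unfolding e_def ip_def using h by (intro sum_nonneg) (auto simp: pi_pos less_imp_le)
  define k where "k z = (if z = x then 0 else 1 :: real)" for z
  have k: "ip k k = 1 - \<pi> x"
  proof -
    have "ip k k = (\<Sum>z\<in>S. \<pi> z - (if z = x then \<pi> z else 0))" unfolding ip_def k_def by (intro sum.cong) auto
    thus ?thesis using x(1) finite_S pi_sum by (simp add: sum_subtractf)
  qed
  have ek: "e = ip k h" unfolding e_def ip_def k_def using x by (intro sum.cong) auto
  have "0 \<le> ip (\<lambda>z. e * k z + (- (1 - \<pi> x)) * h z) (\<lambda>z. e * k z + (- (1 - \<pi> x)) * h z)"
    by (rule ip_self_nonneg)
  also have "\<dots> = (1 - \<pi> x) * ((1 - \<pi> x) * ip h h - e\<^sup>2)"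
    unfolding ip_add_right ip_scale_right ip_add_left ip_scale_left k ip_commute[of h k] ek[symmetric]
    by (simp add: algebra_simps power2_eq_square)
  finally have cs: "0 \<le> (1 - \<pi> x) * ((1 - \<pi> x) * ip h h - e\<^sup>2)" .
  have px: "\<pi> x < 1"
  proof -
    obtain y where y: "y \<in> S" "y \<noteq> x"
      using two x(1) by (metis card_le_Suc0_iff_eq finite_S not_less_eq_eq numeral_2_eq_2)
    have "(\<Sum>z\<in>{x,y}. \<pi> z) \<le> (\<Sum>z\<in>S. \<pi> z)"
      using x y finite_S by (intro sum_mono2) (auto simp: pi_pos less_imp_le)
    thus ?thesis using y pi_sum pi_pos[OF y(1)] by simp
  qed
  hence "e\<^sup>2 \<le> (1 - \<pi> x) * ip h h" using cs by (simp add: zero_le_mult_iff)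
  hence "\<pi> x * ip h h \<le> ip h h - e\<^sup>2" by (simp add: algebra_simps)
  moreover have "e\<^sup>2 \<le> ip h h"
  proof -
    have "\<pi> x * ip h h \<ge> 0" using ip_self_nonneg pi_pos[OF x(1)] by simp
    thus ?thesis using calculation by linarith
  qed
  ultimately have "\<pi> x * e\<^sup>2 \<le> ip h h - e\<^sup>2"
    using mult_left_mono[of "e\<^sup>2" "ip h h" "\<pi> x"] pi_pos[OF x(1)] by linarith
  hence "gap S P * (\<pi> x * e\<^sup>2) \<le> gap S P * (ip h h - e\<^sup>2)" using gp by simp
  also have "\<dots> \<le> ip h h - ip h (step h)" using poincare[OF two, of h] unfolding e_def .
  also have "\<dots> = (\<Sum>z\<in>S. \<pi> z * h z * (h z - step h z))"
    unfolding ip_def by (simp add: algebra_simps sum_subtractf)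
  also have "\<dots> \<le> (\<Sum>z\<in>S. \<pi> z * 1 * h z)"
  proof (rule sum_mono)
    fix z assume z: "z \<in> S"
    show "\<pi> z * h z * (h z - step h z) \<le> \<pi> z * 1 * h z"
    proof (cases "z = x")
      case False
      thus ?thesis using mult_left_mono[OF drift[OF z False], of "\<pi> z * h z"] h[OF z] pi_pos[OF z] by simp
    qed (use x in simp)
  qed
  also have "\<dots> = e" unfolding e_def ip_def ..
  finally have "(gap S P * \<pi> x * e) * e \<le> 1 * e" by (simp add: power2_eq_square mult_ac)
  hence "gap S P * \<pi> x * e \<le> 1 \<or> e = 0" using e0 by (metis less_eq_real_def mult_le_cancel_right_pos)
  hence "gap S P * \<pi> x * e \<le> 1" by auto
  thus ?thesis unfolding e_def[symmetric] using gp pi_pos[OF x(1)] by (simp add: field_simps)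
qed

text \<open>A bound on mean hitting times of a state x whose weight is at least average. The function h stands
  for a truncated mean hitting time, of which only the drift inequality is used.\<close>

lemma drift_sup_bound:
  assumes two: "card S \<ge> 2" and gp: "gap S P > 0"
    and x: "x \<in> S" "h x = 0" "1 / card S \<le> \<pi> x" and h: "\<And>z. z \<in> S \<Longrightarrow> 0 \<le> h z"
    and drift: "\<And>z. z \<in> S \<Longrightarrow> z \<noteq> x \<Longrightarrow> h z - step h z \<le> 1"
    and z: "z \<in> S"
  shows "h z \<le> 2 * card S / gap S P"
proof -
  define c where "c = Max (h ` S)"
  have fin: "finite (h ` S)" "h ` S \<noteq> {}" using finite_S z by auto
  have c: "c \<in> h ` S" unfolding c_def using Max_in[OF fin] .
  have le: "h y \<le> c" if "y \<in> S" for y unfolding c_def using fin that by auto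
  have "c - ip (\<lambda>_. 1) h = (\<Sum>z\<in>S. \<pi> z * (c - h z))"
    unfolding ip_def using pi_sum by (simp add: algebra_simps sum_subtractf flip: sum_distrib_left)
  also have "\<dots> \<le> (\<Sum>z\<in>S. \<pi> z * max 0 (c - h z))"
    by (intro sum_mono mult_left_mono) (auto simp: pi_pos less_imp_le)
  also have "\<dots> \<le> real (card {v\<in>h ` S. v < c}) / gap S P"
    by (rule drift_level_bound[OF two gp x(1,2) h drift c])
  also have "\<dots> \<le> real (card S) / gap S P"
  proof -
    have "card {v\<in>h ` S. v < c} \<le> card (h ` S)" using fin by (intro card_mono) auto
    also have "\<dots> \<le> card S" using finite_S by (rule card_image_le)
    finally show ?thesis using gp by (intro divide_right_mono) auto
  qed
  finally have 1: "c \<le> ip (\<lambda>_. 1) h + card S / gap S P" by simp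
  have "ip (\<lambda>_. 1) h \<le> 1 / (gap S P * \<pi> x)" by (rule drift_mean_bound[OF two gp x(1,2) h drift])
  also have "\<dots> \<le> card S / gap S P"
    using x(3) gp two pi_pos[OF x(1)] by (simp add: field_simps)
  finally have "c \<le> card S / gap S P + card S / gap S P" using 1 by linarith
  hence "c \<le> 2 * card S / gap S P" by simp
  thus ?thesis using le[OF z] by linarith
qed

text \<open>The probability, starting from z, that none of the next r states is x. The start does not count
  as a visit.\<close>

definition avoid :: "'a \<Rightarrow> nat \<Rightarrow> 'a \<Rightarrow> real" where
  "avoid x r z = (\<Sum>w\<in>paths r. wt z w * of_bool (x \<notin> set w))"

lemma avoid_nonneg: "z \<in> S \<Longrightarrow> 0 \<le> avoid x r z"
  unfolding avoid_def by (intro sum_nonneg mult_nonneg_nonneg) (auto intro: wt_nonneg')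

lemma avoid_le_1: "z \<in> S \<Longrightarrow> avoid x r z \<le> 1"
proof -
  assume z: "z \<in> S"
  have "avoid x r z \<le> (\<Sum>w\<in>paths r. wt z w)"
    unfolding avoid_def by (intro sum_mono) (auto intro: wt_nonneg' z)
  thus ?thesis using sum_wt[OF z] by simp
qed

lemma avoid_add:
  "avoid x (r + s) z = (\<Sum>u\<in>paths r. wt z u * of_bool (x \<notin> set u) * avoid x s (last (z # u)))"
  unfolding avoid_def sum_paths_add sum_distrib_left
  by (intro sum.cong refl) (simp only: wt_append, simp)

lemma avoid_Suc: "avoid x (Suc r) z = (\<Sum>y\<in>S. P z y * (of_bool (y \<noteq> x) * avoid x r y))"
  unfolding avoid_def sum_paths_Suc sum_distrib_left by (intro sum.cong refl) auto

lemma avoid_add_le: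
  assumes z: "z \<in> S" and b: "\<And>y. y \<in> S \<Longrightarrow> avoid x s y \<le> b"
  shows "avoid x (r + s) z \<le> avoid x r z * b"
  unfolding avoid_add unfolding avoid_def[of x r] sum_distrib_right
proof (rule sum_mono)
  fix u assume u: "u \<in> paths r"
  show "wt z u * of_bool (x \<notin> set u) * avoid x s (last (z # u)) \<le> wt z u * of_bool (x \<notin> set u) * b"
    using b[OF last_in_S[OF z u]] wt_nonneg'[OF z u] by (intro mult_left_mono) auto
qed

lemma avoid_antimono: "z \<in> S \<Longrightarrow> avoid x (r + s) z \<le> avoid x r z"
  using avoid_add_le[of z x s 1 r] avoid_le_1 by simp

lemma avoid_power:
  assumes b: "\<And>y. y \<in> S \<Longrightarrow> avoid x G y \<le> b" and z: "z \<in> S" and jr: "j * G \<le> r" and b0: "0 \<le> b"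
  shows "avoid x r z \<le> b ^ j"
proof -
  have "avoid x (j * G) z \<le> b ^ j"
  proof (induction j)
    case 0
    then show ?case using avoid_le_1[OF z] by simp
  next
    case (Suc j)
    have "avoid x (j * G + G) z \<le> avoid x (j * G) z * b" by (rule avoid_add_le[OF z b])
    also have "\<dots> \<le> b ^ j * b" using Suc b0 by (intro mult_right_mono)
    finally show ?case by (simp add: add.commute mult.commute)
  qed
  moreover have "avoid x r z \<le> avoid x (j * G) z"
    using avoid_antimono[OF z, of x "j * G" "r - j * G"] jr by simp
  ultimately show ?thesis by linarith
qed

text \<open>The function h below is the mean of the hitting time of x, truncated at N; here a start at x counts
  as a hit at time 0.\<close>

lemma avoid_bound:
  assumes two: "card S \<ge> 2" and gp: "gap S P > 0" and x: "x \<in> S" "1 / card S \<le> \<pi> x"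
    and z: "z \<in> S"
  shows "real N * avoid x N z \<le> 2 * card S / gap S P"
proof (cases N)
  case (Suc N')
  define v where "v t y = of_bool (y \<noteq> x) * avoid x t y" for t y
  define h where "h y = (\<Sum>t<N. v t y)" for y
  have v0: "0 \<le> v t y" if "y \<in> S" for t y unfolding v_def using avoid_nonneg[OF that] by simp
  have h0: "0 \<le> h y" if "y \<in> S" for y unfolding h_def using v0[OF that] by (simp add: sum_nonneg)
  have hx: "h x = 0" unfolding h_def v_def by simp
  have sv: "step (v t) y = avoid x (Suc t) y" for t y
    unfolding step_def avoid_Suc v_def ..
  have sh: "step h y = (\<Sum>t<N. avoid x (Suc t) y)" for y
    unfolding sv[symmetric] h_def step_def sum_distrib_left by (rule sum.swap)
  have drift: "h y - step h y \<le> 1" if y: "y \<in> S" "y \<noteq> x" for y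
  proof -
    have "h y = (\<Sum>t<N. avoid x t y)" unfolding h_def v_def using y(2) by simp
    hence "h y - step h y = (\<Sum>t<N. avoid x t y - avoid x (Suc t) y)" unfolding sh by (simp add: sum_subtractf)
    also have "\<dots> = avoid x 0 y - avoid x N y" by (rule sum_lessThan_telescope')
    also have "\<dots> \<le> 1" using avoid_le_1[OF y(1), of x 0] avoid_nonneg[OF y(1), of x N] by linarith
    finally show ?thesis .
  qed
  have hb: "h y \<le> 2 * card S / gap S P" if "y \<in> S" for y
    by (rule drift_sup_bound[OF two gp x(1) hx x(2) h0 drift that])
  have vb: "real N * v N' y \<le> 2 * card S / gap S P" if y: "y \<in> S" for y
  proof -
    have "real N * v N' y = (\<Sum>t<N. v N' y)" by simp
    also have "\<dots> \<le> h y" unfolding h_def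
    proof (rule sum_mono)
      fix t assume "t \<in> {..<N}"
      hence "avoid x N' y \<le> avoid x t y" using avoid_antimono[OF y, of x t "N' - t"] Suc by simp
      thus "v N' y \<le> v t y" unfolding v_def by simp
    qed
    finally show ?thesis using hb[OF y] by linarith
  qed
  have "real N * avoid x N z = (\<Sum>y\<in>S. P z y * (real N * v N' y))"
    unfolding Suc avoid_Suc v_def sum_distrib_left by (simp add: mult_ac)
  also have "\<dots> \<le> (\<Sum>y\<in>S. P z y * (2 * card S / gap S P))"
    using z by (intro sum_mono mult_left_mono vb) (auto simp: P_nonneg)
  also have "\<dots> = 2 * card S / gap S P" unfolding sum_distrib_right[symmetric] using P_sum[OF z] by simp
  finally show ?thesis .
qed (use gp in simp)

end

section \<open>Weighted sums of squares\<close>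

lemma jensen_square:
  fixes q y :: "'b \<Rightarrow> real"
  assumes q: "\<And>a. a \<in> A \<Longrightarrow> 0 \<le> q a" and sum1: "(\<Sum>a\<in>A. q a) = 1"
  shows "(\<Sum>a\<in>A. q a * y a)\<^sup>2 \<le> (\<Sum>a\<in>A. q a * (y a)\<^sup>2)"
proof -
  define m where "m = (\<Sum>a\<in>A. q a * y a)"
  have "0 \<le> (\<Sum>a\<in>A. q a * (y a - m)\<^sup>2)" using q by (intro sum_nonneg) simp
  also have "\<dots> = (\<Sum>a\<in>A. q a * (y a)\<^sup>2) - 2 * m * (\<Sum>a\<in>A. q a * y a) + m\<^sup>2 * (\<Sum>a\<in>A. q a)"
    unfolding sum_distrib_left sum_subtractf[symmetric] sum.distrib[symmetric]
    by (intro sum.cong refl) (simp add: power2_eq_square algebra_simps)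
  also have "\<dots> = (\<Sum>a\<in>A. q a * (y a)\<^sup>2) - m\<^sup>2"
    unfolding sum1 m_def[symmetric] by (simp add: power2_eq_square)
  finally show ?thesis unfolding m_def by simp
qed

lemma variance_minimizes:
  fixes q y :: "'b \<Rightarrow> real"
  assumes sum1: "(\<Sum>a\<in>A. q a) = 1"
  shows "(\<Sum>a\<in>A. q a * (y a - c)\<^sup>2)
       = (\<Sum>a\<in>A. q a * (y a - (\<Sum>a\<in>A. q a * y a))\<^sup>2) + ((\<Sum>a\<in>A. q a * y a) - c)\<^sup>2"
proof -
  define m where "m = (\<Sum>a\<in>A. q a * y a)"
  have "(\<Sum>a\<in>A. q a * (y a - c)\<^sup>2)
     = (\<Sum>a\<in>A. q a * (y a - m)\<^sup>2) + 2 * (m - c) * (\<Sum>a\<in>A. q a * y a) - 2 * (m - c) * m * (\<Sum>a\<in>A. q a)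
       + (m - c)\<^sup>2 * (\<Sum>a\<in>A. q a)"
    unfolding sum_distrib_left sum_subtractf[symmetric] sum.distrib[symmetric]
    by (intro sum.cong refl) (simp add: power2_eq_square algebra_simps)
  also have "\<dots> = (\<Sum>a\<in>A. q a * (y a - m)\<^sup>2) + (m - c)\<^sup>2"
    unfolding sum1 m_def[symmetric] by simp
  finally show ?thesis unfolding m_def .
qed

lemma weighted_minkowski:
  fixes q :: "'b \<Rightarrow> real" and y :: "'i \<Rightarrow> 'b \<Rightarrow> real"
  assumes fin: "finite I" and q: "\<And>a. a \<in> A \<Longrightarrow> 0 \<le> q a" and D: "0 \<le> D"
    and c: "\<And>i. i \<in> I \<Longrightarrow> 0 \<le> c i"
    and bound: "\<And>i. i \<in> I \<Longrightarrow> (\<Sum>a\<in>A. q a * (y i a)\<^sup>2) \<le> (c i)\<^sup>2 * D"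
  shows "(\<Sum>a\<in>A. q a * (\<Sum>i\<in>I. y i a)\<^sup>2) \<le> (\<Sum>i\<in>I. c i)\<^sup>2 * D"
proof -
  have L2: "L2_set (\<lambda>a. sqrt (q a) * h a) A = sqrt (\<Sum>a\<in>A. q a * (h a)\<^sup>2)" for h
    unfolding L2_set_def using q by (intro arg_cong[of _ _ sqrt] sum.cong) (auto simp: power_mult_distrib)
  have "L2_set (\<lambda>a. sqrt (q a) * (\<Sum>i\<in>I. y i a)) A \<le> (\<Sum>i\<in>I. c i) * sqrt D"
    using fin c bound
  proof (induction I rule: finite_induct)
    case (insert i I)
    have "L2_set (\<lambda>a. sqrt (q a) * (\<Sum>i\<in>insert i I. y i a)) A
        = L2_set (\<lambda>a. sqrt (q a) * y i a + sqrt (q a) * (\<Sum>i\<in>I. y i a)) A"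
      using insert by (simp add: distrib_left)
    also have "\<dots> \<le> L2_set (\<lambda>a. sqrt (q a) * y i a) A + L2_set (\<lambda>a. sqrt (q a) * (\<Sum>i\<in>I. y i a)) A"
      by (rule L2_set_triangle_ineq)
    also have "L2_set (\<lambda>a. sqrt (q a) * y i a) A \<le> c i * sqrt D"
    proof -
      have "sqrt (\<Sum>a\<in>A. q a * (y i a)\<^sup>2) \<le> sqrt ((c i)\<^sup>2 * D)" using insert by simp
      thus ?thesis unfolding L2 using insert.prems(1)[of i] by (simp add: real_sqrt_mult)
    qed
    also have "L2_set (\<lambda>a. sqrt (q a) * (\<Sum>i\<in>I. y i a)) A \<le> (\<Sum>i\<in>I. c i) * sqrt D"
      using insert by simp
    finally show ?case using insert by (simp add: algebra_simps)
  qed (simp add: L2_set_def)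
  hence "sqrt (\<Sum>a\<in>A. q a * (\<Sum>i\<in>I. y i a)\<^sup>2) \<le> (\<Sum>i\<in>I. c i) * sqrt D" unfolding L2 .
  moreover have "0 \<le> (\<Sum>i\<in>I. c i)" using c by (simp add: sum_nonneg)
  ultimately have "(sqrt (\<Sum>a\<in>A. q a * (\<Sum>i\<in>I. y i a)\<^sup>2))\<^sup>2 \<le> ((\<Sum>i\<in>I. c i) * sqrt D)\<^sup>2"
    using q by (intro power_mono) (auto intro!: sum_nonneg)
  thus ?thesis using q D by (simp add: power_mult_distrib sum_nonneg)
qed

section \<open>Shifts of the window\<close>

context reversible_chain
begin

text \<open>Functions of the window are functions f of a multiset of states. The energy is the mean square of
  the change of f when the window of length n moves by one step; it is twice the Dirichlet
  form of the count kernel.\<close>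

definition shift_energy :: "('a multiset \<Rightarrow> real) \<Rightarrow> nat \<Rightarrow> real" where
  "shift_energy f n = (\<Sum>w\<in>paths (n + 1). pw w * (f (mset (take n w)) - f (mset (drop 1 w)))\<^sup>2)"

lemma shift_energy_nonneg: "0 \<le> shift_energy f n"
  unfolding shift_energy_def by (intro sum_nonneg mult_nonneg_nonneg) (auto simp: pw_nonneg)

text \<open>The change of f when the window starting at time t of the path X moves by one step.\<close>

definition shift_incr :: "('a multiset \<Rightarrow> real) \<Rightarrow> nat \<Rightarrow> nat \<Rightarrow> 'a list \<Rightarrow> real" where
  "shift_incr f n t X = f (mset (take n (drop t X))) - f (mset (take n (drop (Suc t) X)))"

lemma shift_incr_telescope:
  "(\<Sum>t<T. shift_incr f n t X) = f (mset (take n X)) - f (mset (take n (drop T X)))"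
  by (induction T) (auto simp: shift_incr_def)

lemma shift_incr_event:
  assumes N: "t + n + 1 \<le> N"
    and B: "\<And>z. z \<in> S \<Longrightarrow> (\<Sum>u\<in>paths t. wt z u * B (rev u)) \<le> p"
  shows "(\<Sum>X\<in>paths N. pw X * (B (take t X) * (shift_incr f n t X)\<^sup>2)) \<le> p * shift_energy f n"
proof -
  define r where "r = N - t - (n + 1)"
  have Nr: "N = t + (n + 1 + r)" using N unfolding r_def by simp
  define G where "G v = (f (mset (take n v)) - f (mset (take n (drop 1 v))))\<^sup>2" for v
  have "(\<Sum>X\<in>paths N. pw X * (B (take t X) * (shift_incr f n t X)\<^sup>2))
      = (\<Sum>X\<in>paths (t + (n + 1 + r)). pw X * (B (take t X) * G (drop t X)))"
    unfolding Nr shift_incr_def G_def by (simp add: drop_drop)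
  also have "\<dots> \<le> p * (\<Sum>v\<in>paths (n + 1 + r). pw v * G v)"
    by (rule sum_pw_prefix_event) (use B in \<open>auto simp: G_def\<close>)
  also have "(\<Sum>v\<in>paths (n + 1 + r). pw v * G v) = (\<Sum>v\<in>paths (n + 1 + r). pw v * G (take (n + 1) v))"
    unfolding G_def by (intro sum.cong refl) (simp add: drop_take)
  also have "\<dots> = (\<Sum>v\<in>paths (n + 1). pw v * G v)" by (rule sum_pw_take)
  also have "\<dots> = shift_energy f n"
    unfolding shift_energy_def G_def by (intro sum.cong refl) (simp add: paths_length)
  finally show ?thesis .
qed

lemma shift_incr_energy:
  assumes "t + n + 1 \<le> N"
  shows "(\<Sum>X\<in>paths N. pw X * (shift_incr f n t X)\<^sup>2) \<le> shift_energy f n"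
  using shift_incr_event[OF assms, of "\<lambda>_. 1" 1] by (simp add: sum_wt)

lemma shift_by:
  "(\<Sum>X\<in>paths (T + n). pw X * (f (mset (take n X)) - f (mset (drop T X)))\<^sup>2) \<le> (real T)\<^sup>2 * shift_energy f n"
proof -
  have "(\<Sum>X\<in>paths (T + n). pw X * (f (mset (take n X)) - f (mset (drop T X)))\<^sup>2)
      = (\<Sum>X\<in>paths (T + n). pw X * (\<Sum>t<T. shift_incr f n t X)\<^sup>2)"
    unfolding shift_incr_telescope by (intro sum.cong refl) (simp add: paths_length)
  also have "\<dots> \<le> (\<Sum>t<T. 1)\<^sup>2 * shift_energy f n"
    by (rule weighted_minkowski) (auto simp: pw_nonneg shift_energy_nonneg shift_incr_energy)
  finally show ?thesis by simp
qed

text \<open>The window is compared with the window that starts right after a random initial piece of the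
  path. The piece ranges over a prefix-free set, so the pieces describe a stopping time; the
  event that it is still running at time t is only used through its probability given
  the future of the path.\<close>

lemma random_shift:
  fixes p :: "'i \<Rightarrow> 'a list"
  assumes finC: "finite C" and CS: "\<And>J. J \<in> C \<Longrightarrow> set (p J) \<subseteq> S" and C0: "\<And>J. J \<in> C \<Longrightarrow> p J \<noteq> []"
    and Cn: "\<And>J. J \<in> C \<Longrightarrow> length (p J) \<le> n"
    and pref: "\<And>J J' v v'. J \<in> C \<Longrightarrow> J' \<in> C \<Longrightarrow> p J @ v = p J' @ v' \<Longrightarrow> J = J'"
    and last: "\<And>J. J \<in> C \<Longrightarrow> last (p J) = x"
    and B: "\<And>J t. J \<in> C \<Longrightarrow> t < length (p J) \<Longrightarrow> B t (take t (p J))"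
    and c0: "\<And>t. t < n \<Longrightarrow> 0 \<le> c t"
    and c: "\<And>t z. t < n \<Longrightarrow> z \<in> S \<Longrightarrow> (\<Sum>u\<in>paths t. wt z u * of_bool (B t (rev u))) \<le> (c t)\<^sup>2"
  shows "(\<Sum>J\<in>C. pw (p J) * (\<Sum>Y\<in>paths n. wt x Y * (f (mset (take n (p J @ Y))) - f (mset Y))\<^sup>2))
       \<le> (\<Sum>t<n. c t)\<^sup>2 * shift_energy f n"
proof -
  define y where "y t X = of_bool (B t (take t X)) * \<bar>shift_incr f n t X\<bar>" for t X
  define Z where "Z X = (\<Sum>t<n. y t X)\<^sup>2" for X
  have Z0: "0 \<le> Z X" for X unfolding Z_def by simp
  have "(\<Sum>J\<in>C. pw (p J) * (\<Sum>Y\<in>paths n. wt x Y * (f (mset (take n (p J @ Y))) - f (mset Y))\<^sup>2))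
      \<le> (\<Sum>J\<in>C. \<Sum>Y\<in>paths (n + (n - length (p J))). pw (p J @ Y) * Z (p J @ Y))"
  proof (rule sum_mono)
    fix J assume J: "J \<in> C"
    have xS: "x \<in> S" using CS[OF J] C0[OF J] last[OF J] by auto
    define H where "H Y = (f (mset (take n (p J @ Y))) - f (mset Y))\<^sup>2" for Y
    have "(\<Sum>Y\<in>paths n. wt x Y * H Y) = (\<Sum>Y\<in>paths (n + (n - length (p J))). wt x Y * H (take n Y))"
      by (rule sum_wt_take[OF xS, symmetric])
    also have "pw (p J) * \<dots> = (\<Sum>Y\<in>paths (n + (n - length (p J))). pw (p J @ Y) * H (take n Y))"
      using pw_append[OF C0[OF J]] last[OF J] by (simp add: sum_distrib_left mult_ac)
    also have "\<dots> \<le> (\<Sum>Y\<in>paths (n + (n - length (p J))). pw (p J @ Y) * Z (p J @ Y))"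
    proof (intro sum_mono mult_left_mono)
      fix Y assume Y: "Y \<in> paths (n + (n - length (p J)))"
      have JY: "p J @ Y \<in> paths (length (p J) + (n + (n - length (p J))))"
        by (rule append_in_paths[OF _ Y]) (use CS[OF J] in \<open>auto simp: paths_def\<close>)
      show "0 \<le> pw (p J @ Y)" by (rule pw_nonneg[OF JY])
      have "H (take n Y) = (\<Sum>t<length (p J). shift_incr f n t (p J @ Y))\<^sup>2"
        unfolding H_def shift_incr_telescope by (simp add: min_def)
      also have "\<dots> \<le> (\<Sum>t<n. y t (p J @ Y))\<^sup>2"
      proof (rule power2_le_iff_abs_le[THEN iffD2])
        show "0 \<le> (\<Sum>t<n. y t (p J @ Y))" unfolding y_def by (intro sum_nonneg) auto
        have "\<bar>\<Sum>t<length (p J). shift_incr f n t (p J @ Y)\<bar> \<le> (\<Sum>t<length (p J). \<bar>shift_incr f n t (p J @ Y)\<bar>)"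
          by (rule sum_abs)
        also have "\<dots> = (\<Sum>t<length (p J). y t (p J @ Y))"
          using B[OF J] by (intro sum.cong refl) (auto simp: y_def)
        also have "\<dots> \<le> (\<Sum>t<n. y t (p J @ Y))"
          using Cn[OF J] by (intro sum_mono2) (auto simp: y_def)
        finally show "\<bar>\<Sum>t<length (p J). shift_incr f n t (p J @ Y)\<bar> \<le> (\<Sum>t<n. y t (p J @ Y))" .
      qed
      finally show "H (take n Y) \<le> Z (p J @ Y)" unfolding Z_def .
    qed
    finally show "pw (p J) * (\<Sum>Y\<in>paths n. wt x Y * (f (mset (take n (p J @ Y))) - f (mset Y))\<^sup>2)
       \<le> (\<Sum>Y\<in>paths (n + (n - length (p J))). pw (p J @ Y) * Z (p J @ Y))" unfolding H_def .
  qed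
  also have "\<dots> = (\<Sum>(J, Y)\<in>(SIGMA J:C. paths (n + (n - length (p J)))). pw (p J @ Y) * Z (p J @ Y))"
    using finC by (simp add: sum.Sigma)
  also have "\<dots> = (\<Sum>X\<in>(\<lambda>(J, Y). p J @ Y) ` (SIGMA J:C. paths (n + (n - length (p J)))). pw X * Z X)"
  proof (subst sum.reindex)
    show "inj_on (\<lambda>(J, Y). p J @ Y) (SIGMA J:C. paths (n + (n - length (p J))))"
    proof (rule inj_onI)
      fix a b assume ab: "a \<in> (SIGMA J:C. paths (n + (n - length (p J))))"
        "b \<in> (SIGMA J:C. paths (n + (n - length (p J))))"
        "(case a of (J, Y) \<Rightarrow> p J @ Y) = (case b of (J, Y) \<Rightarrow> p J @ Y)"
      obtain J Y J' Y' where eq: "a = (J, Y)" "b = (J', Y')" by (cases a, cases b) auto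
      have "J = J'" using pref[of J J' Y Y'] ab unfolding eq by auto
      thus "a = b" using ab(3) unfolding eq by simp
    qed
  qed (auto intro: sum.cong)
  also have "\<dots> \<le> (\<Sum>X\<in>paths (2 * n). pw X * Z X)"
  proof (rule sum_mono2)
    show "(\<lambda>(J, Y). p J @ Y) ` (SIGMA J:C. paths (n + (n - length (p J)))) \<subseteq> paths (2 * n)"
      using CS Cn by (fastforce simp: paths_def)
  qed (auto simp: pw_nonneg Z0)
  also have "\<dots> \<le> (\<Sum>t<n. c t)\<^sup>2 * shift_energy f n"
    unfolding Z_def
  proof (rule weighted_minkowski)
    fix t assume "t \<in> {..<n}"
    hence t: "t < n" by simp
    have "(\<Sum>X\<in>paths (2 * n). pw X * (y t X)\<^sup>2)
        = (\<Sum>X\<in>paths (2 * n). pw X * (of_bool (B t (take t X)) * (shift_incr f n t X)\<^sup>2))"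
      unfolding y_def by (intro sum.cong refl) (simp add: power_mult_distrib)
    also have "\<dots> \<le> (c t)\<^sup>2 * shift_energy f n"
      by (rule shift_incr_event) (use t c in auto)
    finally show "(\<Sum>X\<in>paths (2 * n). pw X * (y t X)\<^sup>2) \<le> (c t)\<^sup>2 * shift_energy f n" .
  qed (use c0 in \<open>auto simp: pw_nonneg shift_energy_nonneg\<close>)
  finally show ?thesis .
qed

end

section \<open>Short windows\<close>

context reversible_chain
begin

lemma step_iterate_paths: "(step ^^ s) g z = (\<Sum>u\<in>paths s. wt z u * g (last (z # u)))"
proof (induction s arbitrary: z)
  case (Suc s)
  have "(step ^^ Suc s) g z = (\<Sum>y\<in>S. P z y * (step ^^ s) g y)" by (simp add: step_def)
  also have "\<dots> = (\<Sum>y\<in>S. P z y * (\<Sum>u\<in>paths s. wt y u * g (last (y # u))))" using Suc by simp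
  also have "\<dots> = (\<Sum>u\<in>paths (Suc s). wt z u * g (last (z # u)))"
    unfolding sum_paths_Suc sum_distrib_left by (simp add: mult_ac)
  finally show ?case .
qed simp

text \<open>Given its last state, the earlier window has the same conditional mean as the later window has
  given its first state; this is reversibility.\<close>

lemma window_covariance:
  fixes f n
  defines "g \<equiv> \<lambda>y. \<Sum>u\<in>paths n. wt y u * f (mset (y # u))"
  shows "(\<Sum>X\<in>paths (n + s + Suc n). pw X * (f (mset (take (Suc n) X)) * f (mset (drop (n + s) X))))
       = ip g ((step ^^ s) g)"
proof -
  define G where "G u w = f (mset (hd w # u)) * f (mset (drop s w))" for u w :: "'a list"
  have "(\<Sum>X\<in>paths (n + s + Suc n). pw X * (f (mset (take (Suc n) X)) * f (mset (drop (n + s) X))))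
     = (\<Sum>X\<in>paths (n + (Suc (s + n))). pw X * G (rev (take n X)) (drop n X))"
  proof (intro sum.cong)
    fix X assume "X \<in> paths (n + (Suc (s + n)))"
    hence l: "n < length X" by (simp add: paths_length)
    have "mset (take (Suc n) X) = mset (hd (drop n X) # rev (take n X))"
      using l by (simp add: take_Suc_conv_app_nth hd_drop_conv_nth)
    thus "pw X * (f (mset (take (Suc n) X)) * f (mset (drop (n + s) X))) = pw X * G (rev (take n X)) (drop n X)"
      unfolding G_def by (simp add: add.commute)
  qed (simp add: algebra_simps)
  also have "\<dots> = (\<Sum>w\<in>paths (Suc (s + n)). pw w * (\<Sum>v\<in>paths n. wt (hd w) v * G v w))"
    by (rule sum_pw_past[symmetric]) simp
  also have "\<dots> = (\<Sum>w\<in>paths (Suc (s + n)). pw w * (g (hd w) * f (mset (drop s w))))"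
    unfolding g_def G_def by (simp add: sum_distrib_left sum_distrib_right mult_ac)
  also have "\<dots> = (\<Sum>y\<in>S. \<Sum>a\<in>paths s. \<Sum>b\<in>paths n. \<pi> y * g y * (wt y a * (wt (last (y # a)) b * f (mset (last (y # a) # b)))))"
    unfolding sum_paths_Suc sum_paths_add
  proof (intro sum.cong refl)
    fix y a b assume a: "a \<in> paths s"
    have "drop s (y # a @ b) = last (y # a) # b"
    proof -
      have "y # a = butlast (y # a) @ [last (y # a)]" by (rule append_butlast_last_id[symmetric]) simp
      hence "y # a @ b = butlast (y # a) @ (last (y # a) # b)" by (metis append_Cons append_Nil append_assoc)
      moreover have "length (butlast (y # a)) = s" 
        by (simp only: length_butlast list.size paths_length[OF a])
      ultimately show ?thesis by (metis append_eq_conv_conj)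
    qed
    thus "pw (y # a @ b) * (g (hd (y # a @ b)) * f (mset (drop s (y # a @ b))))
       = \<pi> y * g y * (wt y a * (wt (last (y # a)) b * f (mset (last (y # a) # b))))"
      by (simp only: pw.simps wt_append) simp
  qed
  also have "\<dots> = (\<Sum>y\<in>S. \<pi> y * g y * (\<Sum>a\<in>paths s. wt y a * g (last (y # a))))"
  proof (intro sum.cong refl)
    fix y
    have gl: "g (last (y # a)) = (\<Sum>b\<in>paths n. wt (last (y # a)) b * f (mset (last (y # a) # b)))" for a
      unfolding g_def ..
    show "(\<Sum>a\<in>paths s. \<Sum>b\<in>paths n. \<pi> y * g y * (wt y a * (wt (last (y # a)) b * f (mset (last (y # a) # b)))))
       = \<pi> y * g y * (\<Sum>a\<in>paths s. wt y a * g (last (y # a)))"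
      unfolding gl sum_distrib_left ..
  qed
  also have "\<dots> = ip g ((step ^^ s) g)" unfolding ip_def step_iterate_paths ..
  finally show ?thesis .
qed

text \<open>Two windows at a distance s comparable to n: their covariance is at most the s-th power of the
  second eigenvalue times the variance, and their difference is a shift by at most 2 n. The
  distance is chosen odd, so that negative eigenvalues only help.\<close>

lemma poincare_short_window:
  assumes two: "card S \<ge> 2" and gp: "gap S P > 0" and n: "n \<ge> 1"
    and mean: "(\<Sum>w\<in>paths n. pw w * f (mset w)) = 0"
  shows "(\<Sum>w\<in>paths n. pw w * (f (mset w))\<^sup>2) \<le> 2 * real n * (real n + 1 / gap S P) * shift_energy f n"
proof -
  let ?V = "\<Sum>w\<in>paths n. pw w * (f (mset w))\<^sup>2"
  let ?\<gamma> = "gap S P"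
  obtain k where k: "n = Suc k" using n by (cases n) auto
  define g where "g y = (\<Sum>u\<in>paths k. wt y u * f (mset (y # u)))" for y
  define s where "s = (if odd n then n else Suc n)"
  have s: "odd s" "n \<le> s" "s \<le> Suc n" unfolding s_def by auto
  define T where "T = k + s"
  have ipg: "ip (\<lambda>_. 1) g = 0"
    using mean unfolding k ip_def g_def sum_paths_Suc by (simp add: sum_distrib_left mult_ac)
  have gV: "ip g g \<le> ?V"
  proof -
    have "ip g g = (\<Sum>y\<in>S. \<pi> y * (g y)\<^sup>2)" unfolding ip_def by (simp add: power2_eq_square mult_ac)
    also have "\<dots> \<le> (\<Sum>y\<in>S. \<pi> y * (\<Sum>u\<in>paths k. wt y u * (f (mset (y # u)))\<^sup>2))"
      unfolding g_def by (intro sum_mono mult_left_mono jensen_square) (auto simp: sum_wt wt_nonneg' pi_pos less_imp_le)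
    also have "\<dots> = ?V" unfolding k sum_paths_Suc by (simp add: sum_distrib_left mult_ac)
    finally show ?thesis .
  qed
  define \<rho> where "\<rho> = 1 / (1 + real n * ?\<gamma>)"
  have ng: "real n * ?\<gamma> > 0" using n gp by simp
  have \<rho>: "(1 - ?\<gamma>) ^ s \<le> \<rho>" "0 \<le> \<rho>"
  proof -
    show "0 \<le> \<rho>" unfolding \<rho>_def using ng by simp
    show "(1 - ?\<gamma>) ^ s \<le> \<rho>"
    proof (cases "?\<gamma> \<ge> 1")
      case True
      hence "(1 - ?\<gamma>) ^ s \<le> 0" using s(1) by (simp add: power_le_zero_eq odd_pos)
      thus ?thesis using \<open>0 \<le> \<rho>\<close> by linarith
    next
      case False
      have "(1 - ?\<gamma>) ^ s \<le> (1 - ?\<gamma>) ^ n" using False gp s by (intro power_decreasing) auto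
      moreover have "(1 - ?\<gamma>) ^ n * (1 + real n * ?\<gamma>) \<le> 1"
      proof -
        have "(1 - ?\<gamma>) ^ n * (1 + real n * ?\<gamma>) \<le> (1 - ?\<gamma>) ^ n * (1 + ?\<gamma>) ^ n"
          using False gp Bernoulli_inequality[of ?\<gamma> n] by (intro mult_left_mono) auto
        also have "\<dots> = (1 - ?\<gamma>\<^sup>2) ^ n"
          by (simp add: power_mult_distrib[symmetric] power2_eq_square algebra_simps)
        also have "\<dots> \<le> 1" using False gp by (intro power_le_one) (auto simp: power_le_one)
        finally show ?thesis .
      qed
      hence "(1 - ?\<gamma>) ^ n \<le> \<rho>" unfolding \<rho>_def using ng by (simp add: pos_le_divide_eq)
      ultimately show ?thesis by linarith
    qed
  qed
  have cov: "ip g ((step ^^ s) g) \<le> \<rho> * ?V"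
  proof -
    have "ip g ((step ^^ s) g) \<le> (1 - ?\<gamma>) ^ s * ip g g" by (rule ip_funpow_le_gap_power[OF two s(1) ipg])
    also have "\<dots> \<le> \<rho> * ip g g" using \<rho>(1) by (intro mult_right_mono) (auto simp: ip_self_nonneg)
    also have "\<dots> \<le> \<rho> * ?V" using \<rho>(2) gV by (intro mult_left_mono)
    finally show ?thesis .
  qed
  have "(\<Sum>X\<in>paths (T + n). pw X * (f (mset (take n X)) - f (mset (drop T X)))\<^sup>2)
     = (\<Sum>X\<in>paths (n + T). pw X * (f (mset (take n X)))\<^sup>2) + (\<Sum>X\<in>paths (T + n). pw X * (f (mset (drop T X)))\<^sup>2)
     - 2 * (\<Sum>X\<in>paths (T + n). pw X * (f (mset (take n X)) * f (mset (drop T X))))"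
    unfolding sum_distrib_left sum_subtractf[symmetric] add.commute[of n T] sum.distrib[symmetric]
    by (intro sum.cong refl) (simp add: power2_eq_square algebra_simps)
  also have "\<dots> = ?V + ?V - 2 * ip g ((step ^^ s) g)"
    unfolding sum_pw_take[where r = n and s = T and H = "\<lambda>u. (f (mset u))\<^sup>2"]
      sum_pw_drop[where r = n and s = T and H = "\<lambda>u. (f (mset u))\<^sup>2"]
    using window_covariance[where f = f and n = k and s = s] unfolding T_def k g_def[abs_def] by simp
  finally have "2 * ?V - 2 * ip g ((step ^^ s) g) \<le> (real T)\<^sup>2 * shift_energy f n"
    using shift_by[where T = T and n = n and f = f] by linarith
  also have "\<dots> \<le> (2 * real n)\<^sup>2 * shift_energy f n"
    using s(3) unfolding T_def k by (intro mult_right_mono power_mono) (auto simp: shift_energy_nonneg)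
  finally have "2 * (1 - \<rho>) * ?V \<le> 4 * (real n)\<^sup>2 * shift_energy f n"
    using cov by (simp add: algebra_simps power_mult_distrib)
  moreover have "1 - \<rho> = real n * ?\<gamma> / (1 + real n * ?\<gamma>)" unfolding \<rho>_def using ng by (simp add: field_simps)
  ultimately have "real n * ?\<gamma> / (1 + real n * ?\<gamma>) * ?V \<le> 2 * (real n)\<^sup>2 * shift_energy f n" by simp
  hence "real n * ?\<gamma> * ?V \<le> 2 * (real n)\<^sup>2 * shift_energy f n * (1 + real n * ?\<gamma>)"
    using ng by (simp add: field_simps)
  also have "\<dots> = real n * ?\<gamma> * (2 * real n * (real n + 1 / ?\<gamma>) * shift_energy f n)"
    using gp by (simp add: field_simps power2_eq_square)
  finally show ?thesis using ng by (simp only: mult_le_cancel_left_pos)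
qed

end

section \<open>Cutting paths at returns to a state\<close>

context reversible_chain
begin

text \<open>A property st of lists describes a stopping time: the path is stopped at its first prefix with the
  property. The paths of length i that are stopped exactly at their end, and the paths of
  length r that are not stopped at all.\<close>

definition first_hit :: "('a list \<Rightarrow> bool) \<Rightarrow> nat \<Rightarrow> 'a list set" where
  "first_hit st i = {u\<in>paths i. st u \<and> (\<forall>j<i. \<not> st (take j u))}"

definition never :: "('a list \<Rightarrow> bool) \<Rightarrow> nat \<Rightarrow> 'a list set" where
  "never st r = {w\<in>paths r. \<forall>j\<le>r. \<not> st (take j w)}"

lemma first_hit_paths: "u \<in> first_hit st i \<Longrightarrow> u \<in> paths i"
  unfolding first_hit_def by auto

lemma finite_first_hit [simp]: "finite (first_hit st i)"
  unfolding first_hit_def by auto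

lemma never_subset: "never st r \<subseteq> paths r"
  unfolding never_def by auto

lemma first_hit_unique:
  assumes "w \<in> paths r"
  shows "of_bool (w \<in> never st r) + (\<Sum>i\<le>r. of_bool (take i w \<in> first_hit st i)) = (1::real)"
proof (cases "\<exists>j\<le>r. st (take j w)")
  case False
  have "w \<in> never st r" using False assms unfolding never_def by auto
  moreover have "take i w \<notin> first_hit st i" if "i \<le> r" for i
    using False that unfolding first_hit_def by auto
  ultimately show ?thesis by simp
next
  case True
  define i where "i = (LEAST j. st (take j w))"
  obtain j where j: "j \<le> r" "st (take j w)" using True by auto
  have st: "st (take i w)" unfolding i_def using j(2) by (rule LeastI)
  have min: "\<not> st (take l w)" if "l < i" for l using that not_less_Least unfolding i_def by blast
  have ir: "i \<le> r" using j Least_le[of "\<lambda>j. st (take j w)" j] unfolding i_def by simp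
  have "take l w \<in> first_hit st l \<longleftrightarrow> l = i" if l: "l \<le> r" for l
  proof
    assume "take l w \<in> first_hit st l"
    hence h: "st (take l w)" "\<forall>j<l. \<not> st (take j (take l w))" unfolding first_hit_def by auto
    have "\<not> l < i" using min h(1) by auto
    moreover have "\<not> i < l" using h(2) st by (auto simp: min_def)
    ultimately show "l = i" by simp
  next
    assume "l = i"
    thus "take l w \<in> first_hit st l" using st min take_in_paths[OF assms l]
      unfolding first_hit_def by (auto simp: min_def)
  qed
  hence "(\<Sum>l\<le>r. of_bool (take l w \<in> first_hit st l)) = (\<Sum>l\<le>r. if l = i then 1 else 0 :: real)"
    by (intro sum.cong) auto
  also have "\<dots> = 1" using ir by simp
  finally show ?thesis using True unfolding never_def by auto
qed

lemma split_paths: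
  fixes H :: "'a list \<Rightarrow> real"
  shows "(\<Sum>w\<in>paths r. H w) = (\<Sum>i\<le>r. \<Sum>u\<in>first_hit st i. \<Sum>v\<in>paths (r - i). H (u @ v)) + (\<Sum>w\<in>never st r. H w)"
proof -
  have "(\<Sum>w\<in>paths r. H w)
     = (\<Sum>w\<in>paths r. (of_bool (w \<in> never st r) + (\<Sum>i\<le>r. of_bool (take i w \<in> first_hit st i))) * H w)"
    by (intro sum.cong refl) (simp only: first_hit_unique mult_1_left)
  also have "\<dots> = (\<Sum>w\<in>paths r. of_bool (w \<in> never st r) * H w)
      + (\<Sum>i\<le>r. \<Sum>w\<in>paths r. of_bool (take i w \<in> first_hit st i) * H w)"
    by (simp only: distrib_right sum.distrib sum_distrib_right) (subst sum.swap[of _ "{..r}"], rule refl)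
  also have "(\<Sum>w\<in>paths r. of_bool (w \<in> never st r) * H w) = (\<Sum>w\<in>never st r. H w)"
    by (rule sum.mono_neutral_cong_right) (auto simp: never_def)
  also have "(\<Sum>i\<le>r. \<Sum>w\<in>paths r. of_bool (take i w \<in> first_hit st i) * H w)
     = (\<Sum>i\<le>r. \<Sum>u\<in>first_hit st i. \<Sum>v\<in>paths (r - i). H (u @ v))"
  proof (rule sum.cong[OF refl])
    fix i assume "i \<in> {..r}"
    hence r: "r = i + (r - i)" by simp
    have "(\<Sum>w\<in>paths r. of_bool (take i w \<in> first_hit st i) * H w)
        = (\<Sum>u\<in>paths i. \<Sum>v\<in>paths (r - i). of_bool (take i (u @ v) \<in> first_hit st i) * H (u @ v))"
      by (subst r, rule sum_paths_add)
    also have "\<dots> = (\<Sum>u\<in>paths i. of_bool (u \<in> first_hit st i) * (\<Sum>v\<in>paths (r - i). H (u @ v)))"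
      unfolding sum_distrib_left by (intro sum.cong refl) (simp add: paths_length)
    also have "\<dots> = (\<Sum>u\<in>first_hit st i. \<Sum>v\<in>paths (r - i). H (u @ v))"
      by (rule sum.mono_neutral_cong_right) (auto simp: first_hit_def)
    finally show "(\<Sum>w\<in>paths r. of_bool (take i w \<in> first_hit st i) * H w)
      = (\<Sum>u\<in>first_hit st i. \<Sum>v\<in>paths (r - i). H (u @ v))" .
  qed
  finally show ?thesis by simp
qed

lemma first_hit_prefix_free:
  assumes "J \<in> first_hit st i" "J' \<in> first_hit st i'" "J @ v = J' @ v'"
  shows "J = J'"
proof -
  have J: "length J = i" "st J" "\<forall>j<i. \<not> st (take j J)" using assms(1) unfolding first_hit_def by (auto simp: paths_length)
  have J': "length J' = i'" "st J'" "\<forall>j<i'. \<not> st (take j J')" using assms(2) unfolding first_hit_def by (auto simp: paths_length)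
  have "\<not> i < i'"
  proof
    assume "i < i'"
    have "J = take i (J @ v)" using J(1) by simp
    also have "\<dots> = take i J'" unfolding assms(3) using J'(1) \<open>i < i'\<close> by simp
    finally show False using J(2) J'(3) \<open>i < i'\<close> by auto
  qed
  moreover have "\<not> i' < i"
  proof
    assume "i' < i"
    have "J' = take i' (J' @ v')" using J'(1) by simp
    also have "\<dots> = take i' J" unfolding assms(3)[symmetric] using J(1) \<open>i' < i\<close> by simp
    finally show False using J'(2) J(3) \<open>i' < i\<close> by auto
  qed
  ultimately show ?thesis using assms(3) J(1) J'(1) by simp
qed

text \<open>The path ends in x after at least L steps. With L = 0 the first such prefix ends at the first
  visit to x. With positive L and a path continuing from x, it is a block: a loop at x that
  is closed at the first visit to x not earlier than L steps after its start.\<close>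

definition returns :: "'a \<Rightarrow> nat \<Rightarrow> 'a list \<Rightarrow> bool" where
  "returns x L w \<longleftrightarrow> w \<noteq> [] \<and> L \<le> length w \<and> last w = x"

lemma first_hit_returnsD:
  assumes "b \<in> first_hit (returns x L) i"
  shows "b \<in> paths i" "b \<noteq> []" "L \<le> i" "last b = x" "length b = i" "set b \<subseteq> S"
    and "\<And>j. j < i \<Longrightarrow> \<not> returns x L (take j b)"
  using assms unfolding first_hit_def returns_def by (auto simp: paths_length dest: paths_set)

lemma take_Suc_returns: "p < length w \<Longrightarrow> w ! p = x \<Longrightarrow> L \<le> Suc p \<Longrightarrow> returns x L (take (Suc p) w)"
  unfolding returns_def by (auto simp: take_Suc_conv_app_nth)

lemma never_returns_avoids:
  assumes "w \<in> never (returns x L) r"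
  shows "x \<notin> set (drop L w)"
proof
  assume "x \<in> set (drop L w)"
  then obtain p where p: "p < length w - L" "w ! (L + p) = x" by (auto simp: in_set_conv_nth)
  have "returns x L (take (Suc (L + p)) w)" using p by (intro take_Suc_returns) auto
  moreover have "length w = r" using assms unfolding never_def by (auto simp: paths_length)
  ultimately show False using assms p unfolding never_def by auto
qed

lemma split_wt:
  "(\<Sum>w\<in>paths r. wt x w * G w)
   = (\<Sum>i\<le>r. \<Sum>b\<in>first_hit (returns x L) i. wt x b * (\<Sum>v\<in>paths (r - i). wt x v * G (b @ v)))
     + (\<Sum>w\<in>never (returns x L) r. wt x w * G w)"
proof -
  have "(\<Sum>v\<in>paths (r - i). wt x (b @ v) * G (b @ v)) = wt x b * (\<Sum>v\<in>paths (r - i). wt x v * G (b @ v))"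
    if "b \<in> first_hit (returns x L) i" for b i
    using first_hit_returnsD[OF that] by (simp only: wt_append) (simp add: sum_distrib_left mult.assoc)
  thus ?thesis by (subst split_paths[of _ r "returns x L"]) simp
qed

lemma split_pw:
  "(\<Sum>w\<in>paths r. pw w * G w)
   = (\<Sum>i\<le>r. \<Sum>J\<in>first_hit (returns x L) i. pw J * (\<Sum>v\<in>paths (r - i). wt x v * G (J @ v)))
     + (\<Sum>w\<in>never (returns x L) r. pw w * G w)"
proof -
  have "(\<Sum>v\<in>paths (r - i). pw (b @ v) * G (b @ v)) = pw b * (\<Sum>v\<in>paths (r - i). wt x v * G (b @ v))"
    if "b \<in> first_hit (returns x L) i" for b i
    using first_hit_returnsD[OF that] by (simp add: pw_append sum_distrib_left mult.assoc)
  thus ?thesis by (subst split_paths[of _ r "returns x L"]) simp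
qed

end

section \<open>Variance by deletion of blocks\<close>

context reversible_chain
begin

text \<open>Conditional mean and variance of the window when the entries k are already known, the last one
  is x, and r entries are still to come.\<close>

definition cmean :: "'a \<Rightarrow> ('a multiset \<Rightarrow> real) \<Rightarrow> 'a multiset \<Rightarrow> nat \<Rightarrow> real" where
  "cmean x f k r = (\<Sum>w\<in>paths r. wt x w * f (k + mset w))"

definition cvar :: "'a \<Rightarrow> ('a multiset \<Rightarrow> real) \<Rightarrow> 'a multiset \<Rightarrow> nat \<Rightarrow> real" where
  "cvar x f k r = (\<Sum>w\<in>paths r. wt x w * (f (k + mset w) - cmean x f k r)\<^sup>2)"

text \<open>The cost of deleting the first block b: after b only r - length b further entries fit into the
  window, without b there is room for r. A block that does not fit is not counted.\<close>

definition block_cost :: "'a \<Rightarrow> nat \<Rightarrow> ('a multiset \<Rightarrow> real) \<Rightarrow> 'a multiset \<Rightarrow> nat \<Rightarrow> real" where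
  "block_cost x L f k r = (\<Sum>i\<le>r. \<Sum>b\<in>first_hit (returns x L) i. wt x b *
     (\<Sum>w\<in>paths r. wt x w * (f (k + mset b + mset (take (r - i) w)) - f (k + mset w))\<^sup>2))"

lemma wt_first_hit_nonneg: "x \<in> S \<Longrightarrow> b \<in> first_hit (returns x L) i \<Longrightarrow> 0 \<le> wt x b"
  using wt_nonneg first_hit_returnsD(6) by blast

lemma wt_never_nonneg: "x \<in> S \<Longrightarrow> w \<in> never st r \<Longrightarrow> 0 \<le> wt x w"
  using never_subset by (auto intro: wt_nonneg')

lemma block_cost_nonneg: "x \<in> S \<Longrightarrow> 0 \<le> block_cost x L f k r"
  unfolding block_cost_def
  by (intro sum_nonneg mult_nonneg_nonneg) (auto simp: wt_first_hit_nonneg wt_nonneg')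

lemma cvar_le: "x \<in> S \<Longrightarrow> cvar x f k r \<le> (\<Sum>w\<in>paths r. wt x w * (f (k + mset w) - c)\<^sup>2)"
  unfolding cvar_def cmean_def
  using variance_minimizes[of "wt x" "paths r" "\<lambda>w. f (k + mset w)" c] by (simp add: sum_wt)

lemma second_moment_cmean:
  "x \<in> S \<Longrightarrow> (\<Sum>w\<in>paths r. wt x w * (f (k + mset w) - c)\<^sup>2) = cvar x f k r + (cmean x f k r - c)\<^sup>2"
  unfolding cvar_def cmean_def
  using variance_minimizes[of "wt x" "paths r" "\<lambda>w. f (k + mset w)" c] by (simp add: sum_wt)

lemma cmean_diff_le:
  assumes x: "x \<in> S" and r: "r \<le> r'"
  shows "(cmean x f k r - (\<Sum>w\<in>paths r'. wt x w * f' w))\<^sup>2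
     \<le> (\<Sum>w\<in>paths r'. wt x w * (f (k + mset (take r w)) - f' w)\<^sup>2)"
proof -
  have "cmean x f k r = (\<Sum>w\<in>paths r'. wt x w * f (k + mset (take r w)))"
    unfolding cmean_def using sum_wt_take[OF x, where r = r and s = "r' - r" and H = "\<lambda>w. f (k + mset w)"] r by simp
  hence "cmean x f k r - (\<Sum>w\<in>paths r'. wt x w * f' w) = (\<Sum>w\<in>paths r'. wt x w * (f (k + mset (take r w)) - f' w))"
    by (simp add: sum_subtractf algebra_simps)
  thus ?thesis using jensen_square[of "paths r'" "wt x"] x by (simp add: sum_wt wt_nonneg')
qed

text \<open>Revealing one block: the conditional mean after the block is compared with the conditional
  mean of the path from which the block has been deleted.\<close>

lemma cvar_step:
  assumes x: "x \<in> S"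
  shows "cvar x f k r \<le> block_cost x L f k r
     + (\<Sum>w\<in>never (returns x L) r. wt x w * (f (k + mset w) - cmean x f k r)\<^sup>2)
     + (\<Sum>i\<le>r. \<Sum>b\<in>first_hit (returns x L) i. wt x b * cvar x f (k + mset b) (r - i))"
proof -
  let ?m = "cmean x f k r"
  have split: "cvar x f k r = (\<Sum>i\<le>r. \<Sum>b\<in>first_hit (returns x L) i. wt x b *
        (\<Sum>v\<in>paths (r - i). wt x v * (f (k + mset (b @ v)) - ?m)\<^sup>2))
     + (\<Sum>w\<in>never (returns x L) r. wt x w * (f (k + mset w) - ?m)\<^sup>2)"
    unfolding cvar_def by (rule split_wt)
  have le: "(\<Sum>i\<le>r. \<Sum>b\<in>first_hit (returns x L) i. wt x b *
        (\<Sum>v\<in>paths (r - i). wt x v * (f (k + mset (b @ v)) - ?m)\<^sup>2))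
     \<le> (\<Sum>i\<le>r. \<Sum>b\<in>first_hit (returns x L) i. wt x b * cvar x f (k + mset b) (r - i)
         + wt x b * (\<Sum>w\<in>paths r. wt x w * (f (k + mset b + mset (take (r - i) w)) - f (k + mset w))\<^sup>2))"
  proof (intro sum_mono)
    fix i b assume "b \<in> first_hit (returns x L) i"
    note b = wt_first_hit_nonneg[OF x this]
    have "(\<Sum>v\<in>paths (r - i). wt x v * (f (k + mset (b @ v)) - ?m)\<^sup>2)
        = cvar x f (k + mset b) (r - i) + (cmean x f (k + mset b) (r - i) - ?m)\<^sup>2"
      using second_moment_cmean[OF x, where f = f and k = "k + mset b" and r = "r - i" and c = ?m] by (simp add: add.assoc)
    also have "(cmean x f (k + mset b) (r - i) - ?m)\<^sup>2
       \<le> (\<Sum>w\<in>paths r. wt x w * (f (k + mset b + mset (take (r - i) w)) - f (k + mset w))\<^sup>2)"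
      unfolding cmean_def[where k = k and r = r] by (rule cmean_diff_le[OF x]) simp
    finally show "wt x b * (\<Sum>v\<in>paths (r - i). wt x v * (f (k + mset (b @ v)) - ?m)\<^sup>2)
       \<le> wt x b * cvar x f (k + mset b) (r - i)
         + wt x b * (\<Sum>w\<in>paths r. wt x w * (f (k + mset b + mset (take (r - i) w)) - f (k + mset w))\<^sup>2)"
      using b unfolding distrib_left[symmetric] by (intro mult_left_mono) auto
  qed
  have "(\<Sum>i\<le>r. \<Sum>b\<in>first_hit (returns x L) i. wt x b * cvar x f (k + mset b) (r - i)
         + wt x b * (\<Sum>w\<in>paths r. wt x w * (f (k + mset b + mset (take (r - i) w)) - f (k + mset w))\<^sup>2))
     = (\<Sum>i\<le>r. \<Sum>b\<in>first_hit (returns x L) i. wt x b * cvar x f (k + mset b) (r - i))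
     + block_cost x L f k r"
    unfolding block_cost_def by (simp only: sum.distrib)
  thus ?thesis using split le by linarith
qed

lemma sum_triangle_swap:
  fixes F :: "nat \<Rightarrow> nat \<Rightarrow> real"
  shows "(\<Sum>i\<le>r. \<Sum>j\<le>r - i. F i j) = (\<Sum>j\<le>r. \<Sum>i\<le>r - j. F i j)"
  unfolding sum.Sigma[OF finite_atMost ballI[OF finite_atMost]]
  by (rule sum.reindex_bij_witness[of _ "\<lambda>(j, i). (i, j)" "\<lambda>(i, j). (j, i)"]) auto

text \<open>Counts do not see the order of the blocks, so the cost of deleting the second block is at most
  the cost of deleting the first one.\<close>

lemma block_cost_average:
  assumes x: "x \<in> S"
  shows "(\<Sum>i\<le>r. \<Sum>b\<in>first_hit (returns x L) i. wt x b * block_cost x L f (k + mset b) (r - i))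
     \<le> block_cost x L f k r"
proof -
  let ?F = "\<lambda>i. first_hit (returns x L) i"
  define T where "T i b j c = (\<Sum>v\<in>paths (r - i). wt x v *
     (f (k + mset b + mset c + mset (take (r - i - j) v)) - f (k + mset b + mset v))\<^sup>2)" for i b j c
  have "(\<Sum>i\<le>r. \<Sum>b\<in>?F i. wt x b * block_cost x L f (k + mset b) (r - i))
     = (\<Sum>i\<le>r. \<Sum>j\<le>r - i. \<Sum>b\<in>?F i. \<Sum>c\<in>?F j. wt x b * (wt x c * T i b j c))"
    unfolding block_cost_def T_def
    by (intro sum.cong refl) (subst sum.swap, simp add: sum_distrib_left)
  also have "\<dots> = (\<Sum>j\<le>r. \<Sum>i\<le>r - j. \<Sum>b\<in>?F i. \<Sum>c\<in>?F j. wt x b * (wt x c * T i b j c))"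
    by (rule sum_triangle_swap)
  also have "\<dots> = (\<Sum>j\<le>r. \<Sum>c\<in>?F j. wt x c * (\<Sum>i\<le>r - j. \<Sum>b\<in>?F i. wt x b * T i b j c))"
  proof (intro sum.cong refl)
    fix j
    have "(\<Sum>i\<le>r - j. \<Sum>b\<in>?F i. \<Sum>c\<in>?F j. wt x b * (wt x c * T i b j c))
       = (\<Sum>i\<le>r - j. \<Sum>c\<in>?F j. \<Sum>b\<in>?F i. wt x b * (wt x c * T i b j c))"
      by (intro sum.cong refl sum.swap)
    also have "\<dots> = (\<Sum>c\<in>?F j. \<Sum>i\<le>r - j. \<Sum>b\<in>?F i. wt x b * (wt x c * T i b j c))"
      by (rule sum.swap)
    also have "\<dots> = (\<Sum>c\<in>?F j. wt x c * (\<Sum>i\<le>r - j. \<Sum>b\<in>?F i. wt x b * T i b j c))"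
      by (simp add: sum_distrib_left mult.left_commute)
    finally show "(\<Sum>i\<le>r - j. \<Sum>b\<in>?F i. \<Sum>c\<in>?F j. wt x b * (wt x c * T i b j c))
      = (\<Sum>c\<in>?F j. wt x c * (\<Sum>i\<le>r - j. \<Sum>b\<in>?F i. wt x b * T i b j c))" .
  qed
  also have "\<dots> \<le> block_cost x L f k r"
    unfolding block_cost_def
  proof (intro sum_mono mult_left_mono)
    fix j c assume c: "c \<in> ?F j"
    show "0 \<le> wt x c" by (rule wt_first_hit_nonneg[OF x c])
    define G where "G w = (f (k + mset c + mset (take (r - j) w)) - f (k + mset w))\<^sup>2" for w
    have "(\<Sum>i\<le>r - j. \<Sum>b\<in>?F i. wt x b * T i b j c)
       = (\<Sum>i\<le>r - j. \<Sum>b\<in>?F i. wt x b * (\<Sum>v\<in>paths (r - i). wt x v * G (b @ v)))"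
    proof (intro sum.cong refl arg_cong2[where f = "(*)"])
      fix i b assume i: "i \<in> {..r - j}" and b: "b \<in> ?F i"
      have l: "length b = i" using first_hit_returnsD[OF b] by simp
      have "take (r - j) (b @ v) = b @ take (r - i - j) v" for v
        using i l by (simp add: add.commute)
      thus "T i b j c = (\<Sum>v\<in>paths (r - i). wt x v * G (b @ v))"
        unfolding T_def G_def by (simp add: ac_simps)
    qed
    also have "\<dots> \<le> (\<Sum>i\<le>r. \<Sum>b\<in>?F i. wt x b * (\<Sum>v\<in>paths (r - i). wt x v * G (b @ v)))"
      by (rule sum_mono2)
        (auto intro!: sum_nonneg mult_nonneg_nonneg simp: wt_first_hit_nonneg x wt_nonneg' G_def)
    also have "\<dots> \<le> (\<Sum>w\<in>paths r. wt x w * G w)"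
      unfolding split_wt[where x = x and r = r and G = G and L = L] by (auto intro!: sum_nonneg mult_nonneg_nonneg simp: wt_never_nonneg x G_def)
    finally show "(\<Sum>i\<le>r - j. \<Sum>b\<in>?F i. wt x b * T i b j c)
      \<le> (\<Sum>w\<in>paths r. wt x w * (f (k + mset c + mset (take (r - j) w)) - f (k + mset w))\<^sup>2)" unfolding G_def .
  qed
  finally show ?thesis .
qed

lemma avoid_suffix:
  assumes z: "z \<in> S" and p: "\<And>y. y \<in> S \<Longrightarrow> avoid x s y \<le> p"
  shows "(\<Sum>w\<in>paths (r + s). wt z w * of_bool (x \<notin> set (drop r w))) \<le> p"
proof -
  have "(\<Sum>w\<in>paths (r + s). wt z w * of_bool (x \<notin> set (drop r w)))
     = (\<Sum>u\<in>paths r. wt z u * avoid x s (last (z # u)))"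
    unfolding sum_paths_add avoid_def sum_distrib_left
    by (intro sum.cong refl) (simp only: wt_append, simp add: paths_length)
  also have "\<dots> \<le> (\<Sum>u\<in>paths r. wt z u * p)"
    using z by (intro sum_mono mult_left_mono p last_in_S) (auto simp: wt_nonneg')
  also have "\<dots> = p" using sum_wt[OF z] by (simp flip: sum_distrib_right)
  finally show ?thesis .
qed

text \<open>The weight of f squared in the error term of the variance bound below. It consists of the indicator
  that x is avoided in the last 4 G entries, and of a summand that grows with r fast enough to
  absorb, at each block, the probability that the block is not closed in time.\<close>

definition tail_weight :: "'a \<Rightarrow> nat \<Rightarrow> nat \<Rightarrow> 'a list \<Rightarrow> real" where
  "tail_weight x G r w = (if r < 8 * G then 0
     else of_bool (x \<notin> set (drop (r - 4 * G) w)) + (1 - (1/2) ^ (r div (4 * G))) / 64)"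

lemma tail_weight_nonneg: "0 \<le> tail_weight x G r w"
  unfolding tail_weight_def by (auto simp: power_le_one)

lemma tail_weight_append:
  assumes G: "G \<ge> 1" and r: "8 * G \<le> r" and i: "4 * G \<le> i" "i \<le> r" "length b = i"
  shows "tail_weight x G (r - i) v \<le> tail_weight x G r (b @ v) - (1/2) ^ (r div (4 * G)) / 64"
proof (cases "r - i < 8 * G")
  case True
  have "2 \<le> r div (4 * G)" using G r by (simp add: less_eq_div_iff_mult_less_eq)
  hence "(1/2::real) ^ (r div (4 * G)) \<le> (1/2) ^ 2" by (intro power_decreasing) auto
  hence "(1/2::real) ^ (r div (4 * G)) \<le> 1/4" by (simp add: power2_eq_square)
  moreover have "tail_weight x G (r - i) v = 0" using True unfolding tail_weight_def by simp
  moreover have "(1 - (1/2) ^ (r div (4 * G))) / 64 \<le> tail_weight x G r (b @ v)"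
    using r unfolding tail_weight_def by simp
  ultimately show ?thesis by simp
next
  case False
  have "Suc ((r - i) div (4 * G)) * (4 * G) \<le> 4 * G + (r - i)"
    using div_times_less_eq_dividend[of "r - i" "4 * G"] by simp
  also have "\<dots> \<le> r" using i by simp
  finally have "Suc ((r - i) div (4 * G)) \<le> r div (4 * G)"
    using G by (subst less_eq_div_iff_mult_less_eq) auto
  hence "(1/2::real) ^ (r div (4 * G)) \<le> (1/2) ^ Suc ((r - i) div (4 * G))" by (intro power_decreasing) auto
  moreover have "drop (r - 4 * G) (b @ v) = drop (r - i - 4 * G) v"
    using False i by (simp add: add.commute)
  ultimately show ?thesis using False r unfolding tail_weight_def by (auto simp: field_simps)
qed

lemma never_mass:
  assumes x: "x \<in> S" and av: "\<And>z. z \<in> S \<Longrightarrow> avoid x G z \<le> 1/4" and G: "G \<ge> 1" and r: "8 * G \<le> r"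
  shows "(\<Sum>w\<in>never (returns x (4 * G)) r. wt x w) \<le> (1/2) ^ (r div (4 * G)) / 64"
proof -
  define j where "j = r div (4 * G)"
  have j2: "2 \<le> j" unfolding j_def using G r by (simp add: less_eq_div_iff_mult_less_eq)
  have jr: "j * (4 * G) \<le> r" unfolding j_def by simp
  have "(\<Sum>w\<in>never (returns x (4 * G)) r. wt x w)
     = (\<Sum>w\<in>never (returns x (4 * G)) r. wt x w * of_bool (x \<notin> set (drop (4 * G) w)))"
    using never_returns_avoids by (intro sum.cong refl) auto
  also have "\<dots> \<le> (\<Sum>w\<in>paths r. wt x w * of_bool (x \<notin> set (drop (4 * G) w)))"
    using never_subset by (intro sum_mono2) (auto simp: wt_nonneg' x)
  also have "\<dots> = (\<Sum>w\<in>paths (4 * G + (r - 4 * G)). wt x w * of_bool (x \<notin> set (drop (4 * G) w)))"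
    using r by simp
  also have "\<dots> \<le> (1/4) ^ (4 * (j - 1))"
  proof (rule avoid_suffix[OF x])
    fix y assume y: "y \<in> S"
    have "4 * (j - 1) * G \<le> r - 4 * G" using jr by (simp add: diff_mult_distrib2 diff_mult_distrib mult_ac)
    thus "avoid x (r - 4 * G) y \<le> (1/4) ^ (4 * (j - 1))" using av by (intro avoid_power[OF _ y]) auto
  qed
  also have "(1/4::real) ^ (4 * (j - 1)) = (1/2) ^ (2 * (4 * (j - 1)))"
    by (subst power_mult) (simp add: power2_eq_square)
  also have "\<dots> \<le> (1/2) ^ (j + 6)" using j2 by (intro power_decreasing) auto
  also have "\<dots> = (1/2) ^ j / 64" by (simp add: power_add power_divide)
  finally show ?thesis unfolding j_def .
qed

text \<open>The variance is at most the number of blocks, r / (4 G), times the cost of deleting one block, up to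
  two errors: the last 8 G entries are handled by an arbitrary predictor h that does not see
  them, and a block left open at the end forces a long time without visits to x. Blocks
  have length at least 4 G, and deleting the next block costs no more than deleting this
  one, so each block revealed uses up one unit of the factor r / (4 G).\<close>

lemma cvar_bound:
  assumes x: "x \<in> S" and av: "\<And>z. z \<in> S \<Longrightarrow> avoid x G z \<le> 1/4" and G: "G \<ge> 1"
  shows "cvar x f k r \<le> real r / (4 * real G) * block_cost x (4 * G) f k r
     + (\<Sum>w\<in>paths r. wt x w * (f (k + mset w) - h (take (r - 8 * G) w))\<^sup>2)
     + 2 * (\<Sum>w\<in>paths r. wt x w * ((f (k + mset w))\<^sup>2 * tail_weight x G r w))"
proof (induction r arbitrary: k h rule: less_induct)
  case (less r)
  let ?L = "4 * G"
  let ?F = "\<lambda>i. first_hit (returns x ?L) i"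
  let ?N = "never (returns x ?L) r"
  let ?bc = "block_cost x ?L f"
  let ?tw = "tail_weight x G"
  have bc0: "0 \<le> ?bc k r" for k r by (rule block_cost_nonneg[OF x])
  show ?case
  proof (cases "r < 8 * G")
    case True
    have "cvar x f k r \<le> (\<Sum>w\<in>paths r. wt x w * (f (k + mset w) - h [])\<^sup>2)" by (rule cvar_le[OF x])
    moreover have "0 \<le> (\<Sum>w\<in>paths r. wt x w * ((f (k + mset w))\<^sup>2 * ?tw r w))"
      by (intro sum_nonneg mult_nonneg_nonneg) (auto simp: wt_nonneg' x tail_weight_nonneg)
    moreover have "0 \<le> real r / (4 * real G) * ?bc k r" using bc0 by simp
    ultimately show ?thesis using True by simp
  next
    case False
    hence r: "8 * G \<le> r" by simp
    define q where "q = (1/2::real) ^ (r div ?L) / 64"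
    have q0: "0 \<le> q" unfolding q_def by simp
    define M where "M = (\<Sum>w\<in>paths r. wt x w * (f (k + mset w))\<^sup>2)"
    define H where "H w = (f (k + mset w) - h (take (r - 8 * G) w))\<^sup>2" for w
    define F where "F w = (f (k + mset w))\<^sup>2 * (?tw r w - q)" for w
    have blk: "wt x b * cvar x f (k + mset b) (r - i)
       \<le> (real r / (4 * real G) - 1) * (wt x b * ?bc (k + mset b) (r - i))
         + wt x b * (\<Sum>v\<in>paths (r - i). wt x v * H (b @ v))
         + 2 * (wt x b * (\<Sum>v\<in>paths (r - i). wt x v * F (b @ v)))"
      if i: "i \<in> {..r}" and b: "b \<in> ?F i" for i b
    proof -
      note bD = first_hit_returnsD[OF b]
      have wb: "0 \<le> wt x b" by (rule wt_first_hit_nonneg[OF x b])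
      have ri: "r - i < r" using bD(3) G i by auto
      have "cvar x f (k + mset b) (r - i) \<le> real (r - i) / (4 * real G) * ?bc (k + mset b) (r - i)
         + (\<Sum>v\<in>paths (r - i). wt x v * (f (k + mset b + mset v) - h (take (r - 8 * G) (b @ take (r - i - 8 * G) v)))\<^sup>2)
         + 2 * (\<Sum>v\<in>paths (r - i). wt x v * ((f (k + mset b + mset v))\<^sup>2 * ?tw (r - i) v))"
        using less.IH[OF ri, of "k + mset b" "\<lambda>u. h (take (r - 8 * G) (b @ u))"] .
      also have "real (r - i) / (4 * real G) * ?bc (k + mset b) (r - i)
         \<le> (real r / (4 * real G) - 1) * ?bc (k + mset b) (r - i)"
        using bD(3) i G by (intro mult_right_mono bc0) (auto simp: field_simps of_nat_diff)
      also have "(\<Sum>v\<in>paths (r - i). wt x v * (f (k + mset b + mset v) - h (take (r - 8 * G) (b @ take (r - i - 8 * G) v)))\<^sup>2)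
         = (\<Sum>v\<in>paths (r - i). wt x v * H (b @ v))"
        unfolding H_def using bD(5) by (simp add: add.assoc min_def diff_commute)
      also have "(\<Sum>v\<in>paths (r - i). wt x v * ((f (k + mset b + mset v))\<^sup>2 * ?tw (r - i) v))
         \<le> (\<Sum>v\<in>paths (r - i). wt x v * F (b @ v))"
      proof (intro sum_mono mult_left_mono)
        fix v assume v: "v \<in> paths (r - i)"
        show "0 \<le> wt x v" using v x by (rule wt_nonneg'[rotated])
        have "?tw (r - i) v \<le> ?tw r (b @ v) - q"
          unfolding q_def by (rule tail_weight_append[OF G r]) (use bD i in auto)
        thus "(f (k + mset b + mset v))\<^sup>2 * ?tw (r - i) v \<le> F (b @ v)"
          unfolding F_def by (simp add: add.assoc mult_left_mono)
      qed
      finally have "cvar x f (k + mset b) (r - i) \<le> (real r / (4 * real G) - 1) * ?bc (k + mset b) (r - i)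
         + (\<Sum>v\<in>paths (r - i). wt x v * H (b @ v)) + 2 * (\<Sum>v\<in>paths (r - i). wt x v * F (b @ v))" by simp
      from mult_left_mono[OF this wb] show ?thesis by (simp add: algebra_simps)
    qed
    have blocks: "(\<Sum>i\<le>r. \<Sum>b\<in>?F i. wt x b * cvar x f (k + mset b) (r - i))
       \<le> (real r / (4 * real G) - 1) * ?bc k r
         + (\<Sum>i\<le>r. \<Sum>b\<in>?F i. wt x b * (\<Sum>v\<in>paths (r - i). wt x v * H (b @ v)))
         + 2 * (\<Sum>i\<le>r. \<Sum>b\<in>?F i. wt x b * (\<Sum>v\<in>paths (r - i). wt x v * F (b @ v)))"
    proof -
      have "(\<Sum>i\<le>r. \<Sum>b\<in>?F i. wt x b * cvar x f (k + mset b) (r - i))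
       \<le> (real r / (4 * real G) - 1) * (\<Sum>i\<le>r. \<Sum>b\<in>?F i. wt x b * ?bc (k + mset b) (r - i))
         + (\<Sum>i\<le>r. \<Sum>b\<in>?F i. wt x b * (\<Sum>v\<in>paths (r - i). wt x v * H (b @ v)))
         + 2 * (\<Sum>i\<le>r. \<Sum>b\<in>?F i. wt x b * (\<Sum>v\<in>paths (r - i). wt x v * F (b @ v)))"
        unfolding sum_distrib_left[of _ _ "{..r}"] sum_distrib_left[of _ _ "?F _"] sum.distrib[symmetric]
        by (intro sum_mono, drule (1) blk) (simp only: sum_distrib_left mult_ac)
      also have "(real r / (4 * real G) - 1) * (\<Sum>i\<le>r. \<Sum>b\<in>?F i. wt x b * ?bc (k + mset b) (r - i))
         \<le> (real r / (4 * real G) - 1) * ?bc k r"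
        using r G by (intro mult_left_mono block_cost_average[OF x]) (auto simp: field_simps)
      finally show ?thesis by simp
    qed
    have nev: "(\<Sum>w\<in>?N. wt x w * (f (k + mset w) - cmean x f k r)\<^sup>2)
        \<le> 2 * (\<Sum>w\<in>?N. wt x w * F w) + 2 * (q * M)"
    proof -
      have "(cmean x f k r)\<^sup>2 \<le> M"
        unfolding cmean_def M_def using x by (intro jensen_square) (auto simp: wt_nonneg' sum_wt)
      have "(\<Sum>w\<in>?N. wt x w * (f (k + mset w) - cmean x f k r)\<^sup>2)
         \<le> (\<Sum>w\<in>?N. 2 * (wt x w * F w) + 2 * (wt x w * M))"
      proof (rule sum_mono)
        fix w assume w: "w \<in> ?N"
        have w0: "0 \<le> wt x w" by (rule wt_never_nonneg[OF x w])
        have "set (drop (r - 4 * G) w) \<subseteq> set (drop (4 * G) w)"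
          using r by (intro set_drop_subset_set_drop) auto
        hence "x \<notin> set (drop (r - 4 * G) w)" using never_returns_avoids[OF w] by auto
        moreover have "(1/2::real) ^ (r div ?L) \<le> 1" by (simp add: power_le_one)
        moreover have "(1/2::real) ^ (r div ?L) \<le> (1/2) ^ 2"
          using G r by (intro power_decreasing) (auto simp: less_eq_div_iff_mult_less_eq)
        ultimately have "1 \<le> ?tw r w - q"
          using r unfolding tail_weight_def q_def by (simp add: power2_eq_square)
        hence "(f (k + mset w))\<^sup>2 * 1 \<le> F w" unfolding F_def by (intro mult_left_mono) auto
        moreover have "(f (k + mset w) - cmean x f k r)\<^sup>2 \<le> 2 * (f (k + mset w))\<^sup>2 + 2 * (cmean x f k r)\<^sup>2"
          using zero_le_power2[of "f (k + mset w) + cmean x f k r"] by (simp add: power2_eq_square algebra_simps)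
        ultimately have "(f (k + mset w) - cmean x f k r)\<^sup>2 \<le> 2 * F w + 2 * M"
          using \<open>(cmean x f k r)\<^sup>2 \<le> M\<close> by linarith
        from mult_left_mono[OF this w0]
        show "wt x w * (f (k + mset w) - cmean x f k r)\<^sup>2 \<le> 2 * (wt x w * F w) + 2 * (wt x w * M)"
          by (simp add: algebra_simps)
      qed
      also have "\<dots> = 2 * (\<Sum>w\<in>?N. wt x w * F w) + 2 * ((\<Sum>w\<in>?N. wt x w) * M)"
        by (simp add: sum.distrib sum_distrib_left sum_distrib_right)
      also have "(\<Sum>w\<in>?N. wt x w) * M \<le> q * M"
        unfolding q_def using never_mass[OF x av G r]
        by (intro mult_right_mono) (auto simp: M_def wt_nonneg' x intro!: sum_nonneg)
      finally show ?thesis by simp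
    qed
    have HT: "(\<Sum>w\<in>paths r. wt x w * H w) \<ge> (\<Sum>i\<le>r. \<Sum>b\<in>?F i. wt x b * (\<Sum>v\<in>paths (r - i). wt x v * H (b @ v)))"
      unfolding split_wt[where x = x and r = r and G = H and L = ?L] by (auto intro!: sum_nonneg mult_nonneg_nonneg simp: wt_never_nonneg x H_def)
    have FT: "(\<Sum>w\<in>paths r. wt x w * F w) = (\<Sum>i\<le>r. \<Sum>b\<in>?F i. wt x b * (\<Sum>v\<in>paths (r - i). wt x v * F (b @ v)))
       + (\<Sum>w\<in>?N. wt x w * F w)"
      by (rule split_wt)
    have FM: "(\<Sum>w\<in>paths r. wt x w * F w) + q * M = (\<Sum>w\<in>paths r. wt x w * ((f (k + mset w))\<^sup>2 * ?tw r w))"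
      unfolding F_def M_def sum_distrib_left sum.distrib[symmetric]
      by (intro sum.cong refl) (simp add: algebra_simps)
    have "cvar x f k r \<le> ?bc k r + (\<Sum>w\<in>?N. wt x w * (f (k + mset w) - cmean x f k r)\<^sup>2)
       + (\<Sum>i\<le>r. \<Sum>b\<in>?F i. wt x b * cvar x f (k + mset b) (r - i))"
      by (rule cvar_step[OF x])
    also have "\<dots> \<le> real r / (4 * real G) * ?bc k r + (\<Sum>w\<in>paths r. wt x w * H w)
       + 2 * ((\<Sum>w\<in>paths r. wt x w * F w) + q * M)"
      using blocks nev HT unfolding FT by (simp add: algebra_simps)
    finally show ?thesis unfolding FM H_def .
  qed
qed

end

section \<open>The cost of deleting one block\<close>

lemma sum_div_le:
  fixes a :: "nat \<Rightarrow> real"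
  assumes K: "K \<ge> 1" and a: "\<And>j. 0 \<le> a j" and M: "(\<Sum>j<n. a j) \<le> M"
  shows "(\<Sum>t<n. a (t div K)) \<le> real K * M"
proof -
  have "(\<Sum>t<n. a (t div K)) \<le> (\<Sum>t<n * K. a (t div K))"
    using K by (intro sum_mono2) (auto simp: a intro: order_less_le_trans)
  also have "\<dots> = (\<Sum>j<n. \<Sum>t\<in>{j * K..<j * K + K}. a (t div K))" by (rule sum.nat_group[symmetric])
  also have "\<dots> = (\<Sum>j<n. real K * a j)"
  proof (intro sum.cong refl)
    fix j
    have "t div K = j" if "t \<in> {j * K..<j * K + K}" for t
      using that by (intro div_nat_eqI) (auto simp: mult.commute)
    thus "(\<Sum>t\<in>{j * K..<j * K + K}. a (t div K)) = real K * a j" by simp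
  qed
  also have "\<dots> \<le> real K * M" using M by (simp flip: sum_distrib_left add: mult_left_mono)
  finally show ?thesis .
qed

lemma sum_half_powers: "(\<Sum>j<n. (1/2::real) ^ j) \<le> 2"
proof -
  have "(\<Sum>j<n. (1/2::real) ^ j) = 2 - 2 * (1/2) ^ n" by (induction n) auto
  thus ?thesis by simp
qed

lemma sum_lessThan_add: "(\<Sum>t<a + (b::nat). h t) = (\<Sum>t<a. h t) + (\<Sum>t<b. h (a + t) :: real)"
  by (induction b) auto

lemma square_le_two_step: "((a::real) - c)\<^sup>2 \<le> 6/5 * (a - b)\<^sup>2 + 6 * (c - b)\<^sup>2"
proof -
  have "6/5 * (a - b)\<^sup>2 + 6 * (c - b)\<^sup>2 - (a - c)\<^sup>2 = ((a - b) + 5 * (c - b))\<^sup>2 / 5"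
    by (simp add: power2_eq_square field_simps)
  also have "\<dots> \<ge> 0" by simp
  finally show ?thesis by simp
qed

context reversible_chain
begin

lemma first_hit_before:
  assumes "J \<in> first_hit (returns x L) i" "Suc p < i" "L \<le> Suc p"
  shows "J ! p \<noteq> x"
  using first_hit_returnsD(5,7)[OF assms(1)] take_Suc_returns[of p J x L] assms by auto

text \<open>The blocks of length at most n, and the initial pieces of paths up to the first visit to x.\<close>

definition return_blocks :: "'a \<Rightarrow> nat \<Rightarrow> nat \<Rightarrow> 'a list set" where
  "return_blocks x L n = (\<Union>i\<le>n. first_hit (returns x L) i)"

definition first_visits :: "'a \<Rightarrow> nat \<Rightarrow> 'a list set" where
  "first_visits x n = return_blocks x 0 n"

lemma sum_return_blocks:
  "(\<Sum>b\<in>return_blocks x L n. F b) = (\<Sum>i\<le>n. \<Sum>b\<in>first_hit (returns x L) i. F b)"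
  unfolding return_blocks_def
  by (rule sum.UNION_disjoint) (auto dest!: first_hit_returnsD(5))

lemma return_blocksD:
  assumes "b \<in> return_blocks x L n"
  shows "b \<in> first_hit (returns x L) (length b)" "length b \<le> n" "b \<noteq> []" "L \<le> length b" "last b = x" "set b \<subseteq> S"
proof -
  obtain i where i: "i \<le> n" "b \<in> first_hit (returns x L) i" using assms unfolding return_blocks_def by auto
  thus "b \<in> first_hit (returns x L) (length b)" "length b \<le> n" "b \<noteq> []" "L \<le> length b" "last b = x" "set b \<subseteq> S"
    using first_hit_returnsD[OF i(2)] by auto
qed

lemma finite_return_blocks [simp]: "finite (return_blocks x L n)"
  unfolding return_blocks_def by auto

lemma return_blocks_prefix_free:
  assumes "b \<in> return_blocks x L n" "b' \<in> return_blocks x L n'" "b @ v = b' @ v'"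
  shows "b = b'"
  using first_hit_prefix_free[OF return_blocksD(1)[OF assms(1)] return_blocksD(1)[OF assms(2)] assms(3)] .

lemma split_pw_first_visit:
  "(\<Sum>w\<in>paths n. pw w * G w)
   = (\<Sum>J\<in>first_visits x n. pw J * (\<Sum>v\<in>paths (n - length J). wt x v * G (J @ v)))
     + (\<Sum>w\<in>never (returns x 0) n. pw w * G w)"
  unfolding split_pw[where x = x and L = 0] first_visits_def sum_return_blocks
  by (simp add: first_hit_returnsD(5) cong: sum.cong)

lemma sum_wt_return_blocks_le: "x \<in> S \<Longrightarrow> (\<Sum>b\<in>return_blocks x L r. wt x b) \<le> 1"
proof -
  assume x: "x \<in> S"
  have "0 \<le> (\<Sum>w\<in>never (returns x L) r. wt x w)" by (simp add: sum_nonneg wt_never_nonneg x)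
  thus ?thesis
    using split_wt[where G = "\<lambda>_. 1" and x = x and r = r and L = L] x
    by (simp add: sum_return_blocks sum_wt)
qed

lemma first_visit_avoids:
  assumes "J \<in> first_visits x n" "t < length J"
  shows "x \<notin> set (take t J)"
proof
  assume "x \<in> set (take t J)"
  then obtain p where "p < t" "J ! p = x" using assms(2) by (auto simp: in_set_conv_nth)
  thus False
    using first_hit_before[OF return_blocksD(1)[OF assms(1)[unfolded first_visits_def]], of p] assms(2) by auto
qed

lemma first_visits_pw_nonneg: "J \<in> first_visits x n \<Longrightarrow> 0 \<le> pw J"
  unfolding first_visits_def using first_hit_paths[OF return_blocksD(1)] by (blast intro: pw_nonneg)

text \<open>Moving the window from time 0 to the time of the first visit.\<close>

lemma first_visit_cost:
  assumes av: "\<And>z. z \<in> S \<Longrightarrow> avoid x G z \<le> 1/4" and G: "G \<ge> 1"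
  shows "(\<Sum>J\<in>first_visits x n. pw J * (\<Sum>Y\<in>paths n. wt x Y * (f (mset (take n (J @ Y))) - f (mset Y))\<^sup>2))
     \<le> 4 * (real G)\<^sup>2 * shift_energy f n"
proof -
  have "(\<Sum>J\<in>first_visits x n. pw J * (\<Sum>Y\<in>paths n. wt x Y * (f (mset (take n (J @ Y))) - f (mset Y))\<^sup>2))
     \<le> (\<Sum>t<n. (1/2) ^ (t div G))\<^sup>2 * shift_energy f n"
  proof (rule random_shift[where B = "\<lambda>_ u. x \<notin> set u" and p = "\<lambda>J. J"])
    fix t z assume z: "z \<in> S"
    have "(\<Sum>u\<in>paths t. wt z u * of_bool (x \<notin> set (rev u))) = avoid x t z" unfolding avoid_def by simp
    also have "\<dots> \<le> (1/4) ^ (t div G)" by (rule avoid_power[OF av z]) auto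
    also have "\<dots> = ((1/2) ^ (t div G))\<^sup>2"
      by (simp add: power_mult[symmetric] mult.commute[of _ 2]) (simp add: power_mult power2_eq_square)
    finally show "(\<Sum>u\<in>paths t. wt z u * of_bool (x \<notin> set (rev u))) \<le> ((1/2) ^ (t div G))\<^sup>2" .
  qed (auto simp: first_visits_def dest: return_blocksD return_blocks_prefix_free
      intro: first_visit_avoids[unfolded first_visits_def, THEN notE])
  also have "\<dots> \<le> (real G * 2)\<^sup>2 * shift_energy f n"
    using sum_div_le[OF G, of "\<lambda>j. (1/2) ^ j" n 2] sum_half_powers[of n]
    by (intro mult_right_mono power_mono shift_energy_nonneg) (auto intro: sum_nonneg)
  finally show ?thesis by (simp add: power_mult_distrib mult.commute)
qed

text \<open>If the first block after the first visit is still open at time t, then x was avoided either at the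
  beginning or just before t.\<close>

lemma open_block_avoids:
  assumes J: "J \<in> first_visits x n" and b: "b \<in> return_blocks x L n'"
    and t: "t < length (J @ b)" and a: "L + 2 * a \<le> t"
  shows "x \<notin> set (take a (take t (J @ b))) \<or> x \<notin> set (drop (t - a) (take t (J @ b)))"
proof (rule ccontr)
  assume neg: "\<not> ?thesis"
  define w where "w = J @ b"
  have "take a (take t w) = take a w" using a by (simp add: take_take min_def)
  hence 1: "x \<in> set (take a (J @ b))" and 2: "x \<in> set (drop (t - a) (take t w))"
    using neg unfolding w_def by metis+
  have "length J \<le> a"
  proof (rule ccontr)
    assume "\<not> length J \<le> a"
    thus False using 1 first_visit_avoids[OF J, of a] by simp
  qed
  from 2 obtain q where "q < a" "w ! (t - a + q) = x"
    using t[folded w_def] a by (auto simp: in_set_conv_nth)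
  hence q: "q < a" "(J @ b) ! (t - a + q) = x" unfolding w_def by auto
  define p where "p = t - a + q - length J"
  have p: "t - a + q = length J + p" unfolding p_def using \<open>length J \<le> a\<close> a by simp
  have "b ! p = x" using q(2) unfolding p by (simp add: nth_append)
  moreover have "Suc p < length b" using t q(1) a p by simp
  moreover have "L \<le> Suc p" using p a \<open>length J \<le> a\<close> by simp
  ultimately show False using first_hit_before[OF return_blocksD(1)[OF b]] by blast
qed

text \<open>Moving the window from time 0 to the end of the first block after the first visit.\<close>

lemma first_block_cost:
  assumes av: "\<And>z. z \<in> S \<Longrightarrow> avoid x G z \<le> 1/4" and G: "G \<ge> 1"
  shows "(\<Sum>J\<in>first_visits x n. pw J * (\<Sum>b\<in>return_blocks x (4 * G) (n - length J). wt x b *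
       (\<Sum>Y\<in>paths n. wt x Y * (f (mset (take n (J @ b @ Y))) - f (mset Y))\<^sup>2)))
     \<le> 81 * (real G)\<^sup>2 * shift_energy f n"
proof -
  \<comment> \<open>At time t the probability of an open block is at most 2 (1/4)^j with j = (t - 4 G) div (2 G); the
    square of e j dominates it because 2 is at most the square of 3/2.\<close>
  define e where "e j = (if j = 0 then 1 else 3/2 * (1/2) ^ j :: real)" for j :: nat
  define j where "j t = (t - 4 * G) div (2 * G)" for t
  define B where "B t u \<longleftrightarrow> x \<notin> set (take (j t * G) u) \<or> x \<notin> set (drop (t - j t * G) u)" for t u
  define C where "C = (SIGMA J:first_visits x n. return_blocks x (4 * G) (n - length J))"
  define p where "p = (\<lambda>(J :: 'a list, b). J @ b)"
  have jt: "4 * G + 2 * (j t * G) \<le> t" if "j t \<noteq> 0" for t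
  proof -
    have "2 * G \<le> t - 4 * G" using that unfolding j_def by (metis div_less not_less)
    moreover have "(t - 4 * G) div (2 * G) * (2 * G) \<le> t - 4 * G" by (rule div_times_less_eq_dividend)
    ultimately show ?thesis unfolding j_def by (simp add: algebra_simps)
  qed
  have "(\<Sum>J\<in>first_visits x n. pw J * (\<Sum>b\<in>return_blocks x (4 * G) (n - length J). wt x b *
       (\<Sum>Y\<in>paths n. wt x Y * (f (mset (take n (J @ b @ Y))) - f (mset Y))\<^sup>2)))
     = (\<Sum>J\<in>first_visits x n. \<Sum>b\<in>return_blocks x (4 * G) (n - length J). pw (p (J, b)) *
       (\<Sum>Y\<in>paths n. wt x Y * (f (mset (take n (p (J, b) @ Y))) - f (mset Y))\<^sup>2))"
    unfolding p_def sum_distrib_left first_visits_def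
    by (intro sum.cong refl) (simp add: return_blocksD pw_append mult_ac)
  also have "\<dots> = (\<Sum>c\<in>C. pw (p c) * (\<Sum>Y\<in>paths n. wt x Y * (f (mset (take n (p c @ Y))) - f (mset Y))\<^sup>2))"
    unfolding C_def by (subst sum.Sigma) (auto simp: first_visits_def split: prod.splits)
  also have "\<dots> \<le> (\<Sum>t<n. e (j t))\<^sup>2 * shift_energy f n"
  proof (rule random_shift[where B = B])
    show "finite C" unfolding C_def first_visits_def by auto
  next
    fix c assume "c \<in> C"
    then obtain J b where c: "c = (J, b)" and J: "J \<in> first_visits x n" and b: "b \<in> return_blocks x (4 * G) (n - length J)"
      unfolding C_def by auto
    note JD = return_blocksD[OF J[unfolded first_visits_def]] and bD = return_blocksD[OF b]
    show "set (p c) \<subseteq> S" "p c \<noteq> []" "length (p c) \<le> n" "last (p c) = x"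
      unfolding c p_def using JD bD by auto
    fix t assume t: "t < length (p c)"
    show "B t (take t (p c))"
    proof (cases "j t = 0")
      case False
      thus ?thesis using open_block_avoids[OF J b, of t "j t * G"] t jt[OF False]
        unfolding c p_def B_def by simp
    qed (simp add: B_def)
  next
    fix c c' v v' assume cc: "c \<in> C" "c' \<in> C" "p c @ v = p c' @ v'"
    obtain J b where c: "c = (J, b)" and J: "J \<in> first_visits x n" and b: "b \<in> return_blocks x (4 * G) (n - length J)"
      using cc(1) unfolding C_def by auto
    obtain J' b' where c': "c' = (J', b')" and J': "J' \<in> first_visits x n" and b': "b' \<in> return_blocks x (4 * G) (n - length J')"
      using cc(2) unfolding C_def by auto
    have eq: "J @ (b @ v) = J' @ (b' @ v')" using cc(3) unfolding c c' p_def by simp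
    have "J = J'" using return_blocks_prefix_free[OF J[unfolded first_visits_def] J'[unfolded first_visits_def] eq] .
    moreover from this eq have "b @ v = b' @ v'" by simp
    hence "b = b'" using return_blocks_prefix_free[OF b b'] by blast
    ultimately show "c = c'" unfolding c c' by simp
  next
    fix t assume "t < n" show "0 \<le> e (j t)" unfolding e_def by auto
  next
    fix t z assume z: "z \<in> S"
    show "(\<Sum>u\<in>paths t. wt z u * of_bool (B t (rev u))) \<le> (e (j t))\<^sup>2"
    proof (cases "j t = 0")
      case True
      have "(\<Sum>u\<in>paths t. wt z u * of_bool (B t (rev u))) \<le> (\<Sum>u\<in>paths t. wt z u)"
        by (intro sum_mono) (auto simp: wt_nonneg' z)
      thus ?thesis using True sum_wt[OF z] unfolding e_def by simp
    next
      case False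
      define a where "a = j t * G"
      have a: "a \<le> t" "t = (t - a) + a" using jt[OF False] unfolding a_def by auto
      have ap: "avoid x a y \<le> (1/4) ^ j t" if "y \<in> S" for y
        unfolding a_def by (rule avoid_power[OF av that]) auto
      have "(\<Sum>u\<in>paths t. wt z u * of_bool (B t (rev u)))
         \<le> (\<Sum>u\<in>paths t. wt z u * of_bool (x \<notin> set (drop (t - a) u)) + wt z u * of_bool (x \<notin> set (take a u)))"
      proof (rule sum_mono)
        fix u assume u: "u \<in> paths t"
        have "B t (rev u) \<longleftrightarrow> x \<notin> set (drop (t - a) u) \<or> x \<notin> set (take a u)"
          unfolding B_def a_def[symmetric] using u a by (simp add: take_rev drop_rev paths_length)
        thus "wt z u * of_bool (B t (rev u)) \<le> wt z u * of_bool (x \<notin> set (drop (t - a) u)) + wt z u * of_bool (x \<notin> set (take a u))"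
          using wt_nonneg'[OF z u] by auto
      qed
      also have "\<dots> = (\<Sum>u\<in>paths ((t - a) + a). wt z u * of_bool (x \<notin> set (drop (t - a) u)))
         + (\<Sum>u\<in>paths (a + (t - a)). wt z u * of_bool (x \<notin> set (take a u)))"
        using a by (simp add: sum.distrib)
      also have "(\<Sum>u\<in>paths ((t - a) + a). wt z u * of_bool (x \<notin> set (drop (t - a) u))) \<le> (1/4) ^ j t"
        by (rule avoid_suffix[OF z ap])
      also have "(\<Sum>u\<in>paths (a + (t - a)). wt z u * of_bool (x \<notin> set (take a u))) = avoid x a z"
        unfolding avoid_def by (rule sum_wt_take[OF z])
      also have "\<dots> \<le> (1/4) ^ j t" by (rule ap[OF z])
      finally have "(\<Sum>u\<in>paths t. wt z u * of_bool (B t (rev u))) \<le> 2 * (1/4) ^ j t" by simp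
      also have "\<dots> \<le> 9/4 * (1/4) ^ j t" by simp
      also have "\<dots> = (e (j t))\<^sup>2"
        using False unfolding e_def
        by (simp add: power_mult_distrib power2_eq_square power_mult_distrib[symmetric])
      finally show ?thesis .
    qed
  qed
  also have "\<dots> \<le> (9 * real G)\<^sup>2 * shift_energy f n"
  proof (intro mult_right_mono power_mono shift_energy_nonneg)
    show "0 \<le> (\<Sum>t<n. e (j t))" by (intro sum_nonneg) (auto simp: e_def)
    have "(\<Sum>t<n. e (j t)) \<le> (\<Sum>t<4 * G + n. e (j t))"
      by (rule sum_mono2) (auto simp: e_def)
    also have "\<dots> = (\<Sum>t<4 * G. e (j t)) + (\<Sum>t<n. e (t div (2 * G)))"
      unfolding sum_lessThan_add j_def by simp
    also have "(\<Sum>t<4 * G. e (j t)) = real (4 * G)" unfolding j_def e_def by simp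
    also have "(\<Sum>t<n. e (t div (2 * G))) \<le> real (2 * G) * (5/2)"
    proof (rule sum_div_le)
      show "(\<Sum>i<n. e i) \<le> 5/2"
      proof (cases n)
        case (Suc k)
        have "(\<Sum>i<Suc k. e i) = 5/2 - 3 * (1/2) ^ Suc k" by (induction k) (auto simp: e_def)
        also have "\<dots> \<le> 5/2" by simp
        finally show ?thesis unfolding Suc .
      qed simp
    qed (use G in \<open>auto simp: e_def\<close>)
    finally show "(\<Sum>t<n. e (j t)) \<le> 9 * real G" by simp
  qed
  finally show ?thesis by (simp add: power_mult_distrib)
qed

text \<open>With the block and without it, the window is compared with the same third window, the one that
  starts after the block and, respectively, after the first visit.\<close>

lemma total_block_cost:
  assumes x: "x \<in> S" and av: "\<And>z. z \<in> S \<Longrightarrow> avoid x G z \<le> 1/4" and G: "G \<ge> 1"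
  shows "(\<Sum>J\<in>first_visits x n. pw J * block_cost x (4 * G) f (mset J) (n - length J))
     \<le> 122 * (real G)\<^sup>2 * shift_energy f n"
proof -
  define d where "d J = (\<Sum>Y\<in>paths n. wt x Y * (f (mset (take n (J @ Y))) - f (mset Y))\<^sup>2)" for J
  define RB where "RB J = return_blocks x (4 * G) (n - length J)" for J :: "'a list"
  have d0: "0 \<le> d J" for J unfolding d_def by (intro sum_nonneg) (auto simp: wt_nonneg' x)
  have "pw J * block_cost x (4 * G) f (mset J) (n - length J)
     \<le> 6/5 * (pw J * (\<Sum>b\<in>RB J. wt x b * d (J @ b))) + 6 * (pw J * d J)" if J: "J \<in> first_visits x n" for J
  proof -
    note JD = return_blocksD[OF J[unfolded first_visits_def]]
    have pJ: "0 \<le> pw J" by (rule first_visits_pw_nonneg[OF J])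
    have "block_cost x (4 * G) f (mset J) (n - length J)
       = (\<Sum>b\<in>RB J. wt x b * (\<Sum>w\<in>paths (n - length J). wt x w *
          (f (mset J + mset b + mset (take (n - length J - length b) w)) - f (mset J + mset w))\<^sup>2))"
      unfolding block_cost_def RB_def sum_return_blocks
      by (intro sum.cong refl) (simp add: first_hit_returnsD(5))
    also have "\<dots> \<le> (\<Sum>b\<in>RB J. wt x b * (6/5 * d (J @ b) + 6 * d J))"
    proof (intro sum_mono mult_left_mono)
      fix b assume b: "b \<in> RB J"
      note bD = return_blocksD[OF b[unfolded RB_def]]
      show "0 \<le> wt x b" using bD x by (intro wt_nonneg)
      have "(\<Sum>w\<in>paths (n - length J). wt x w *
          (f (mset J + mset b + mset (take (n - length J - length b) w)) - f (mset J + mset w))\<^sup>2)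
        = (\<Sum>Y\<in>paths (n - length J + length J). wt x Y *
          (f (mset J + mset b + mset (take (n - length J - length b) (take (n - length J) Y))) - f (mset J + mset (take (n - length J) Y)))\<^sup>2)"
        by (rule sum_wt_take[OF x, symmetric])
      also have "\<dots> = (\<Sum>Y\<in>paths n. wt x Y * (f (mset (take n ((J @ b) @ Y))) - f (mset (take n (J @ Y))))\<^sup>2)"
        using JD(2) bD(2) by (simp add: min_def add.assoc)
      also have "\<dots> \<le> (\<Sum>Y\<in>paths n. 6/5 * (wt x Y * (f (mset (take n ((J @ b) @ Y))) - f (mset Y))\<^sup>2)
           + 6 * (wt x Y * (f (mset (take n (J @ Y))) - f (mset Y))\<^sup>2))"
      proof (rule sum_mono)
        fix Y assume Y: "Y \<in> paths n"
        show "wt x Y * (f (mset (take n ((J @ b) @ Y))) - f (mset (take n (J @ Y))))\<^sup>2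
          \<le> 6/5 * (wt x Y * (f (mset (take n ((J @ b) @ Y))) - f (mset Y))\<^sup>2)
           + 6 * (wt x Y * (f (mset (take n (J @ Y))) - f (mset Y))\<^sup>2)"
          using mult_left_mono[OF square_le_two_step[of "f (mset (take n ((J @ b) @ Y)))" "f (mset (take n (J @ Y)))" "f (mset Y)"] wt_nonneg'[OF x Y]]
          by (simp add: algebra_simps)
      qed
      also have "\<dots> = 6/5 * d (J @ b) + 6 * d J" unfolding d_def by (simp only: sum.distrib sum_distrib_left)
      finally show "(\<Sum>w\<in>paths (n - length J). wt x w *
          (f (mset J + mset b + mset (take (n - length J - length b) w)) - f (mset J + mset w))\<^sup>2)
        \<le> 6/5 * d (J @ b) + 6 * d J" .
    qed
    also have "\<dots> = 6/5 * (\<Sum>b\<in>RB J. wt x b * d (J @ b)) + 6 * ((\<Sum>b\<in>RB J. wt x b) * d J)"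
      by (simp add: distrib_left sum.distrib sum_distrib_left sum_distrib_right mult_ac)
    also have "(\<Sum>b\<in>RB J. wt x b) * d J \<le> 1 * d J"
      unfolding RB_def by (intro mult_right_mono sum_wt_return_blocks_le[OF x] d0)
    finally have "block_cost x (4 * G) f (mset J) (n - length J) \<le> 6/5 * (\<Sum>b\<in>RB J. wt x b * d (J @ b)) + 6 * d J"
      by simp
    from mult_left_mono[OF this pJ] show ?thesis by (simp add: algebra_simps)
  qed
  hence "(\<Sum>J\<in>first_visits x n. pw J * block_cost x (4 * G) f (mset J) (n - length J))
     \<le> (\<Sum>J\<in>first_visits x n. 6/5 * (pw J * (\<Sum>b\<in>RB J. wt x b * d (J @ b))) + 6 * (pw J * d J))"
    by (rule sum_mono)
  also have "\<dots> = 6/5 * (\<Sum>J\<in>first_visits x n. pw J * (\<Sum>b\<in>RB J. wt x b * d (J @ b)))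
       + 6 * (\<Sum>J\<in>first_visits x n. pw J * d J)"
    by (simp only: sum.distrib sum_distrib_left)
  also have "\<dots> \<le> 6/5 * (81 * (real G)\<^sup>2 * shift_energy f n) + 6 * (4 * (real G)\<^sup>2 * shift_energy f n)"
    using first_block_cost[OF av G, where n = n and f = f] first_visit_cost[OF av G, where n = n and f = f]
    unfolding d_def RB_def append_assoc by (intro add_mono mult_left_mono) auto
  also have "\<dots> \<le> 122 * (real G)\<^sup>2 * shift_energy f n"
  proof -
    have "0 \<le> (real G)\<^sup>2 * shift_energy f n" by (simp add: shift_energy_nonneg)
    thus ?thesis by (simp add: mult.commute)
  qed
  finally show ?thesis .
qed

end

section \<open>Long windows\<close>

lemma weighted_cauchy_schwarz:
  fixes q y :: "'b \<Rightarrow> real"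
  assumes q: "\<And>a. a \<in> A \<Longrightarrow> 0 \<le> q a"
  shows "(\<Sum>a\<in>A. q a * y a)\<^sup>2 \<le> (\<Sum>a\<in>A. q a) * (\<Sum>a\<in>A. q a * (y a)\<^sup>2)"
proof -
  have "(\<Sum>a\<in>A. sqrt (q a) * (sqrt (q a) * y a))\<^sup>2
      \<le> (\<Sum>a\<in>A. (sqrt (q a))\<^sup>2) * (\<Sum>a\<in>A. (sqrt (q a) * y a)\<^sup>2)"
    by (rule Cauchy_Schwarz_ineq_sum)
  also have "(\<Sum>a\<in>A. sqrt (q a) * (sqrt (q a) * y a)) = (\<Sum>a\<in>A. q a * y a)"
    using q by (intro sum.cong) (auto simp: mult.assoc[symmetric])
  also have "(\<Sum>a\<in>A. (sqrt (q a))\<^sup>2) = (\<Sum>a\<in>A. q a)" using q by (intro sum.cong) auto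
  also have "(\<Sum>a\<in>A. (sqrt (q a) * y a)\<^sup>2) = (\<Sum>a\<in>A. q a * (y a)\<^sup>2)"
    using q by (intro sum.cong) (auto simp: power_mult_distrib)
  finally show ?thesis .
qed

lemma second_moment_le_centered:
  fixes q y :: "'b \<Rightarrow> real"
  assumes half: "1/2 \<le> (\<Sum>a\<in>A. q a)" and N: "0 \<le> N"
    and m: "(\<Sum>a\<in>A. q a * y a)\<^sup>2 \<le> (1 - (\<Sum>a\<in>A. q a)) * N"
  shows "(\<Sum>a\<in>A. q a * (y a)\<^sup>2) \<le> (\<Sum>a\<in>A. q a * (y a - c)\<^sup>2) + N"
proof -
  define p where "p = (\<Sum>a\<in>A. q a)"
  define e where "e = (\<Sum>a\<in>A. q a * y a)"
  have "(\<Sum>a\<in>A. q a * (y a - c)\<^sup>2) = (\<Sum>a\<in>A. q a * (y a)\<^sup>2) - 2 * c * e + c\<^sup>2 * p"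
    unfolding e_def p_def sum_distrib_left sum_subtractf[symmetric] sum.distrib[symmetric]
    by (intro sum.cong refl) (simp add: power2_eq_square algebra_simps)
  moreover have "2 * c * e - c\<^sup>2 * p \<le> N"
  proof -
    have "(2 * c * e - c\<^sup>2 * p) * p = e\<^sup>2 - (e - c * p)\<^sup>2" by (simp add: power2_eq_square algebra_simps)
    also have "\<dots> \<le> e\<^sup>2" by simp
    also have "\<dots> \<le> (1 - p) * N" using m unfolding e_def p_def .
    also have "\<dots> \<le> p * N" using half N unfolding p_def by (intro mult_right_mono) auto
    finally have "(2 * c * e - c\<^sup>2 * p) * p \<le> N * p" by (simp add: mult.commute)
    moreover have "0 < p" using half unfolding p_def by linarith
    ultimately show ?thesis by (simp only: mult_le_cancel_right_pos)
  qed
  ultimately show ?thesis by linarith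
qed

context reversible_chain
begin

text \<open>The first n - T entries predict the value of f up to the mean square of a shift by T: they are the
  end of a window that started T steps earlier, and the predictor averages f over the
  missing past.\<close>

lemma predictor_exists:
  assumes T: "T < n"
  obtains h where "(\<Sum>w\<in>paths n. pw w * (f (mset w) - h (take (n - T) w))\<^sup>2) \<le> (real T)\<^sup>2 * shift_energy f n"
proof -
  define h where "h u = (\<Sum>v\<in>paths T. wt (hd u) v * f (mset v + mset u))" for u
  have "(\<Sum>w\<in>paths n. pw w * (f (mset w) - h (take (n - T) w))\<^sup>2)
     \<le> (\<Sum>w\<in>paths n. pw w * (\<Sum>v\<in>paths T. wt (hd w) v * (f (mset w) - f (mset v + mset (take (n - T) w)))\<^sup>2))"
  proof (intro sum_mono mult_left_mono)
    fix w assume w: "w \<in> paths n"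
    show "0 \<le> pw w" by (rule pw_nonneg[OF w])
    have "w \<noteq> []" using paths_length[OF w] T by auto
    hence hd: "hd w \<in> S" using paths_set[OF w] by auto
    have "hd (take (n - T) w) = hd w" using T by simp
    hence "f (mset w) - h (take (n - T) w) = (\<Sum>v\<in>paths T. wt (hd w) v * (f (mset w) - f (mset v + mset (take (n - T) w))))"
      unfolding h_def using sum_wt[OF hd, of T]
      by (simp add: right_diff_distrib sum_subtractf flip: sum_distrib_right)
    thus "(f (mset w) - h (take (n - T) w))\<^sup>2
       \<le> (\<Sum>v\<in>paths T. wt (hd w) v * (f (mset w) - f (mset v + mset (take (n - T) w)))\<^sup>2)"
      using jensen_square[of "paths T" "wt (hd w)"] sum_wt[OF hd] wt_nonneg'[OF hd] by simp
  qed
  also have "\<dots> = (\<Sum>w\<in>paths (T + n). pw w *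
       (f (mset (drop T w)) - f (mset (rev (take T w)) + mset (take (n - T) (drop T w))))\<^sup>2)"
    using T by (intro sum_pw_past) simp
  also have "\<dots> = (\<Sum>w\<in>paths (T + n). pw w * (f (mset (take n w)) - f (mset (drop T w)))\<^sup>2)"
  proof (intro sum.cong refl)
    fix w :: "'a list"
    have "take n w = take T w @ take (n - T) (drop T w)" using T by (metis le_add_diff_inverse less_imp_le take_add)
    hence "mset (rev (take T w)) + mset (take (n - T) (drop T w)) = mset (take n w)" by simp
    thus "pw w * (f (mset (drop T w)) - f (mset (rev (take T w)) + mset (take (n - T) (drop T w))))\<^sup>2
      = pw w * (f (mset (take n w)) - f (mset (drop T w)))\<^sup>2" by (simp add: power2_commute)
  qed
  also have "\<dots> \<le> (real T)\<^sup>2 * shift_energy f n" by (rule shift_by)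
  finally show thesis by (rule that)
qed

text \<open>The window shifted back by a ends before the last a entries, and whatever it is, the conditional
  probability that these avoid x is at most \<delta>.\<close>

lemma tail_event_bound:
  assumes a: "a \<le> n" "n \<ge> 1" and av: "\<And>z. z \<in> S \<Longrightarrow> avoid x a z \<le> \<delta>"
  shows "(\<Sum>w\<in>paths n. pw w * ((f (mset w))\<^sup>2 * of_bool (x \<notin> set (drop (n - a) w))))
     \<le> 2 * (real a)\<^sup>2 * shift_energy f n + 2 * \<delta> * (\<Sum>w\<in>paths n. pw w * (f (mset w))\<^sup>2)"
proof -
  let ?I = "\<lambda>w. of_bool (x \<notin> set (drop n w)) :: real"
  have "(\<Sum>w\<in>paths n. pw w * ((f (mset w))\<^sup>2 * of_bool (x \<notin> set (drop (n - a) w))))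
     = (\<Sum>w\<in>paths (a + n). pw w * ((f (mset (drop a w)))\<^sup>2 * of_bool (x \<notin> set (drop (n - a) (drop a w)))))"
    by (rule sum_pw_drop[symmetric])
  also have "\<dots> = (\<Sum>w\<in>paths (a + n). pw w * ((f (mset (drop a w)))\<^sup>2 * ?I w))"
    using a by (simp add: drop_drop)
  also have "\<dots> \<le> (\<Sum>w\<in>paths (a + n). 2 * (pw w * (f (mset (take n w)) - f (mset (drop a w)))\<^sup>2)
        + 2 * (pw w * ((f (mset (take n w)))\<^sup>2 * ?I w)))"
  proof (rule sum_mono)
    fix w assume w: "w \<in> paths (a + n)"
    have "(f (mset (drop a w)))\<^sup>2 \<le> 2 * (f (mset (take n w)) - f (mset (drop a w)))\<^sup>2 + 2 * (f (mset (take n w)))\<^sup>2"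
      using zero_le_power2[of "2 * f (mset (take n w)) - f (mset (drop a w))"]
      by (simp add: power2_eq_square algebra_simps)
    hence "(f (mset (drop a w)))\<^sup>2 * ?I w
        \<le> 2 * (f (mset (take n w)) - f (mset (drop a w)))\<^sup>2 + 2 * ((f (mset (take n w)))\<^sup>2 * ?I w)"
      by auto
    from mult_left_mono[OF this pw_nonneg[OF w]]
    show "pw w * ((f (mset (drop a w)))\<^sup>2 * ?I w)
       \<le> 2 * (pw w * (f (mset (take n w)) - f (mset (drop a w)))\<^sup>2) + 2 * (pw w * ((f (mset (take n w)))\<^sup>2 * ?I w))"
      by (simp add: algebra_simps)
  qed
  also have "\<dots> = 2 * (\<Sum>w\<in>paths (a + n). pw w * (f (mset (take n w)) - f (mset (drop a w)))\<^sup>2)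
      + 2 * (\<Sum>w\<in>paths (n + a). pw w * ((f (mset (take n w)))\<^sup>2 * ?I w))"
    by (simp only: sum.distrib sum_distrib_left add.commute[of a n])
  also have "\<dots> \<le> 2 * ((real a)\<^sup>2 * shift_energy f n) + 2 * (\<delta> * (\<Sum>w\<in>paths n. pw w * (f (mset w))\<^sup>2))"
  proof (intro add_mono mult_left_mono shift_by)
    show "(\<Sum>w\<in>paths (n + a). pw w * ((f (mset (take n w)))\<^sup>2 * ?I w)) \<le> \<delta> * (\<Sum>w\<in>paths n. pw w * (f (mset w))\<^sup>2)"
      by (rule sum_pw_suffix_event) (use a av in \<open>auto simp: avoid_def\<close>)
  qed auto
  finally show ?thesis by simp
qed

text \<open>The path is cut at the first visit to x and then into blocks. Events of small probability, weighted
  with f squared, are bounded by a shift plus a small multiple of the variance, which is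
  absorbed into the left-hand side.\<close>

lemma poincare_long_window:
  assumes x: "x \<in> S" and av: "\<And>z. z \<in> S \<Longrightarrow> avoid x G z \<le> 1/4" and G: "G \<ge> 1" and n: "24 * G \<le> n"
    and mean: "(\<Sum>w\<in>paths n. pw w * f (mset w)) = 0"
  shows "(\<Sum>w\<in>paths n. pw w * (f (mset w))\<^sup>2) \<le> 40 * real n * real G * shift_energy f n"
proof -
  define V where "V = (\<Sum>w\<in>paths n. pw w * (f (mset w))\<^sup>2)"
  define D where "D = shift_energy f n"
  define J where "J = first_visits x n"
  define N where "N = never (returns x 0) n"
  define cm where "cm w = cmean x f (mset w) (n - length w)" for w
  define I where "I w = (of_bool (x \<notin> set (drop (n - 4 * G) w)) :: real)" for w
  define K where "K w = (f (mset w))\<^sup>2 * (I w + 1/64)" for w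
  have n1: "n \<ge> 1" using n G by simp
  have D0: "0 \<le> D" unfolding D_def by (rule shift_energy_nonneg)
  have N_paths: "w \<in> paths n" if "w \<in> N" for w using that never_subset unfolding N_def by blast
  have pwN: "0 \<le> pw w" if "w \<in> N" for w by (rule pw_nonneg[OF N_paths[OF that]])
  have IN: "I w = 1" if "w \<in> N" for w
    using never_returns_avoids[of w x 0 n] that unfolding I_def N_def by (auto dest: in_set_dropD)
  define N0 where "N0 = (\<Sum>w\<in>N. pw w * (f (mset w))\<^sup>2)"
  have N00: "0 \<le> N0" unfolding N0_def by (intro sum_nonneg) (simp add: pwN)
  have av4: "avoid x (4 * G) z \<le> 1/256" if "z \<in> S" for z
    using avoid_power[where j = 4 and G = G and r = "4 * G", OF av that] by (simp add: power_divide)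
  \<comment> \<open>Variance after the first visit, plus the second moment of the conditional mean at the first visit,
    plus the paths without a visit.\<close>
  have V_split: "V = (\<Sum>j\<in>J. pw j * cvar x f (mset j) (n - length j)) + (\<Sum>j\<in>J. pw j * (cm j)\<^sup>2) + N0"
  proof -
    have "(\<Sum>v\<in>paths (n - length j). wt x v * (f (mset (j @ v)))\<^sup>2) = cvar x f (mset j) (n - length j) + (cm j)\<^sup>2" for j
      using second_moment_cmean[OF x, where f = f and k = "mset j" and r = "n - length j" and c = 0]
      unfolding cm_def by simp
    thus ?thesis
      unfolding V_def split_pw_first_visit[where x = x and n = n] N0_def N_def J_def
      by (simp add: distrib_left sum.distrib)
  qed
  have cm_bound: "(\<Sum>j\<in>J. pw j * (cm j)\<^sup>2) \<le> 4 * (real G)\<^sup>2 * D + N0"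
  proof -
    define c where "c = (\<Sum>Y\<in>paths n. wt x Y * f (mset Y))"
    have mass: "(\<Sum>j\<in>J. pw j) + (\<Sum>w\<in>N. pw w) = 1"
      using split_pw_first_visit[where x = x and n = n and G = "\<lambda>_. 1"] unfolding J_def N_def
      by (simp add: sum_pw sum_wt x)
    have Nmass: "(\<Sum>w\<in>N. pw w) \<le> 1/256"
    proof -
      have "(\<Sum>w\<in>N. pw w) = (\<Sum>w\<in>N. pw w * I w)" using IN by simp
      also have "\<dots> \<le> (\<Sum>w\<in>paths n. pw w * I w)"
        using N_paths by (intro sum_mono2) (auto simp: pw_nonneg I_def)
      also have "\<dots> = (\<Sum>w\<in>paths ((n - 4 * G) + 4 * G). pw w * (1 * of_bool (x \<notin> set (drop (n - 4 * G) w))))"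
        using n unfolding I_def by simp
      also have "\<dots> \<le> 1/256 * (\<Sum>w\<in>paths (n - 4 * G). pw w * 1)"
        by (rule sum_pw_suffix_event) (use n G av4 in \<open>auto simp: avoid_def\<close>)
      finally show ?thesis by (simp add: sum_pw)
    qed
    have first: "(\<Sum>j\<in>J. pw j * cm j) = - (\<Sum>w\<in>N. pw w * f (mset w))"
    proof -
      have "(\<Sum>v\<in>paths (n - length j). wt x v * f (mset (j @ v))) = cm j" for j
        unfolding cm_def cmean_def by simp
      thus ?thesis
        using split_pw_first_visit[where x = x and n = n and G = "\<lambda>w. f (mset w)"] mean
        unfolding J_def N_def by simp
    qed
    have "(\<Sum>j\<in>J. pw j * (cm j)\<^sup>2) \<le> (\<Sum>j\<in>J. pw j * (cm j - c)\<^sup>2) + N0"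
    proof (rule second_moment_le_centered[OF _ N00])
      show "1/2 \<le> (\<Sum>j\<in>J. pw j)" using mass Nmass by linarith
      have "(\<Sum>j\<in>J. pw j * cm j)\<^sup>2 = (\<Sum>w\<in>N. pw w * f (mset w))\<^sup>2" unfolding first by simp
      also have "\<dots> \<le> (\<Sum>w\<in>N. pw w) * N0"
        unfolding N0_def by (rule weighted_cauchy_schwarz[OF pwN])
      also have "(\<Sum>w\<in>N. pw w) = 1 - (\<Sum>j\<in>J. pw j)" using mass by simp
      finally show "(\<Sum>j\<in>J. pw j * cm j)\<^sup>2 \<le> (1 - (\<Sum>j\<in>J. pw j)) * N0" .
    qed
    also have "(\<Sum>j\<in>J. pw j * (cm j - c)\<^sup>2)
       \<le> (\<Sum>j\<in>J. pw j * (\<Sum>Y\<in>paths n. wt x Y * (f (mset (take n (j @ Y))) - f (mset Y))\<^sup>2))"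
    proof (intro sum_mono mult_left_mono)
      fix j assume j: "j \<in> J"
      show "0 \<le> pw j" using first_visits_pw_nonneg j unfolding J_def by blast
      have "length j \<le> n" using j unfolding J_def first_visits_def by (rule return_blocksD)
      thus "(cm j - c)\<^sup>2 \<le> (\<Sum>Y\<in>paths n. wt x Y * (f (mset (take n (j @ Y))) - f (mset Y))\<^sup>2)"
        unfolding cm_def c_def using cmean_diff_le[OF x, of "n - length j" n f "mset j" "\<lambda>Y. f (mset Y)"] by simp
    qed
    also have "\<dots> \<le> 4 * (real G)\<^sup>2 * D" unfolding J_def D_def by (rule first_visit_cost[OF av G])
    finally show ?thesis by simp
  qed
  obtain h where h: "(\<Sum>w\<in>paths n. pw w * (f (mset w) - h (take (n - 8 * G) w))\<^sup>2) \<le> (real (8 * G))\<^sup>2 * D"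
    using predictor_exists[of "8 * G" n f] n G unfolding D_def by auto
  define H where "H w = (f (mset w) - h (take (n - 8 * G) w))\<^sup>2" for w
  have cvar_sum: "(\<Sum>j\<in>J. pw j * cvar x f (mset j) (n - length j))
     \<le> real n / (4 * real G) * (\<Sum>j\<in>J. pw j * block_cost x (4 * G) f (mset j) (n - length j))
       + (\<Sum>j\<in>J. pw j * (\<Sum>v\<in>paths (n - length j). wt x v * H (j @ v)))
       + 2 * (\<Sum>j\<in>J. pw j * (\<Sum>v\<in>paths (n - length j). wt x v * K (j @ v)))"
    unfolding sum_distrib_left[of _ _ J] sum.distrib[symmetric]
  proof (rule sum_mono)
    fix j assume j: "j \<in> J"
    have pj: "0 \<le> pw j" using first_visits_pw_nonneg j unfolding J_def by blast
    have jn: "length j \<le> n" using j unfolding J_def first_visits_def by (rule return_blocksD)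
    have "cvar x f (mset j) (n - length j) \<le> real (n - length j) / (4 * real G) * block_cost x (4 * G) f (mset j) (n - length j)
        + (\<Sum>v\<in>paths (n - length j). wt x v * (f (mset j + mset v) - h (take (n - 8 * G) (j @ take (n - length j - 8 * G) v)))\<^sup>2)
        + 2 * (\<Sum>v\<in>paths (n - length j). wt x v * ((f (mset j + mset v))\<^sup>2 * tail_weight x G (n - length j) v))"
      using cvar_bound[OF x av G, of f "mset j" "n - length j" "\<lambda>u. h (take (n - 8 * G) (j @ u))"] .
    also have "real (n - length j) / (4 * real G) * block_cost x (4 * G) f (mset j) (n - length j)
       \<le> real n / (4 * real G) * block_cost x (4 * G) f (mset j) (n - length j)"
      by (intro mult_right_mono divide_right_mono block_cost_nonneg x) auto
    also have "(\<Sum>v\<in>paths (n - length j). wt x v * (f (mset j + mset v) - h (take (n - 8 * G) (j @ take (n - length j - 8 * G) v)))\<^sup>2)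
       = (\<Sum>v\<in>paths (n - length j). wt x v * H (j @ v))"
      unfolding H_def by (simp add: min_def add.commute)
    also have "(\<Sum>v\<in>paths (n - length j). wt x v * ((f (mset j + mset v))\<^sup>2 * tail_weight x G (n - length j) v))
       \<le> (\<Sum>v\<in>paths (n - length j). wt x v * K (j @ v))"
    proof (intro sum_mono mult_left_mono)
      fix v assume v: "v \<in> paths (n - length j)"
      show "0 \<le> wt x v" by (rule wt_nonneg'[OF x v])
      have "tail_weight x G (n - length j) v \<le> I (j @ v) + 1/64"
      proof (cases "n - length j < 8 * G")
        case False
        hence "length j \<le> n - 4 * G" using G by linarith
        hence "drop (n - 4 * G) (j @ v) = drop (n - length j - 4 * G) v" by (simp add: add.commute)
        thus ?thesis unfolding tail_weight_def I_def by simp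
      qed (simp add: tail_weight_def I_def)
      thus "(f (mset j + mset v))\<^sup>2 * tail_weight x G (n - length j) v \<le> K (j @ v)"
        unfolding K_def by (simp add: mult_left_mono)
    qed
    finally have "cvar x f (mset j) (n - length j) \<le> real n / (4 * real G) * block_cost x (4 * G) f (mset j) (n - length j)
      + (\<Sum>v\<in>paths (n - length j). wt x v * H (j @ v)) + 2 * (\<Sum>v\<in>paths (n - length j). wt x v * K (j @ v))" by simp
    from mult_left_mono[OF this pj]
    show "pw j * cvar x f (mset j) (n - length j)
      \<le> real n / (4 * real G) * (pw j * block_cost x (4 * G) f (mset j) (n - length j))
        + pw j * (\<Sum>v\<in>paths (n - length j). wt x v * H (j @ v))
        + 2 * (pw j * (\<Sum>v\<in>paths (n - length j). wt x v * K (j @ v)))"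
      by (simp add: distrib_left mult.left_commute)
  qed
  have blocks: "real n / (4 * real G) * (\<Sum>j\<in>J. pw j * block_cost x (4 * G) f (mset j) (n - length j))
      \<le> real n / (4 * real G) * (122 * (real G)\<^sup>2 * D)"
    unfolding J_def D_def by (intro mult_left_mono total_block_cost[OF x av G]) auto
  have Hsum: "(\<Sum>j\<in>J. pw j * (\<Sum>v\<in>paths (n - length j). wt x v * H (j @ v))) \<le> 64 * (real G)\<^sup>2 * D"
  proof -
    have "(\<Sum>j\<in>J. pw j * (\<Sum>v\<in>paths (n - length j). wt x v * H (j @ v))) \<le> (\<Sum>w\<in>paths n. pw w * H w)"
      unfolding split_pw_first_visit[where x = x and n = n and G = H] J_def[symmetric] N_def[symmetric]
      by (simp add: sum_nonneg pwN H_def)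
    thus ?thesis using h unfolding H_def by (simp add: power_mult_distrib)
  qed
  have Ksum: "(\<Sum>j\<in>J. pw j * (\<Sum>v\<in>paths (n - length j). wt x v * K (j @ v))) + N0 \<le> 32 * (real G)\<^sup>2 * D + 3/128 * V"
  proof -
    have "N0 \<le> (\<Sum>w\<in>N. pw w * K w)"
      unfolding N0_def K_def by (intro sum_mono mult_left_mono) (auto simp: IN pwN algebra_simps)
    hence "(\<Sum>j\<in>J. pw j * (\<Sum>v\<in>paths (n - length j). wt x v * K (j @ v))) + N0 \<le> (\<Sum>w\<in>paths n. pw w * K w)"
      unfolding split_pw_first_visit[where x = x and n = n and G = K] J_def[symmetric] N_def[symmetric] by simp
    also have "\<dots> = (\<Sum>w\<in>paths n. pw w * ((f (mset w))\<^sup>2 * I w)) + 1/64 * V"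
      unfolding K_def V_def sum_distrib_left sum.distrib[symmetric]
      by (intro sum.cong refl) (simp add: algebra_simps)
    also have "(\<Sum>w\<in>paths n. pw w * ((f (mset w))\<^sup>2 * I w)) \<le> 2 * (real (4 * G))\<^sup>2 * D + 2 * (1/256) * V"
      unfolding I_def V_def D_def by (rule tail_event_bound) (use n n1 av4 in auto)
    finally show ?thesis by (simp add: power_mult_distrib)
  qed
  \<comment> \<open>Here 132 = 4 + 64 + 64, from the first visit, the predictor and the tail event, and 61/2 = 122/4
    comes from the blocks.\<close>
  have "V \<le> 132 * (real G)\<^sup>2 * D + 61/2 * real n * real G * D + 3/64 * V"
  proof -
    have "real n / (4 * real G) * (122 * (real G)\<^sup>2 * D) = 61/2 * real n * real G * D"
      using G by (simp add: field_simps power2_eq_square)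
    thus ?thesis using V_split cm_bound cvar_sum blocks Hsum Ksum by linarith
  qed
  moreover have "132 * (real G)\<^sup>2 * D \<le> 11/2 * real n * real G * D"
  proof -
    have "real G * 24 \<le> real n" using n by linarith
    hence "(real G * 24) * (real G * D) \<le> real n * (real G * D)" using D0 by (intro mult_right_mono) auto
    thus ?thesis by (simp add: power2_eq_square mult_ac)
  qed
  moreover have "0 \<le> real n * real G * D" using D0 by simp
  ultimately have "V \<le> 40 * (real n * real G * D)" by linarith
  thus ?thesis unfolding V_def D_def by (simp add: mult.assoc)
qed

text \<open>The time scale is G, of order card S / gap: within G steps a heavy state is hit with probability at
  least 3/4 from everywhere. Windows shorter than 24 G are covered by the bound for short windows.\<close>

theorem poincare_window:
  assumes two: "card S \<ge> 2" and gp: "gap S P > 0" and n: "n \<ge> 1"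
    and mean: "(\<Sum>w\<in>paths n. pw w * f (mset w)) = 0"
  shows "(\<Sum>w\<in>paths n. pw w * (f (mset w))\<^sup>2)
     \<le> 540 * real (card S) * real n / gap S P * shift_energy f n"
proof -
  let ?m = "real (card S)" let ?\<gamma> = "gap S P"
  have D0: "0 \<le> shift_energy f n" by (rule shift_energy_nonneg)
  have m2: "2 \<le> ?m" using two by simp
  have mg: "1 \<le> ?m / ?\<gamma>" using gap_le_2[OF two] m2 gp by (simp add: field_simps)
  obtain x where x: "x \<in> S" "1 / ?m \<le> \<pi> x"
  proof (rule ccontr)
    assume "\<not> thesis"
    hence "\<pi> x < 1 / ?m" if "x \<in> S" for x using that \<open>\<not> thesis\<close> \<open>\<And>x. \<lbrakk>x \<in> S; 1 / ?m \<le> \<pi> x\<rbrakk> \<Longrightarrow> thesis\<close> by force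
    moreover have "S \<noteq> {}" using two by auto
    ultimately have "(\<Sum>x\<in>S. \<pi> x) < (\<Sum>x\<in>S. 1 / ?m)" using finite_S by (intro sum_strict_mono)
    thus False using pi_sum two by simp
  qed
  define G where "G = nat \<lceil>8 * ?m / ?\<gamma>\<rceil>"
  have Gl: "8 * ?m / ?\<gamma> \<le> real G" unfolding G_def by linarith
  have Gu: "real G \<le> 9 * ?m / ?\<gamma>"
  proof -
    have "real G \<le> 8 * ?m / ?\<gamma> + 1" unfolding G_def using mg gp by linarith
    also have "\<dots> \<le> 8 * ?m / ?\<gamma> + ?m / ?\<gamma>" using mg by simp
    also have "\<dots> = 9 * ?m / ?\<gamma>" by (simp add: add_divide_distrib[symmetric])
    finally show ?thesis .
  qed
  have G1: "G \<ge> 1" using Gl mg by (cases G) auto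
  have av: "avoid x G z \<le> 1/4" if "z \<in> S" for z
  proof -
    have "real G * avoid x G z \<le> 2 * ?m / ?\<gamma>" using avoid_bound[OF two gp x that, of G] by simp
    also have "\<dots> \<le> real G * (1/4)" using Gl by simp
    finally show ?thesis using G1 by simp
  qed
  show ?thesis
  proof (cases "24 * G \<le> n")
    case True
    have "(\<Sum>w\<in>paths n. pw w * (f (mset w))\<^sup>2) \<le> 40 * real n * real G * shift_energy f n"
      by (rule poincare_long_window[OF x(1) av G1 True mean])
    also have "\<dots> \<le> 540 * ?m * real n / ?\<gamma> * shift_energy f n"
    proof (rule mult_right_mono[OF _ D0])
      have "40 * real n * real G \<le> 40 * real n * (9 * ?m / ?\<gamma>)" using Gu by (intro mult_left_mono) auto
      also have "\<dots> \<le> 540 * ?m * real n / ?\<gamma>" using gp by (simp add: field_simps)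
      finally show "40 * real n * real G \<le> 540 * ?m * real n / ?\<gamma>" .
    qed
    finally show ?thesis .
  next
    case False
    hence nG: "real n \<le> 24 * real G" by linarith
    have "(\<Sum>w\<in>paths n. pw w * (f (mset w))\<^sup>2) \<le> 2 * real n * (real n + 1 / ?\<gamma>) * shift_energy f n"
      by (rule poincare_short_window[OF two gp n mean])
    also have "\<dots> \<le> 540 * ?m * real n / ?\<gamma> * shift_energy f n"
    proof (rule mult_right_mono[OF _ D0])
      have "1 / ?\<gamma> \<le> ?m / ?\<gamma>" using m2 gp by (simp add: divide_right_mono)
      hence "real n + 1 / ?\<gamma> \<le> 217 * ?m / ?\<gamma>" using nG Gu by simp
      hence "2 * real n * (real n + 1 / ?\<gamma>) \<le> 2 * real n * (217 * ?m / ?\<gamma>)" by (intro mult_left_mono) auto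
      also have "\<dots> \<le> 540 * ?m * real n / ?\<gamma>" using gp by (simp add: field_simps)
      finally show "2 * real n * (real n + 1 / ?\<gamma>) \<le> 540 * ?m * real n / ?\<gamma>" .
    qed
    finally show ?thesis .
  qed
qed

end

section \<open>From the chain to path weights\<close>

lemma irreducible_law_pos:
  assumes "irreducible_reversible_kernel S P \<pi>" and x: "x \<in> S"
  shows "0 < \<pi> x"
proof -
  have fin: "finite S" and P0: "\<And>x y. x \<in> S \<Longrightarrow> y \<in> S \<Longrightarrow> 0 \<le> P x y"
    and irr: "irreducible_on S P" and \<pi>0: "\<And>x. x \<in> S \<Longrightarrow> 0 \<le> \<pi> x" and \<pi>1: "(\<Sum>x\<in>S. \<pi> x) = 1"
    and bal: "\<And>x y. x \<in> S \<Longrightarrow> y \<in> S \<Longrightarrow> \<pi> x * P x y = \<pi> y * P y x"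
    using assms unfolding irreducible_reversible_kernel_def stochastic_on_def stationary_law_def reversible_on_def
    by auto
  obtain y where y: "y \<in> S" "0 < \<pi> y"
  proof (rule ccontr)
    assume "\<not> thesis"
    hence "\<pi> y = 0" if "y \<in> S" for y using \<pi>0[OF that] that \<open>\<And>y. \<lbrakk>y \<in> S; 0 < \<pi> y\<rbrakk> \<Longrightarrow> thesis\<close> by force
    thus False using \<pi>1 by simp
  qed
  have "(y, x) \<in> {(u, v). u \<in> S \<and> v \<in> S \<and> P u v > 0}\<^sup>*" using irr y x unfolding irreducible_on_def by blast
  thus ?thesis
  proof (induction rule: rtrancl_induct)
    case (step u v)
    hence uv: "u \<in> S" "v \<in> S" "P u v > 0" by auto
    have "0 < \<pi> v * P v u" using bal[OF uv(1,2)] step.IH uv(3) by (metis mult_pos_pos)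
    thus ?case using \<pi>0[OF uv(2)] P0[OF uv(2,1)] by (simp add: zero_less_mult_iff)
  qed (use y in simp)
qed

lemma irreducible_kernel_reversible_chain:
  assumes "irreducible_reversible_kernel S P \<pi>"
  shows "reversible_chain S P \<pi>"
  using assms irreducible_law_pos[OF assms]
  unfolding irreducible_reversible_kernel_def stochastic_on_def stationary_law_def reversible_on_def reversible_chain_def
  by auto

text \<open>The states at the times 0, ..., r - 1.\<close>

definition sample_path :: "(int \<Rightarrow> 'w \<Rightarrow> 'a) \<Rightarrow> nat \<Rightarrow> 'w \<Rightarrow> 'a list" where
  "sample_path X r \<omega> = map (\<lambda>j. X (int j) \<omega>) [0..<r]"

lemma count_mset_map_upt: "count (mset (map g [0..<n])) = (\<lambda>x. \<Sum>j<n. if g j = x then 1 else 0)"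
proof (induction n)
  case (Suc n)
  have "count (mset (map g [0..<Suc n])) x = count (mset (map g [0..<n])) x + (if g n = x then 1 else 0)" for x
    by simp
  thus ?case unfolding Suc by auto
qed auto

lemma window_count_0: "window_count X n 0 \<omega> = count (mset (take n (sample_path X (n + r) \<omega>)))"
proof -
  have path: "take n (sample_path X (n + r) \<omega>) = map (\<lambda>j. X (int j) \<omega>) [0..<n]"
    unfolding sample_path_def by (simp add: take_map)
  show ?thesis unfolding window_count_def path count_mset_map_upt by simp
qed

lemma window_count_1: "window_count X n 1 \<omega> = count (mset (drop 1 (sample_path X (n + 1) \<omega>)))"
proof -
  have path: "drop 1 (sample_path X (n + 1) \<omega>) = map (\<lambda>j. X (1 + int j) \<omega>) [0..<n]"
    unfolding sample_path_def by (rule nth_equalityI) (auto simp del: upt_Suc)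
  show ?thesis unfolding window_count_def path count_mset_map_upt by simp
qed

text \<open>A reversible chain together with a stationary two-sided realization of it.\<close>

locale stationary_chain = reversible_chain S P \<pi>
  for S :: "'a set" and P \<pi> +
  fixes M :: "'w measure" and X :: "int \<Rightarrow> 'w \<Rightarrow> 'a"
  assumes chain: "stationary_markov_chain S P \<pi> M X"
begin

lemma prob_space_M: "prob_space M"
  using chain unfolding stationary_markov_chain_def by auto

lemma X_in_S:
  assumes "\<omega> \<in> space M"
  shows "X t \<omega> \<in> S"
proof -
  have "X t \<in> measurable M (count_space S)"
    using chain unfolding stationary_markov_chain_def by blast
  hence "X t \<omega> \<in> space (count_space S)" using assms by (rule measurable_space)
  thus ?thesis by simp
qed

lemma X_event: "{\<omega> \<in> space M. X t \<omega> = x} \<in> sets M"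
proof (cases "x \<in> S")
  case True
  have "X t -` {x} \<inter> space M \<in> sets M"
    using chain True unfolding stationary_markov_chain_def by (auto intro: measurable_sets)
  moreover have "X t -` {x} \<inter> space M = {\<omega> \<in> space M. X t \<omega> = x}" by auto
  ultimately show ?thesis by simp
next
  case False
  hence "{\<omega> \<in> space M. X t \<omega> = x} = {}" using X_in_S by blast
  thus ?thesis by (simp only: sets.empty_sets)
qed

lemma path_law:
  assumes "w \<in> paths (Suc r)"
  shows "measure M {\<omega> \<in> space M. \<forall>j<Suc r. X (int j) \<omega> = w ! j} = pw w"
  using assms
proof (induction r arbitrary: w)
  case 0
  then obtain y where y: "w = [y]" "y \<in> S" by (auto simp: paths_def length_Suc_conv)
  have "measure M {\<omega> \<in> space M. X 0 \<omega> = y} = \<pi> y"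
    using chain y unfolding stationary_markov_chain_def by auto
  thus ?case using y by simp
next
  case (Suc r)
  define u where "u = take (Suc r) w"
  define y where "y = w ! Suc r"
  have len: "length w = Suc (Suc r)" using paths_length[OF Suc.prems] .
  have u: "u \<in> paths (Suc r)" unfolding u_def by (rule take_in_paths[OF Suc.prems]) simp
  have yS: "y \<in> S" using paths_set[OF Suc.prems] len unfolding y_def by auto
  have w: "w = u @ [y]" unfolding u_def y_def using len take_Suc_conv_app_nth[of "Suc r" w] by simp
  have une: "u \<noteq> []" using paths_length[OF u] by auto
  define h where "h j = u ! (r - j)" for j
  have hS: "\<forall>j\<le>r. h j \<in> S" unfolding h_def using paths_set[OF u] paths_length[OF u] by auto
  have mk: "measure M {\<omega> \<in> space M. (\<forall>j\<le>r. X (int r - int j) \<omega> = h j) \<and> X (int r + 1) \<omega> = y}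
      = measure M {\<omega> \<in> space M. \<forall>j\<le>r. X (int r - int j) \<omega> = h j} * P (h 0) y"
    using chain hS yS unfolding stationary_markov_chain_def by blast
  have past: "(\<forall>j\<le>r. X (int r - int j) \<omega> = h j) \<longleftrightarrow> (\<forall>j<Suc r. X (int j) \<omega> = u ! j)" for \<omega>
  proof
    assume a: "\<forall>j\<le>r. X (int r - int j) \<omega> = h j"
    show "\<forall>j<Suc r. X (int j) \<omega> = u ! j"
    proof (intro allI impI)
      fix j assume j: "j < Suc r"
      have "X (int r - int (r - j)) \<omega> = h (r - j)" using a by simp
      thus "X (int j) \<omega> = u ! j" using j by (simp add: h_def of_nat_diff)
    qed
  next
    assume a: "\<forall>j<Suc r. X (int j) \<omega> = u ! j"
    show "\<forall>j\<le>r. X (int r - int j) \<omega> = h j"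
    proof (intro allI impI)
      fix j assume j: "j \<le> r"
      have "X (int (r - j)) \<omega> = u ! (r - j)" using a by simp
      thus "X (int r - int j) \<omega> = h j" using j by (simp add: h_def of_nat_diff)
    qed
  qed
  have "(\<forall>j<Suc (Suc r). X (int j) \<omega> = w ! j) \<longleftrightarrow> (\<forall>j<Suc r. X (int j) \<omega> = u ! j) \<and> X (int r + 1) \<omega> = y" for \<omega>
  proof -
    have "(\<forall>j<Suc (Suc r). X (int j) \<omega> = w ! j) \<longleftrightarrow> (\<forall>j<Suc r. X (int j) \<omega> = w ! j) \<and> X (int (Suc r)) \<omega> = w ! Suc r"
      by (auto simp: less_Suc_eq)
    thus ?thesis unfolding u_def y_def by (simp add: add.commute)
  qed
  hence "measure M {\<omega> \<in> space M. \<forall>j<Suc (Suc r). X (int j) \<omega> = w ! j}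
     = measure M {\<omega> \<in> space M. \<forall>j<Suc r. X (int j) \<omega> = u ! j} * P (h 0) y"
    using mk unfolding past by simp
  also have "\<dots> = pw u * P (last u) y"
    using Suc.IH[OF u] une paths_length[OF u] unfolding h_def by (simp add: last_conv_nth)
  also have "\<dots> = pw w" unfolding w using une by (simp add: pw_append)
  finally show ?case .
qed

lemma sample_path_in_paths: "\<omega> \<in> space M \<Longrightarrow> sample_path X r \<omega> \<in> paths r"
  unfolding sample_path_def paths_def by (auto simp: X_in_S)

lemma sample_path_eq_iff:
  "length w = r \<Longrightarrow> sample_path X r \<omega> = w \<longleftrightarrow> (\<forall>j<r. X (int j) \<omega> = w ! j)"
  unfolding sample_path_def by (auto simp: list_eq_iff_nth_eq)

lemma measure_sample_path:
  assumes r: "r \<ge> 1"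
  shows "measure M {\<omega> \<in> space M. Q (sample_path X r \<omega>)} = (\<Sum>w\<in>paths r. pw w * of_bool (Q w))"
proof -
  interpret prob_space M by (rule prob_space_M)
  define E where "E w = {\<omega> \<in> space M. sample_path X r \<omega> = w}" for w
  have Eeq: "E w = {\<omega> \<in> space M. \<forall>j<r. X (int j) \<omega> = w ! j}" if "w \<in> paths r" for w
    unfolding E_def using sample_path_eq_iff[OF paths_length[OF that]] by simp
  have meas: "E w \<in> sets M" if "w \<in> paths r" for w
  proof -
    have "{\<omega> \<in> space M. \<forall>j\<in>{..<r}. X (int j) \<omega> = w ! j} \<in> sets M"
      by (rule sets.sets_Collect_finite_All) (auto intro: X_event)
    thus ?thesis unfolding Eeq[OF that] by (simp only: Ball_def lessThan_iff)
  qed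
  have law: "measure M (E w) = pw w" if "w \<in> paths r" for w
    using path_law[of w "r - 1"] r that unfolding Eeq[OF that] by simp
  have "{\<omega> \<in> space M. Q (sample_path X r \<omega>)} = (\<Union>w\<in>{w\<in>paths r. Q w}. E w)"
    unfolding E_def using sample_path_in_paths by auto
  also have "measure M \<dots> = (\<Sum>w\<in>{w\<in>paths r. Q w}. measure M (E w))"
    by (rule finite_measure_finite_Union) (auto simp: disjoint_family_on_def meas, auto simp: E_def)
  also have "\<dots> = (\<Sum>w\<in>paths r. pw w * of_bool (Q w))"
    by (rule sum.mono_neutral_cong_left) (auto simp: law)
  finally show ?thesis .
qed

context
  fixes n :: nat
  assumes n: "n \<ge> 1"
begin

text \<open>The joint law of the counts of two consecutive windows, as a sum over paths.\<close>

definition joint :: "('a \<Rightarrow> nat) \<Rightarrow> ('a \<Rightarrow> nat) \<Rightarrow> real" where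
  "joint k l = (\<Sum>w\<in>paths (n + 1). pw w * of_bool (count (mset (take n w)) = k \<and> count (mset (drop 1 w)) = l))"

lemma count_law_eq: "count_law M X n k = (\<Sum>w\<in>paths n. pw w * of_bool (count (mset w) = k))"
  unfolding count_law_def window_count_0[where r = 0]
  using measure_sample_path[OF n, of "\<lambda>w. count (mset (take n w)) = k"]
  by (simp add: paths_length cong: sum.cong)

lemma joint_eq: "measure M {\<omega> \<in> space M. window_count X n 0 \<omega> = k \<and> window_count X n 1 \<omega> = l} = joint k l"
  unfolding window_count_0[where r = 1] window_count_1 joint_def
  by (rule measure_sample_path) simp

lemma count_law_take: "count_law M X n k = (\<Sum>w\<in>paths (n + 1). pw w * of_bool (count (mset (take n w)) = k))"
  unfolding count_law_eq by (rule sum_pw_take[symmetric])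

lemma joint_nonneg: "0 \<le> joint k l"
  unfolding joint_def by (intro sum_nonneg mult_nonneg_nonneg) (auto simp: pw_nonneg)

lemma joint_sym: "joint k l = joint l k"
proof -
  have "joint k l = (\<Sum>w\<in>paths (n + 1). pw (rev w) * of_bool (count (mset (take n (rev w))) = k \<and> count (mset (drop 1 (rev w))) = l))"
    unfolding joint_def by (rule sum_paths_rev[symmetric])
  also have "\<dots> = joint l k"
    unfolding joint_def
    by (intro sum.cong refl) (auto simp: pw_rev paths_length take_rev drop_rev dest: paths_set)
  finally show ?thesis .
qed

lemma joint_le: "joint k l \<le> count_law M X n k"
  unfolding joint_def count_law_take by (intro sum_mono mult_left_mono) (auto simp: pw_nonneg)

lemma count_law_nonneg: "0 \<le> count_law M X n k"
  using joint_nonneg joint_le by (rule order_trans)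

lemma joint_outside: "k \<notin> count_support M X n \<or> l \<notin> count_support M X n \<Longrightarrow> joint k l = 0"
  using joint_le[of k l] joint_le[of l k] joint_nonneg[of k l] joint_sym[of k l]
  unfolding count_support_def by auto

lemma count_support_subset: "count_support M X n \<subseteq> (\<lambda>w. count (mset w)) ` paths n"
proof
  fix k assume "k \<in> count_support M X n"
  hence "count_law M X n k \<noteq> 0" unfolding count_support_def by auto
  then obtain w where "w \<in> paths n" "pw w * of_bool (count (mset w) = k) \<noteq> (0 :: real)"
    unfolding count_law_eq by (rule sum.not_neutral_contains_not_neutral)
  thus "k \<in> (\<lambda>w. count (mset w)) ` paths n" by (cases "count (mset w) = k") auto
qed

lemma finite_count_support: "finite (count_support M X n)"
  by (rule finite_subset[OF count_support_subset]) simp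

lemma sum_count_law:
  "(\<Sum>k\<in>count_support M X n. count_law M X n k * F k) = (\<Sum>w\<in>paths n. pw w * F (count (mset w)))"
proof -
  let ?I = "(\<lambda>w. count (mset w)) ` paths n"
  have "(\<Sum>k\<in>count_support M X n. count_law M X n k * F k) = (\<Sum>k\<in>?I. count_law M X n k * F k)"
    using count_law_nonneg
    by (intro sum.mono_neutral_left count_support_subset) (auto simp: count_support_def less_le)
  also have "\<dots> = (\<Sum>w\<in>paths n. \<Sum>k\<in>?I. pw w * of_bool (count (mset w) = k) * F k)"
    unfolding count_law_eq sum_distrib_right by (rule sum.swap)
  also have "\<dots> = (\<Sum>w\<in>paths n. pw w * F (count (mset w)))"
  proof (intro sum.cong refl)
    fix w assume w: "w \<in> paths n"
    have "(\<Sum>k\<in>?I. pw w * of_bool (count (mset w) = k) * F k)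
        = (\<Sum>k\<in>?I. if k = count (mset w) then pw w * F (count (mset w)) else 0)"
      by (intro sum.cong) auto
    thus "(\<Sum>k\<in>?I. pw w * of_bool (count (mset w) = k) * F k) = pw w * F (count (mset w))"
      using w by simp
  qed
  finally show ?thesis .
qed

lemma sum_joint:
  "(\<Sum>k\<in>count_support M X n. \<Sum>l\<in>count_support M X n. joint k l * F k l)
   = (\<Sum>w\<in>paths (n + 1). pw w * F (count (mset (take n w))) (count (mset (drop 1 w))))"
proof -
  let ?I = "(\<lambda>w. count (mset w)) ` paths n"
  have "(\<Sum>k\<in>count_support M X n. \<Sum>l\<in>count_support M X n. joint k l * F k l)
      = (\<Sum>k\<in>count_support M X n. \<Sum>l\<in>?I. joint k l * F k l)"
    by (intro sum.cong refl sum.mono_neutral_left count_support_subset) (auto simp: joint_outside)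
  also have "\<dots> = (\<Sum>k\<in>?I. \<Sum>l\<in>?I. joint k l * F k l)"
    by (intro sum.mono_neutral_left count_support_subset) (auto simp: joint_outside)
  also have "\<dots> = (\<Sum>k\<in>?I. \<Sum>w\<in>paths (n + 1). \<Sum>l\<in>?I.
      pw w * of_bool (count (mset (take n w)) = k \<and> count (mset (drop 1 w)) = l) * F k l)"
    unfolding joint_def sum_distrib_right by (intro sum.cong refl sum.swap)
  also have "\<dots> = (\<Sum>w\<in>paths (n + 1). \<Sum>k\<in>?I. \<Sum>l\<in>?I.
      pw w * of_bool (count (mset (take n w)) = k \<and> count (mset (drop 1 w)) = l) * F k l)"
    by (rule sum.swap)
  also have "\<dots> = (\<Sum>w\<in>paths (n + 1). pw w * F (count (mset (take n w))) (count (mset (drop 1 w))))"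
  proof (intro sum.cong refl)
    fix w assume w: "w \<in> paths (n + 1)"
    let ?a = "count (mset (take n w))" and ?b = "count (mset (drop 1 w))"
    have ab: "?a \<in> ?I" "?b \<in> ?I"
      using take_in_paths[OF w, of n] drop_in_paths[OF w, of 1] by auto
    have "(\<Sum>k\<in>?I. \<Sum>l\<in>?I. pw w * of_bool (?a = k \<and> ?b = l) * F k l)
        = (\<Sum>k\<in>?I. \<Sum>l\<in>?I. if l = ?b then (if k = ?a then pw w * F ?a ?b else 0) else 0)"
      by (intro sum.cong refl) auto
    also have "\<dots> = pw w * F ?a ?b" using ab by simp
    finally show "(\<Sum>k\<in>?I. \<Sum>l\<in>?I. pw w * of_bool (?a = k \<and> ?b = l) * F k l) = pw w * F ?a ?b" .
  qed
  finally show ?thesis .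
qed

lemma projected_kernel_eq: "projected_kernel M X n k l = joint k l / count_law M X n k"
  unfolding projected_kernel_def joint_eq ..

lemma law_projected_kernel:
  "k \<in> count_support M X n \<Longrightarrow> count_law M X n k * projected_kernel M X n k l = joint k l"
  unfolding projected_kernel_eq count_support_def by simp

lemma projected_reversible_chain:
  "reversible_chain (count_support M X n) (projected_kernel M X n) (count_law M X n)"
proof
  show "finite (count_support M X n)" by (rule finite_count_support)
  fix k assume k: "k \<in> count_support M X n"
  hence kpos: "0 < count_law M X n k" unfolding count_support_def by simp
  thus "0 < count_law M X n k" .
  show "0 \<le> projected_kernel M X n k l" for l
    unfolding projected_kernel_eq using joint_nonneg kpos by simp
  show "count_law M X n k * projected_kernel M X n k l = count_law M X n l * projected_kernel M X n l k"
    if "l \<in> count_support M X n" for l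
    using that k by (simp add: law_projected_kernel joint_sym)
  have "(\<Sum>l\<in>count_support M X n. joint k l)
      = (\<Sum>i\<in>count_support M X n. \<Sum>l\<in>count_support M X n. joint i l * of_bool (i = k))"
  proof -
    have "(\<Sum>i\<in>count_support M X n. \<Sum>l\<in>count_support M X n. joint i l * of_bool (i = k))
        = (\<Sum>i\<in>count_support M X n. if i = k then \<Sum>l\<in>count_support M X n. joint k l else 0)"
      by (intro sum.cong) auto
    thus ?thesis using k finite_count_support by simp
  qed
  also have "\<dots> = count_law M X n k" unfolding sum_joint count_law_take ..
  finally show "(\<Sum>l\<in>count_support M X n. projected_kernel M X n k l) = 1"
    unfolding projected_kernel_eq using kpos by (simp flip: sum_divide_distrib)
next
  show "(\<Sum>k\<in>count_support M X n. count_law M X n k) = 1"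
    using sum_count_law[of "\<lambda>_. 1"] sum_pw by simp
qed

theorem projected_gap_lower_bound:
  assumes two: "card S \<ge> 2" and gp: "gap S P > 0"
  shows "1 / (1080 * real (card S)) * (gap S P / real n) \<le> projected_gap M X n"
proof -
  let ?K = "count_support M X n"
  interpret K: reversible_chain ?K "projected_kernel M X n" "count_law M X n"
    by (rule projected_reversible_chain)
  let ?c = "1 / (1080 * real (card S)) * (gap S P / real n)"
  have pos: "0 < 1080 * real (card S) * real n" using two n by simp
  have K0: "card ?K \<noteq> 0"
    using K.pi_sum K.finite_S by (metis card_0_eq sum.empty zero_neq_one)
  show ?thesis
  proof (cases "card ?K = 1")
    case True
    have "1 * 1 \<le> real (card S) * real n" using two n by (intro mult_mono) auto
    hence "gap S P \<le> 2 * (real (card S) * real n)" using gap_le_2[OF two] by linarith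
    hence "?c \<le> 1" using pos by (simp add: field_simps)
    thus ?thesis using True unfolding projected_gap_def gap_def[of ?K] by simp
  next
    case False
    hence two': "card ?K \<ge> 2" using K0 by linarith
    show ?thesis unfolding projected_gap_def
    proof (rule K.gap_geI[OF two'])
      fix g :: "('a \<Rightarrow> nat) \<Rightarrow> real" assume mean: "K.ip (\<lambda>_. 1) g = 0"
      define f where "f A = g (count A)" for A :: "'a multiset"
      have m0: "(\<Sum>w\<in>paths n. pw w * f (mset w)) = 0"
        using mean sum_count_law[of g] unfolding K.ip_def f_def by simp
      have V: "K.ip g g = (\<Sum>w\<in>paths n. pw w * (f (mset w))\<^sup>2)"
        using sum_count_law[of "\<lambda>k. (g k)\<^sup>2"] unfolding K.ip_def f_def by (simp add: power2_eq_square mult.assoc)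
      have "2 * (K.ip g g - K.ip g (K.step g)) = (\<Sum>k\<in>?K. \<Sum>l\<in>?K. joint k l * (g k - g l)\<^sup>2)"
        unfolding K.dirichlet_form_eq[symmetric] by (intro sum.cong refl) (simp add: law_projected_kernel)
      also have "\<dots> = shift_energy f n" unfolding sum_joint shift_energy_def f_def ..
      finally have D: "shift_energy f n = 2 * (K.ip g g - K.ip g (K.step g))" by simp
      have "K.ip g g \<le> 540 * real (card S) * real n / gap S P * (2 * (K.ip g g - K.ip g (K.step g)))"
        using poincare_window[OF two gp n m0] unfolding V[symmetric] D .
      hence "?c * K.ip g g \<le> ?c * (540 * real (card S) * real n / gap S P * (2 * (K.ip g g - K.ip g (K.step g))))"
        using gp pos by (intro mult_left_mono) auto
      also have "\<dots> = K.ip g g - K.ip g (K.step g)" using gp two n by simp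
      finally show "?c * K.ip g g \<le> K.ip g g - K.ip g (K.step g)" .
    qed
  qed
qed

end

end

lemma projected_gap_ge:
  assumes "irreducible_reversible_kernel S P \<pi>" "stationary_markov_chain S P \<pi> M X"
    and "card S \<ge> 2" "n \<ge> 1"
  shows "1 / (1080 * real (card S)) * (gap S P / real n) \<le> projected_gap M X n" and "0 < gap S P"
proof -
  interpret stationary_chain S P \<pi> M X
    using irreducible_kernel_reversible_chain[OF assms(1)] assms(2)
    by (intro stationary_chain.intro) (auto simp: stationary_chain_axioms_def)
  show gp: "0 < gap S P"
    using assms(1) by (intro gap_pos[OF assms(3)]) (simp add: irreducible_reversible_kernel_def)
  show "1 / (1080 * real (card S)) * (gap S P / real n) \<le> projected_gap M X n"
    by (rule projected_gap_lower_bound[OF assms(4,3) gp])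
qed

section \<open>Independent uniform samples\<close>

text \<open>The infimum of an empty set of reals carries no information, so the set of ratios must be shown
  to be nonempty. Independent uniform samples from m points provide a member.\<close>

definition uniform_samples :: "nat \<Rightarrow> (int \<Rightarrow> nat) measure" where
  "uniform_samples m = Pi\<^sub>M UNIV (\<lambda>_. uniform_count_measure {..<m})"

lemma uniform_samples_cylinder:
  assumes m: "m \<ge> 1" and J: "finite J" and g: "\<And>i. i \<in> J \<Longrightarrow> g i < m"
  shows "measure (uniform_samples m) {\<omega> \<in> space (uniform_samples m). \<forall>i\<in>J. \<omega> i = g i} = (1 / real m) ^ card J"
proof -
  have ps: "prob_space (uniform_count_measure {..<m})"
    using m by (intro prob_space_uniform_count_measure) (auto simp: lessThan_empty_iff)
  interpret product_prob_space "\<lambda>_::int. uniform_count_measure {..<m}" UNIV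
    by (intro product_prob_spaceI ps)
  have cyl: "{\<omega> \<in> space (uniform_samples m). \<forall>i\<in>J. \<omega> i = g i}
     = prod_emb UNIV (\<lambda>_. uniform_count_measure {..<m}) J (\<Pi>\<^sub>E i\<in>J. {g i})"
    unfolding uniform_samples_def prod_emb_def space_PiM
    by (auto simp: space_uniform_count_measure PiE_iff restrict_def extensional_def)
  have point: "emeasure (uniform_count_measure {..<m}) {g i} = ennreal (1 / real m)" if "i \<in> J" for i
    using g[OF that] by (subst emeasure_uniform_count_measure) auto
  have "emeasure (uniform_samples m) {\<omega> \<in> space (uniform_samples m). \<forall>i\<in>J. \<omega> i = g i}
     = (\<Prod>i\<in>J. emeasure (uniform_count_measure {..<m}) {g i})"
    unfolding cyl unfolding uniform_samples_def
    by (rule emeasure_PiM_emb) (use J g in \<open>auto simp: sets_uniform_count_measure\<close>)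
  also have "\<dots> = (\<Prod>i\<in>J. ennreal (1 / real m))" by (rule prod.cong[OF refl point])
  also have "\<dots> = ennreal ((1 / real m) ^ card J)" by (simp add: ennreal_power)
  finally show ?thesis by (simp add: measure_def)
qed

lemma uniform_samples_chain:
  assumes m: "m \<ge> 1"
  shows "stationary_markov_chain {..<m} (\<lambda>_ _. 1 / real m) (\<lambda>_. 1 / real m) (uniform_samples m) (\<lambda>t \<omega>. \<omega> t)"
  unfolding stationary_markov_chain_def
proof (intro conjI allI impI ballI)
  have ps: "prob_space (uniform_count_measure {..<m})"
    using m by (intro prob_space_uniform_count_measure) (auto simp: lessThan_empty_iff)
  show "prob_space (uniform_samples m)" unfolding uniform_samples_def by (rule prob_space_PiM) (rule ps)
  fix t :: int
  have "(\<lambda>\<omega>. \<omega> t) \<in> measurable (uniform_samples m) (uniform_count_measure {..<m})"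
    unfolding uniform_samples_def by (rule measurable_component_singleton) simp
  moreover have "measurable (uniform_samples m) (uniform_count_measure {..<m}) = measurable (uniform_samples m) (count_space {..<m})"
    by (rule measurable_cong_sets) (auto simp: sets_uniform_count_measure_count_space)
  ultimately show "(\<lambda>\<omega>. \<omega> t) \<in> measurable (uniform_samples m) (count_space {..<m})" by simp
  show "measure (uniform_samples m) {\<omega> \<in> space (uniform_samples m). \<omega> t = x} = 1 / real m" if "x \<in> {..<m}" for x
    using uniform_samples_cylinder[OF m, of "{t}" "\<lambda>_. x"] that by simp
  fix r :: nat and h and y assume h: "\<forall>j\<le>r. h j \<in> {..<m}" and y: "y \<in> {..<m}"
  define J where "J = (\<lambda>j. t - int j) ` {..r}"
  define g where "g i = (if i = t + 1 then y else h (nat (t - i)))" for i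
  have J: "finite J" "t + 1 \<notin> J" unfolding J_def by auto
  have gJ: "g i < m" if "i \<in> insert (t + 1) J" for i
    using that h y unfolding g_def J_def by auto
  have 1: "(\<forall>i\<in>J. \<omega> i = g i) \<longleftrightarrow> (\<forall>j\<le>r. \<omega> (t - int j) = h j)" for \<omega> :: "int \<Rightarrow> nat"
    unfolding J_def g_def by auto
  have 2: "(\<forall>i\<in>insert (t + 1) J. \<omega> i = g i) \<longleftrightarrow> (\<forall>j\<le>r. \<omega> (t - int j) = h j) \<and> \<omega> (t + 1) = y" for \<omega> :: "int \<Rightarrow> nat"
    using 1[of \<omega>] unfolding g_def by auto
  show "measure (uniform_samples m) {\<omega> \<in> space (uniform_samples m). (\<forall>j\<le>r. \<omega> (t - int j) = h j) \<and> \<omega> (t + 1) = y}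
     = measure (uniform_samples m) {\<omega> \<in> space (uniform_samples m). \<forall>j\<le>r. \<omega> (t - int j) = h j} * (1 / real m)"
    using uniform_samples_cylinder[OF m, of "insert (t + 1) J" g, unfolded 2]
      uniform_samples_cylinder[OF m J(1), of g, unfolded 1] J gJ
    by simp
qed

lemma uniform_kernel_irreducible_reversible:
  assumes m: "m \<ge> 1"
  shows "irreducible_reversible_kernel {..<m} (\<lambda>_ _. 1 / real m) (\<lambda>_. 1 / real m)"
  using m unfolding irreducible_reversible_kernel_def stochastic_on_def irreducible_on_def
    stationary_law_def reversible_on_def by auto

section \<open>The bound for the count kernel\<close>

theorem theorem9p1:
  fixes m :: nat
  assumes "m \<ge> 2"
  shows "(\<forall>(S :: 'a set) P \<pi> (M :: 'w measure) X n.
            card S = m \<and> irreducible_reversible_kernel S P \<pi> \<and>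
            stationary_markov_chain S P \<pi> M X \<and> n \<ge> 1 \<longrightarrow>
            projected_gap M X n \<ge> 1 / (1080 * real m) * (gap S P / real n))
       \<and> c_star m \<ge> 1 / (1080 * real m)
       \<and> C_opt m \<le> 1080 * real m"
proof -
  have cs: "1 / (1080 * real m) \<le> c_star m"
    unfolding c_star_def
  proof (rule cInf_greatest)
    have "card {..<m} = m \<and> irreducible_reversible_kernel {..<m} (\<lambda>_ _. 1 / real m) (\<lambda>_. 1 / real m)
      \<and> stationary_markov_chain {..<m} (\<lambda>_ _. 1 / real m) (\<lambda>_. 1 / real m) (uniform_samples m) (\<lambda>t \<omega>. \<omega> t)
      \<and> (2::nat) \<ge> 2"
      using uniform_kernel_irreducible_reversible[of m] uniform_samples_chain[of m] assms by auto
    thus "{real n * projected_gap M X n / gap S P | S P \<pi> M X n.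
     card S = m \<and> irreducible_reversible_kernel S P \<pi> \<and>
     stationary_markov_chain S P \<pi> (M :: (int \<Rightarrow> nat) measure) (X :: int \<Rightarrow> (int \<Rightarrow> nat) \<Rightarrow> nat) \<and>
     n \<ge> 2} \<noteq> {}" by blast
  next
    fix c assume "c \<in> {real n * projected_gap M X n / gap S P | S P \<pi> M X n.
     card S = m \<and> irreducible_reversible_kernel S P \<pi> \<and>
     stationary_markov_chain S P \<pi> (M :: (int \<Rightarrow> nat) measure) (X :: int \<Rightarrow> (int \<Rightarrow> nat) \<Rightarrow> nat) \<and>
     n \<ge> 2}"
    then obtain S P \<pi> n and M :: "(int \<Rightarrow> nat) measure" and X :: "int \<Rightarrow> (int \<Rightarrow> nat) \<Rightarrow> nat"
      where c: "c = real n * projected_gap M X n / gap S P" and S: "card S = m"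
        and k: "irreducible_reversible_kernel S P \<pi>" "stationary_markov_chain S P \<pi> M X" and n: "n \<ge> 2"
      by blast
    have two: "card S \<ge> 2" "n \<ge> 1" using S assms n by auto
    have "real n * (1 / (1080 * real m) * (gap S P / real n)) / gap S P \<le> c"
      unfolding c using projected_gap_ge[OF k two] S by (intro divide_right_mono mult_left_mono) auto
    thus "1 / (1080 * real m) \<le> c" using projected_gap_ge(2)[OF k two] n by simp
  qed
  have "inverse (c_star m) \<le> inverse (1 / (1080 * real m))"
    using cs assms by (intro le_imp_inverse_le) auto
  hence "C_opt m \<le> 1080 * real m" unfolding C_opt_def by simp
  thus ?thesis using cs projected_gap_ge(1) assms by blast
qed

end
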